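(* Let $L$ be a Lie algebra over a field $\mathbb K$ of characteristic $0$ with $\dim H^2(L;L)<\infty$, and let $C$ be the base of the miniversal formal deformation of $L$. Then $C$ is formally embedded in $H^2(L;L)$, that is, it may be described in $H^2(L;L)$ by a finite system of formal equations: there is a finitely generated ideal $I$ of the formal power series algebra $\mathbb K[[H^2(L;L)']]$ such that $C\cong\mathbb K[[H^2(L;L)']]/I$.
   Context: $V'$ denotes the dual of a vector space $V$; $\mathbb K[[H^2(L;L)']]$ is the algebra of formal power series on the finite-dimensional space $H^2(L;L)$ (formal power series in a basis of the dual space). $H^q(L;L)$ is Chevalley–Eilenberg cohomology with adjoint coefficients. A complete local base is a commutative local unital $\mathbb K$-algebra $A$ with maximal ideal $\mathfrak m$, augmentation $\varepsilon\colon A\to A/\mathfrak m=\mathbb K$, $A=\varprojlim A/\mathfrak m^n$, and $\dim(\mathfrak m^k/\mathfrak m^{k+1})<\infty$ for all $k$. A formal deformation of $L$ with base $A$ is a Lie $A$-algebra structure on $A\hat\otimes L=\varprojlim((A/\mathfrak m^n)\otimes_{\mathbb K} L)$ such that $\varepsilon\hat\otimes\mathrm{id}\colon A\hat\otimes L\to L$ is a Lie algebra homomorphism. Two formal deformations with base $A$ are equivalent if there is an isomorphism of Lie $A$-algebras between them compatible with $\varepsilon\hat\otimes\mathrm{id}$. For a unital augmentation-preserving homomorphism $f\colon B\to A$ and a formal deformation $\eta$ with base $B$, the push-out $f_*\eta$ is the formal deformation with base $A$ obtained by extension of scalars along $f$. A formal deformation $\eta$ of $L$ with base $B$ is miniversal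 if (i) for any formal deformation $\lambda$ of $L$ with any complete local base $A$ there is a homomorphism $f\colon B\to A$ such that $\lambda$ is equivalent to $f_*\eta$; and (ii) if in (i) the maximal ideal of $A$ satisfies $\mathfrak m^2=0$, then $f$ is unique. When $\dim H^2(L;L)<\infty$ a miniversal formal deformation exists, and its base is unique up to isomorphism. *)

theory Defs
  imports "HOL-Library.Multiset" "HOL-Algebra.Algebraic_Closure_Type" "HOL-Algebra.Algebra"
begin

text \<open>
  The ground field is a type of class \<open>field\<close> and the Lie algebra \<open>L\<close> is a type with a scalar
  multiplication \<open>sc\<close> and a bracket \<open>br\<close>. All other vector spaces, algebras and modules are
  HOL-Algebra records over the ground field, seen as a record through \<^const>\<open>ring_of_type_algebra\<close>.
  In records that are only modules, the fields \<open>mult\<close> and \<open>one\<close> are left \<^const>\<open>undefined\<close>.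
\<close>

locale lie_algebra = vector_space sc
  for sc :: "'k::field \<Rightarrow> 'l::ab_group_add \<Rightarrow> 'l" +
  fixes br :: "'l \<Rightarrow> 'l \<Rightarrow> 'l"
  assumes br_linear_left: "Vector_Spaces.linear sc sc (\<lambda>x. br x y)"
    and br_linear_right: "Vector_Spaces.linear sc sc (\<lambda>y. br x y)"
    and br_self: "br x x = 0"
    and jacobi: "br x (br y z) + br y (br z x) + br z (br x y) = 0"


section \<open>Vector spaces as records\<close>

definition is_basis :: "('k::field, 'v) module \<Rightarrow> 'v set \<Rightarrow> bool" where
  "is_basis V S \<longleftrightarrow> S \<subseteq> carrier V \<and>
     (\<forall>v\<in>carrier V. \<exists>!c. finite {x. c x \<noteq> 0} \<and> {x. c x \<noteq> 0} \<subseteq> S \<and>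
        v = finsum V (\<lambda>x. c x \<odot>\<^bsub>V\<^esub> x) {x. c x \<noteq> 0})"

definition finite_dimensional :: "('k::field, 'v) module \<Rightarrow> bool" where
  "finite_dimensional V \<longleftrightarrow> (\<exists>S. finite S \<and> is_basis V S)"

text \<open>\<open>U / W\<close> for subspaces \<open>W \<subseteq> U\<close> of \<open>V\<close>.\<close>

definition subquotient :: "('k, 'v) module \<Rightarrow> 'v set \<Rightarrow> 'v set \<Rightarrow> ('k, 'v set) module" where
  "subquotient V U W =
     \<lparr>carrier = (\<lambda>u. W +>\<^bsub>V\<^esub> u) ` U, monoid.mult = undefined, monoid.one = undefined,
      ring.zero = W, ring.add = set_add V, module.smult = (\<lambda>c Y. \<Union>x\<in>Y. W +>\<^bsub>V\<^esub> (c \<odot>\<^bsub>V\<^esub> x))\<rparr>"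

text \<open>Functionals are extended by \<open>0\<close> outside the carrier, so that equality is equality on it.\<close>

definition dual :: "('k::field, 'v) module \<Rightarrow> ('k, 'v \<Rightarrow> 'k) module" where
  "dual V =
     \<lparr>carrier = {\<xi>. (\<forall>v\<in>carrier V. \<forall>w\<in>carrier V. \<xi> (v \<oplus>\<^bsub>V\<^esub> w) = \<xi> v + \<xi> w) \<and>
                    (\<forall>c. \<forall>v\<in>carrier V. \<xi> (c \<odot>\<^bsub>V\<^esub> v) = c * \<xi> v) \<and>
                    (\<forall>v. v \<notin> carrier V \<longrightarrow> \<xi> v = 0)},
      monoid.mult = undefined, monoid.one = undefined,
      ring.zero = (\<lambda>v. 0), ring.add = (\<lambda>\<xi> \<zeta> v. \<xi> v + \<zeta> v), module.smult = (\<lambda>c \<xi> v. c * \<xi> v)\<rparr>"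


section \<open>Chevalley--Eilenberg cohomology with adjoint coefficients\<close>

text \<open>A \<open>q\<close>-cochain is an alternating \<open>q\<close>-linear map; its arguments form a list of length \<open>q\<close>, and
  it is extended by \<open>0\<close> to lists of other lengths.\<close>

definition cochains :: "('k::field \<Rightarrow> 'l::ab_group_add \<Rightarrow> 'l) \<Rightarrow> nat \<Rightarrow> ('k, 'l list \<Rightarrow> 'l) module"
  where
  "cochains sc q =
     \<lparr>carrier = {\<phi>. (\<forall>xs. \<forall>i<q. length xs = q \<longrightarrow>
                          Vector_Spaces.linear sc sc (\<lambda>y. \<phi> (xs[i := y]))) \<and>
                    (\<forall>xs. \<forall>j<q. \<forall>i<j. length xs = q \<and> xs ! i = xs ! j \<longrightarrow> \<phi> xs = 0) \<and>
                    (\<forall>xs. length xs \<noteq> q \<longrightarrow> \<phi> xs = 0)},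
      monoid.mult = undefined, monoid.one = undefined,
      ring.zero = (\<lambda>xs. 0), ring.add = (\<lambda>\<phi> \<psi> xs. \<phi> xs + \<psi> xs), module.smult = (\<lambda>c \<phi> xs. sc c (\<phi> xs))\<rparr>"

definition coboundary_map ::
  "('k::field \<Rightarrow> 'l::ab_group_add \<Rightarrow> 'l) \<Rightarrow> ('l \<Rightarrow> 'l \<Rightarrow> 'l) \<Rightarrow> nat \<Rightarrow> ('l list \<Rightarrow> 'l) \<Rightarrow> 'l list \<Rightarrow> 'l"
  where
  "coboundary_map sc br q \<phi> xs =
     (if length xs = Suc q then
        (\<Sum>i\<le>q. sc ((-1) ^ i) (br (xs ! i) (\<phi> (nths xs (- {i}))))) +
        (\<Sum>j\<le>q. \<Sum>i<j. sc ((-1) ^ (i + j)) (\<phi> (br (xs ! i) (xs ! j) # nths xs (- {i, j}))))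
      else 0)"

definition cocycles ::
  "('k::field \<Rightarrow> 'l::ab_group_add \<Rightarrow> 'l) \<Rightarrow> ('l \<Rightarrow> 'l \<Rightarrow> 'l) \<Rightarrow> nat \<Rightarrow> ('l list \<Rightarrow> 'l) set" where
  "cocycles sc br q = {\<phi> \<in> carrier (cochains sc q). coboundary_map sc br q \<phi> = (\<lambda>xs. 0)}"

fun coboundaries ::
  "('k::field \<Rightarrow> 'l::ab_group_add \<Rightarrow> 'l) \<Rightarrow> ('l \<Rightarrow> 'l \<Rightarrow> 'l) \<Rightarrow> nat \<Rightarrow> ('l list \<Rightarrow> 'l) set" where
  "coboundaries sc br 0 = {\<lambda>xs. 0}"
| "coboundaries sc br (Suc q) = coboundary_map sc br q ` carrier (cochains sc q)"

definition cohomology ::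
  "('k::field \<Rightarrow> 'l::ab_group_add \<Rightarrow> 'l) \<Rightarrow> ('l \<Rightarrow> 'l \<Rightarrow> 'l) \<Rightarrow> nat \<Rightarrow> ('k, ('l list \<Rightarrow> 'l) set) module"
  where
  "cohomology sc br q = subquotient (cochains sc q) (cocycles sc br q) (coboundaries sc br q)"


section \<open>Algebras and complete local bases\<close>

text \<open>\<^term>\<open>A Quot I\<close> as an algebra over the ground field.\<close>

definition quot_algebra :: "('k, 'a) module \<Rightarrow> 'a set \<Rightarrow> ('k, 'a set) module" where
  "quot_algebra A I =
     \<lparr>carrier = carrier (A Quot I), monoid.mult = monoid.mult (A Quot I),
      monoid.one = monoid.one (A Quot I),
      ring.zero = ring.zero (A Quot I), ring.add = ring.add (A Quot I),
      module.smult = (\<lambda>c Y. \<Union>x\<in>Y. I +>\<^bsub>A\<^esub> (c \<odot>\<^bsub>A\<^esub> x))\<rparr>"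

definition algebra_isomorphic :: "('k, 'a) module \<Rightarrow> ('k, 'b) module \<Rightarrow> bool" where
  "algebra_isomorphic A B \<longleftrightarrow>
     (\<exists>h\<in>ring_iso A B. \<forall>c. \<forall>a\<in>carrier A. h (c \<odot>\<^bsub>A\<^esub> a) = c \<odot>\<^bsub>B\<^esub> h a)"

text \<open>The map of quotients \<open>B / I \<rightarrow> A / J\<close> induced by an additive map \<open>f : B \<rightarrow> A\<close> with
  \<open>f(I) \<subseteq> J\<close>; a coset \<open>Y\<close> of \<open>I\<close> is sent to the coset \<open>J + f(Y)\<close> of \<open>J\<close>.\<close>

definition coset_map :: "('k, 'a) module \<Rightarrow> 'a set \<Rightarrow> ('b \<Rightarrow> 'a) \<Rightarrow> 'b set \<Rightarrow> 'a set" where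
  "coset_map A J f Y = J <+>\<^bsub>A\<^esub> (f ` Y)"

definition max_ideal :: "('k, 'a) module \<Rightarrow> 'a set" where
  "max_ideal A = (THE I. maximalideal I A)"

primrec max_power :: "('k, 'a) module \<Rightarrow> nat \<Rightarrow> 'a set" where
  "max_power A 0 = carrier A"
| "max_power A (Suc n) = ideal_prod A (max_ideal A) (max_power A n)"

definition truncation :: "('k, 'a) module \<Rightarrow> nat \<Rightarrow> ('k, 'a set) module" where
  "truncation A n = quot_algebra A (max_power A n)"

text \<open>The conditions after locality: the composite of the structure map into \<open>A\<close> with the
  projection onto \<open>A / \<mm>\<close> is bijective; the canonical map of \<open>A\<close> into the inverse limit of the
  \<open>A / \<mm>\<^sup>n\<close> is bijective; the \<open>\<mm>\<^sup>k / \<mm>\<^sup>k\<^sup>+\<^sup>1\<close> are finite-dimensional.\<close>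

definition complete_local_base :: "('k::field, 'a) module \<Rightarrow> bool" where
  "complete_local_base A \<longleftrightarrow>
     algebra (ring_of_type_algebra :: 'k ring) A \<and>
     (\<exists>!I. maximalideal I A) \<and>
     bij_betw (\<lambda>c. max_ideal A +>\<^bsub>A\<^esub> (c \<odot>\<^bsub>A\<^esub> \<one>\<^bsub>A\<^esub>)) UNIV (carrier (A Quot max_ideal A)) \<and>
     (\<forall>x. (\<forall>n. x n \<in> carrier (truncation A n)) \<and>
          (\<forall>n. coset_map A (max_power A n) (\<lambda>a. a) (x (Suc n)) = x n) \<longrightarrow>
          (\<exists>!a. a \<in> carrier A \<and> (\<forall>n. x n = max_power A n +>\<^bsub>A\<^esub> a))) \<and>
     (\<forall>k. finite_dimensional (subquotient A (max_power A k) (max_power A (Suc k))))"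

text \<open>\<open>\<epsilon> : A \<rightarrow> A / \<mm> = \<K>\<close>.\<close>

definition augmentation :: "('k, 'a) module \<Rightarrow> 'a \<Rightarrow> 'k" where
  "augmentation A a = (THE c. max_ideal A +>\<^bsub>A\<^esub> a = max_ideal A +>\<^bsub>A\<^esub> (c \<odot>\<^bsub>A\<^esub> \<one>\<^bsub>A\<^esub>))"

definition base_hom :: "('k, 'b) module \<Rightarrow> ('k, 'a) module \<Rightarrow> ('b \<Rightarrow> 'a) \<Rightarrow> bool" where
  "base_hom B A f \<longleftrightarrow> f \<in> ring_hom B A \<and>
     (\<forall>c. \<forall>b\<in>carrier B. f (c \<odot>\<^bsub>B\<^esub> b) = c \<odot>\<^bsub>A\<^esub> f b) \<and>
     (\<forall>b\<in>carrier B. augmentation A (f b) = augmentation B b)"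


section \<open>The completed tensor product of a base with \<open>L\<close>\<close>

text \<open>
  Over a field, \<open>V \<otimes> L\<close> embeds into the space of functionals on the space \<open>Bil(V, L; \<K>)\<close> of
  bilinear forms: \<open>v \<otimes> l\<close> is the evaluation \<open>\<beta> \<mapsto> \<beta>(v, l)\<close>, and \<open>V \<otimes> L\<close> is the set of finite
  sums of such evaluations. The map \<open>f \<otimes> id\<close> is then given by pulling back bilinear forms along \<open>f\<close>.
\<close>

definition bilinear_forms ::
  "('k::field \<Rightarrow> 'l::ab_group_add \<Rightarrow> 'l) \<Rightarrow> ('k, 'v) module \<Rightarrow> ('v \<Rightarrow> 'l \<Rightarrow> 'k) set" where
  "bilinear_forms sc V =
     {\<beta>. (\<forall>v\<in>carrier V. Vector_Spaces.linear sc (*) (\<beta> v)) \<and>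
         (\<forall>v\<in>carrier V. \<forall>w\<in>carrier V. \<forall>l. \<beta> (v \<oplus>\<^bsub>V\<^esub> w) l = \<beta> v l + \<beta> w l) \<and>
         (\<forall>c. \<forall>v\<in>carrier V. \<forall>l. \<beta> (c \<odot>\<^bsub>V\<^esub> v) l = c * \<beta> v l) \<and>
         (\<forall>v l. v \<notin> carrier V \<longrightarrow> \<beta> v l = 0)}"

type_synonym ('k, 'v, 'l) tensor = "('v \<Rightarrow> 'l \<Rightarrow> 'k) \<Rightarrow> 'k"

definition pure_tensor ::
  "('k::field \<Rightarrow> 'l::ab_group_add \<Rightarrow> 'l) \<Rightarrow> ('k, 'v) module \<Rightarrow> 'v \<Rightarrow> 'l \<Rightarrow> ('k, 'v, 'l) tensor" where
  "pure_tensor sc V v l = (\<lambda>\<beta>. if \<beta> \<in> bilinear_forms sc V then \<beta> v l else 0)"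

definition tensors ::
  "('k::field \<Rightarrow> 'l::ab_group_add \<Rightarrow> 'l) \<Rightarrow> ('k, 'v) module \<Rightarrow> ('k, 'v, 'l) tensor set" where
  "tensors sc V =
     {\<lambda>\<beta>. \<Sum>i<n. pure_tensor sc V (v i) (l i) \<beta> | (n::nat) v l. \<forall>i<n. v i \<in> carrier V}"

definition tensor_map ::
  "('k::field \<Rightarrow> 'l::ab_group_add \<Rightarrow> 'l) \<Rightarrow> ('k, 'v) module \<Rightarrow> ('k, 'w) module \<Rightarrow> ('v \<Rightarrow> 'w) \<Rightarrow>
     ('k, 'v, 'l) tensor \<Rightarrow> ('k, 'w, 'l) tensor" where
  "tensor_map sc V W f u =
     (\<lambda>\<beta>. if \<beta> \<in> bilinear_forms sc W then u (\<lambda>v l. if v \<in> carrier V then \<beta> (f v) l else 0) else 0)"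

type_synonym ('k, 'a, 'l) ctensor = "nat \<Rightarrow> ('k, 'a set, 'l) tensor"

text \<open>The inverse limit of the \<open>(A / \<mm>\<^sup>n) \<otimes> L\<close>, as a module over \<open>A\<close>.\<close>

definition completed_tensor ::
  "('k::field \<Rightarrow> 'l::ab_group_add \<Rightarrow> 'l) \<Rightarrow> ('k, 'a) module \<Rightarrow> ('a, ('k, 'a, 'l) ctensor) module" where
  "completed_tensor sc A =
     \<lparr>carrier = {u. (\<forall>n. u n \<in> tensors sc (truncation A n)) \<and>
                    (\<forall>n. tensor_map sc (truncation A (Suc n)) (truncation A n)
                           (coset_map A (max_power A n) (\<lambda>a. a)) (u (Suc n)) = u n)},
      monoid.mult = undefined, monoid.one = undefined,
      ring.zero = (\<lambda>n \<beta>. 0), ring.add = (\<lambda>u v n \<beta>. u n \<beta> + v n \<beta>),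
      module.smult = (\<lambda>a u n. tensor_map sc (truncation A n) (truncation A n)
                         (coset_map A (max_power A n) (\<lambda>x. a \<otimes>\<^bsub>A\<^esub> x)) (u n))\<rparr>"

text \<open>\<open>\<epsilon> \<otimes> id\<close>: the component \<open>u 1\<close> lies in \<open>(A / \<mm>) \<otimes> L = \<K> \<otimes> L\<close>, which is identified with
  \<open>L\<close> through \<open>x \<mapsto> 1 \<otimes> x\<close>.\<close>

definition tensor_augmentation ::
  "('k::field \<Rightarrow> 'l::ab_group_add \<Rightarrow> 'l) \<Rightarrow> ('k, 'a) module \<Rightarrow> ('k, 'a, 'l) ctensor \<Rightarrow> 'l" where
  "tensor_augmentation sc A u =
     (THE x. u 1 = pure_tensor sc (truncation A 1) \<one>\<^bsub>truncation A 1\<^esub> x)"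

text \<open>\<open>f \<otimes> id\<close> on the completed tensor products, for a homomorphism of bases \<open>f : B \<rightarrow> A\<close>.\<close>

definition completed_tensor_map ::
  "('k::field \<Rightarrow> 'l::ab_group_add \<Rightarrow> 'l) \<Rightarrow> ('k, 'b) module \<Rightarrow> ('k, 'a) module \<Rightarrow> ('b \<Rightarrow> 'a) \<Rightarrow>
     ('k, 'b, 'l) ctensor \<Rightarrow> ('k, 'a, 'l) ctensor" where
  "completed_tensor_map sc B A f u =
     (\<lambda>n. tensor_map sc (truncation B n) (truncation A n) (coset_map A (max_power A n) f) (u n))"


section \<open>Formal deformations\<close>

locale lie_algebra_over = module R M
  for R :: "('a, 'r) ring_scheme" (structure) and M :: "('a, 'm, 's) module_scheme" (structure) +
  fixes \<mu> :: "'m \<Rightarrow> 'm \<Rightarrow> 'm"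
  assumes bracket_closed: "\<lbrakk>u \<in> carrier M; v \<in> carrier M\<rbrakk> \<Longrightarrow> \<mu> u v \<in> carrier M"
    and bracket_add_left: "\<lbrakk>u \<in> carrier M; v \<in> carrier M; w \<in> carrier M\<rbrakk> \<Longrightarrow>
           \<mu> (u \<oplus>\<^bsub>M\<^esub> v) w = \<mu> u w \<oplus>\<^bsub>M\<^esub> \<mu> v w"
    and bracket_add_right: "\<lbrakk>u \<in> carrier M; v \<in> carrier M; w \<in> carrier M\<rbrakk> \<Longrightarrow>
           \<mu> u (v \<oplus>\<^bsub>M\<^esub> w) = \<mu> u v \<oplus>\<^bsub>M\<^esub> \<mu> u w"
    and bracket_smult_left: "\<lbrakk>a \<in> carrier R; u \<in> carrier M; v \<in> carrier M\<rbrakk> \<Longrightarrow>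
           \<mu> (a \<odot>\<^bsub>M\<^esub> u) v = a \<odot>\<^bsub>M\<^esub> \<mu> u v"
    and bracket_smult_right: "\<lbrakk>a \<in> carrier R; u \<in> carrier M; v \<in> carrier M\<rbrakk> \<Longrightarrow>
           \<mu> u (a \<odot>\<^bsub>M\<^esub> v) = a \<odot>\<^bsub>M\<^esub> \<mu> u v"
    and bracket_self: "u \<in> carrier M \<Longrightarrow> \<mu> u u = \<zero>\<^bsub>M\<^esub>"
    and bracket_jacobi: "\<lbrakk>u \<in> carrier M; v \<in> carrier M; w \<in> carrier M\<rbrakk> \<Longrightarrow>
           \<mu> u (\<mu> v w) \<oplus>\<^bsub>M\<^esub> \<mu> v (\<mu> w u) \<oplus>\<^bsub>M\<^esub> \<mu> w (\<mu> u v) = \<zero>\<^bsub>M\<^esub>"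

definition formal_deformation ::
  "('k::field \<Rightarrow> 'l::ab_group_add \<Rightarrow> 'l) \<Rightarrow> ('l \<Rightarrow> 'l \<Rightarrow> 'l) \<Rightarrow> ('k, 'a) module \<Rightarrow>
     (('k, 'a, 'l) ctensor \<Rightarrow> ('k, 'a, 'l) ctensor \<Rightarrow> ('k, 'a, 'l) ctensor) \<Rightarrow> bool" where
  "formal_deformation sc br A \<mu> \<longleftrightarrow>
     lie_algebra_over A (completed_tensor sc A) \<mu> \<and>
     (\<forall>u\<in>carrier (completed_tensor sc A). \<forall>v\<in>carrier (completed_tensor sc A).
        tensor_augmentation sc A (\<mu> u v) =
          br (tensor_augmentation sc A u) (tensor_augmentation sc A v))"

definition deformations_equivalent ::
  "('k::field \<Rightarrow> 'l::ab_group_add \<Rightarrow> 'l) \<Rightarrow> ('k, 'a) module \<Rightarrow>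
     (('k, 'a, 'l) ctensor \<Rightarrow> ('k, 'a, 'l) ctensor \<Rightarrow> ('k, 'a, 'l) ctensor) \<Rightarrow>
     (('k, 'a, 'l) ctensor \<Rightarrow> ('k, 'a, 'l) ctensor \<Rightarrow> ('k, 'a, 'l) ctensor) \<Rightarrow> bool" where
  "deformations_equivalent sc A \<mu> \<nu> \<longleftrightarrow>
     (let M = completed_tensor sc A in
      \<exists>\<phi>. bij_betw \<phi> (carrier M) (carrier M) \<and>
          (\<forall>u\<in>carrier M. \<forall>v\<in>carrier M. \<phi> (u \<oplus>\<^bsub>M\<^esub> v) = \<phi> u \<oplus>\<^bsub>M\<^esub> \<phi> v) \<and>
          (\<forall>a\<in>carrier A. \<forall>u\<in>carrier M. \<phi> (a \<odot>\<^bsub>M\<^esub> u) = a \<odot>\<^bsub>M\<^esub> \<phi> u) \<and>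
          (\<forall>u\<in>carrier M. \<forall>v\<in>carrier M. \<phi> (\<mu> u v) = \<nu> (\<phi> u) (\<phi> v)) \<and>
          (\<forall>u\<in>carrier M. tensor_augmentation sc A (\<phi> u) = tensor_augmentation sc A u))"

text \<open>
  \<open>\<mu> = f\<^sub>* \<eta>\<close>. Under the identification of \<open>A \<otimes>\<^sub>B (B \<otimes> L)\<close> with \<open>A \<otimes> L\<close> (completed
  tensor products), the extension of scalars of \<open>\<eta>\<close> is the \<open>A\<close>-bilinear bracket with
  \<open>[1 \<otimes> u, 1 \<otimes> v] = 1 \<otimes> [u, v]\<close>, where \<open>1 \<otimes> u\<close> is the image of \<open>u\<close> under \<open>f \<otimes> id\<close>. These
  images generate a dense \<open>A\<close>-submodule, so that \<open>\<mu>\<close> is determined on the carrier.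
\<close>

definition is_push_out ::
  "('k::field \<Rightarrow> 'l::ab_group_add \<Rightarrow> 'l) \<Rightarrow> ('l \<Rightarrow> 'l \<Rightarrow> 'l) \<Rightarrow> ('k, 'b) module \<Rightarrow> ('k, 'a) module \<Rightarrow>
     ('b \<Rightarrow> 'a) \<Rightarrow>
     (('k, 'b, 'l) ctensor \<Rightarrow> ('k, 'b, 'l) ctensor \<Rightarrow> ('k, 'b, 'l) ctensor) \<Rightarrow>
     (('k, 'a, 'l) ctensor \<Rightarrow> ('k, 'a, 'l) ctensor \<Rightarrow> ('k, 'a, 'l) ctensor) \<Rightarrow> bool" where
  "is_push_out sc br B A f \<eta> \<mu> \<longleftrightarrow>
     formal_deformation sc br A \<mu> \<and>
     (\<forall>u\<in>carrier (completed_tensor sc B). \<forall>v\<in>carrier (completed_tensor sc B).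
        \<mu> (completed_tensor_map sc B A f u) (completed_tensor_map sc B A f v) =
          completed_tensor_map sc B A f (\<eta> u v))"

definition induces ::
  "('k::field \<Rightarrow> 'l::ab_group_add \<Rightarrow> 'l) \<Rightarrow> ('l \<Rightarrow> 'l \<Rightarrow> 'l) \<Rightarrow> ('k, 'b) module \<Rightarrow>
     (('k, 'b, 'l) ctensor \<Rightarrow> ('k, 'b, 'l) ctensor \<Rightarrow> ('k, 'b, 'l) ctensor) \<Rightarrow> ('k, 'a) module \<Rightarrow>
     (('k, 'a, 'l) ctensor \<Rightarrow> ('k, 'a, 'l) ctensor \<Rightarrow> ('k, 'a, 'l) ctensor) \<Rightarrow> ('b \<Rightarrow> 'a) \<Rightarrow> bool"
  where
  "induces sc br B \<eta> A \<mu> f \<longleftrightarrow> base_hom B A f \<and>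
     (\<exists>\<nu>. is_push_out sc br B A f \<eta> \<nu> \<and> deformations_equivalent sc A \<mu> \<nu>)"

text \<open>
  The test bases \<open>A\<close> range over the complete local bases whose carrier is a set of functions
  \<open>nat \<Rightarrow> 'k\<close>. This is no restriction: \<open>A\<close> embeds into the product of the countably many
  finite-dimensional spaces \<open>A / \<mm>\<^sup>n\<close>, so every complete local base over \<open>'k\<close>, on whatever type,
  is isomorphic to one of these.
\<close>

definition miniversal ::
  "('k::field \<Rightarrow> 'l::ab_group_add \<Rightarrow> 'l) \<Rightarrow> ('l \<Rightarrow> 'l \<Rightarrow> 'l) \<Rightarrow> ('k, 'b) module \<Rightarrow>
     (('k, 'b, 'l) ctensor \<Rightarrow> ('k, 'b, 'l) ctensor \<Rightarrow> ('k, 'b, 'l) ctensor) \<Rightarrow> bool" where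
  "miniversal sc br B \<eta> \<longleftrightarrow>
     complete_local_base B \<and> formal_deformation sc br B \<eta> \<and>
     (\<forall>(A :: ('k, nat \<Rightarrow> 'k) module) \<mu>.
        complete_local_base A \<and> formal_deformation sc br A \<mu> \<longrightarrow>
        (\<exists>f. induces sc br B \<eta> A \<mu> f) \<and>
        (max_power A 2 = {\<zero>\<^bsub>A\<^esub>} \<longrightarrow>
           (\<forall>f g. induces sc br B \<eta> A \<mu> f \<and> induces sc br B \<eta> A \<mu> g \<longrightarrow>
              (\<forall>b\<in>carrier B. f b = g b))))"


section \<open>Formal power series\<close>

text \<open>\<open>\<K>[[S]]\<close> for a finite set \<open>S\<close> of variables; monomials are multisets over \<open>S\<close>, and a power
  series is given by its coefficients.\<close>

definition power_series :: "'x set \<Rightarrow> ('k::field, 'x multiset \<Rightarrow> 'k) module" where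
  "power_series S =
     \<lparr>carrier = {p. \<forall>m. p m \<noteq> 0 \<longrightarrow> set_mset m \<subseteq> S},
      monoid.mult = (\<lambda>p q m. \<Sum>m'\<in>{m'. m' \<subseteq># m}. p m' * q (m - m')),
      monoid.one = (\<lambda>m. if m = {#} then 1 else 0),
      ring.zero = (\<lambda>m. 0), ring.add = (\<lambda>p q m. p m + q m), module.smult = (\<lambda>c p m. c * p m)\<rparr>"

definition finitely_generated_ideal :: "'a set \<Rightarrow> ('k, 'a) module \<Rightarrow> bool" where
  "finitely_generated_ideal I R \<longleftrightarrow>
     ideal I R \<and> (\<exists>S. finite S \<and> S \<subseteq> carrier R \<and> I = Idl\<^bsub>R\<^esub> S)"

end

theory Submission
  imports Defs "HOL-Library.Function_Algebras"
begin

text \<open>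
  Let \<open>\<mm>\<close> be the maximal ideal of \<open>C\<close>. Homomorphisms \<open>C \<rightarrow> \<K>[\<epsilon>]\<close> correspond to functionals \<open>c\<close> on the
  cotangent space \<open>\<mm> / \<mm>\<^sup>2\<close>, and the push-out of \<open>\<eta>\<close> along the homomorphism given by \<open>c\<close> is the bracket
  \<open>[x, y] + \<epsilon> \<phi>\<^sub>c(x, y)\<close> with a \<open>2\<close>-cocycle \<open>\<phi>\<^sub>c\<close> that is linear in \<open>c\<close>. If \<open>\<phi>\<^sub>c\<close> is a coboundary, then
  this push-out is equivalent to the trivial deformation, which is also the push-out along \<open>c = 0\<close>; the
  uniqueness in the definition of a miniversal deformation gives \<open>c = 0\<close>. Hence
  \<open>dim \<mm> / \<mm>\<^sup>2 \<le> dim H\<^sup>2(L; L)\<close>, so \<open>dim H\<^sup>2(L; L)\<close> many elements generate \<open>\<mm>\<close> modulo \<open>\<mm>\<^sup>2\<close>. By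
  completeness, evaluation at them is a surjection of the power series algebra onto \<open>C\<close>, whose kernel is
  finitely generated because the power series algebra is Noetherian.
\<close>

section \<open>Formal power series\<close>

text \<open>\<open>L\<close> may have infinite dimension and the bracket \<open>\<eta>\<close> is
  only bilinear over the base; continuity is not assumed, although elements of the completed tensor
  product are infinite series. A finite division takes its place: such an element is a constant
  tensor plus a sum of multiples by the finitely many generators \<open>t e\<close> of the maximal
  ideal. As \<epsilon> squares to zero, a push-out to the dual numbers sees the cofactors only
  through their augmentations, and so is linear in the tangent vector. The division must respect the
  powers of the maximal ideal in every coordinate, so that the cofactors converge; this is read off
  from power series representing the coordinates. Tensors are functionals on bilinear forms, so
  extracting coordinates requires linear functionals on the base that vanish on a given power of the
  maximal ideal. The comparison with cohomology is a count: the cotangent basis is injected into the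
  given basis of the dual of cohomology and surplus variables go to zero. For the Noetherian
  property the lowest monomial acts as the leading one, since a power series need not have a highest
  one.\<close>

lemma finite_submultisets: "finite {a. a \<subseteq># (m :: 'x multiset)}"
proof (rule finite_subset)
  show "{a. a \<subseteq># m} \<subseteq> (\<Union>n\<le>size m. multisets_of_size (set_mset m) n)"
    by (auto simp: multisets_of_size_def size_mset_mono dest: mset_subset_eqD)
  show "finite (\<Union>n\<le>size m. multisets_of_size (set_mset m) n)"
    by (simp add: finite_multisets_of_size)
qed

definition conv :: "('x multiset \<Rightarrow> 'k::field) \<Rightarrow> ('x multiset \<Rightarrow> 'k) \<Rightarrow> 'x multiset \<Rightarrow> 'k" where
  "conv p q m = (\<Sum>a\<in>{a. a \<subseteq># m}. p a * q (m - a))"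

lemma power_series_simps:
  "carrier (power_series S) = {p. \<forall>m. p m \<noteq> 0 \<longrightarrow> set_mset m \<subseteq> S}"
  "p \<otimes>\<^bsub>power_series S\<^esub> q = conv p q"
  "\<one>\<^bsub>power_series S\<^esub> = (\<lambda>m. if m = {#} then 1 else 0)"
  "\<zero>\<^bsub>power_series S\<^esub> = (\<lambda>m. 0)"
  "p \<oplus>\<^bsub>power_series S\<^esub> q = (\<lambda>m. p m + q m)"
  "c \<odot>\<^bsub>power_series S\<^esub> p = (\<lambda>m. c * p m)"
  by (simp_all add: power_series_def conv_def fun_eq_iff)

lemma conv_commute: "conv p q = conv q p"
proof
  fix m show "conv p q m = conv q p m"
    unfolding conv_def
    by (rule sum.reindex_bij_witness[where i = "\<lambda>a. m - a" and j = "\<lambda>a. m - a"])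
       (auto simp: mult.commute subset_mset.diff_diff_right subset_mset.add_diff_inverse)
qed

text \<open>Both sides sum over the ways to split \<open>m\<close> into three ordered summands; the
  left side records the first summand and the sum of the first two, the right side the first and the
  second.\<close>

lemma conv_assoc: "conv (conv p q) r = conv p (conv q r)"
proof
  fix m
  have sub2: "a - b \<subseteq># m - b" if "a \<subseteq># m" for a b :: "'a multiset"
    using that by (simp add: subseteq_mset_def diff_le_mono)
  have "conv (conv p q) r m =
    (\<Sum>(a, b)\<in>Sigma {a. a \<subseteq># m} (\<lambda>a. {b. b \<subseteq># a}). p b * q (a - b) * r (m - a))"
    by (simp add: conv_def sum_distrib_right sum.Sigma finite_submultisets)
  also have "\<dots> = (\<Sum>(b, c)\<in>Sigma {b. b \<subseteq># m} (\<lambda>b. {c. c \<subseteq># m - b}). p b * q c * r (m - b - c))"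
  proof (rule sum.reindex_bij_witness[where i = "\<lambda>(b, c). (b + c, b)" and j = "\<lambda>(a, b). (b, a - b)"], goal_cases)
    case (1 x)
    then show ?case by (auto simp: subset_mset.add_diff_inverse)
  next
    case (2 x)
    then show ?case by (auto simp: sub2 dest: subset_mset.order_trans)
  next
    case (3 x)
    then show ?case by auto
  next
    case (4 x)
    then show ?case by (auto simp: subset_mset.le_diff_conv2 add.commute)
  next
    case (5 x)
    then obtain a b where x: "x = (a, b)" "b \<subseteq># a" "a \<subseteq># m" by auto
    then have "m - b - (a - b) = m - a" by (simp add: subset_mset.add_diff_inverse)
    with x show ?case by simp
  qed
  also have "\<dots> = conv p (conv q r) m"
    by (simp add: conv_def sum_distrib_left sum.Sigma finite_submultisets mult.assoc)
  finally show "conv (conv p q) r m = conv p (conv q r) m" .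
qed

lemma conv_add_left: "conv (\<lambda>m. p m + q m) r = (\<lambda>m. conv p r m + conv q r m)"
  by (simp add: conv_def fun_eq_iff distrib_right sum.distrib)

lemma conv_one_left: "conv (\<lambda>m. if m = {#} then 1 else 0) p = p"
proof
  fix m
  have "conv (\<lambda>m. if m = {#} then 1 else 0) p m = (\<Sum>a\<in>{a. a \<subseteq># m}. if a = {#} then p m else 0)"
    unfolding conv_def by (rule sum.cong) auto
  then show "conv (\<lambda>m. if m = {#} then 1 else 0) p m = p m"
    by (simp add: finite_submultisets)
qed

lemma conv_closed:
  assumes "p \<in> carrier (power_series S)" "q \<in> carrier (power_series S)"
  shows "conv p q \<in> carrier (power_series S)"
proof -
  have "set_mset m \<subseteq> S" if "conv p q m \<noteq> 0" for m
  proof -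
    from that obtain a where "a \<subseteq># m" "p a * q (m - a) \<noteq> 0"
      unfolding conv_def by (metis (mono_tags, lifting) mem_Collect_eq sum.neutral)
    then have "set_mset a \<subseteq> S" "set_mset (m - a) \<subseteq> S" "m = a + (m - a)"
      using assms by (auto simp: power_series_simps)
    then show ?thesis by (metis le_sup_iff set_mset_union)
  qed
  then show ?thesis by (simp add: power_series_simps)
qed

lemma cring_power_series: "cring (power_series S :: ('k::field, 'x multiset \<Rightarrow> 'k) module)"
proof (rule cringI)
  let ?P = "power_series S :: ('k, 'x multiset \<Rightarrow> 'k) module"
  show "abelian_group ?P"
  proof (rule abelian_groupI)
    fix x assume "x \<in> carrier ?P"
    then show "\<exists>y\<in>carrier ?P. y \<oplus>\<^bsub>?P\<^esub> x = \<zero>\<^bsub>?P\<^esub>"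
      by (intro bexI[where x = "\<lambda>m. - x m"]) (auto simp: power_series_simps)
    show "x \<oplus>\<^bsub>?P\<^esub> y \<in> carrier ?P" if "x \<in> carrier ?P" "y \<in> carrier ?P" for x y
      using that unfolding power_series_simps mem_Collect_eq by (metis add.right_neutral)
  qed (auto simp: power_series_simps fun_eq_iff algebra_simps)
  show "comm_monoid ?P"
  proof (rule comm_monoidI)
    show "x \<otimes>\<^bsub>?P\<^esub> y \<in> carrier ?P" if "x \<in> carrier ?P" "y \<in> carrier ?P" for x y
      using conv_closed[OF that] by (simp add: power_series_simps)
    show "x \<otimes>\<^bsub>?P\<^esub> y = y \<otimes>\<^bsub>?P\<^esub> x" for x y
      by (simp add: power_series_simps conv_commute[of x y])
  qed (auto simp: power_series_simps conv_assoc conv_one_left split: if_splits)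
qed (auto simp: power_series_simps conv_add_left)

section \<open>Noetherianity of power series by means of lowest monomials\<close>

lemma dickson:
  assumes "finite S" "U \<subseteq> {m. set_mset m \<subseteq> S}"
  shows "\<exists>F\<subseteq>U. finite F \<and> (\<forall>u\<in>U. \<exists>f\<in>F. f \<subseteq># u)"
  using assms
proof (induction S arbitrary: U rule: finite_induct)
  case empty
  then show ?case by (intro exI[where x = U]) (auto intro: finite_subset[where B = "{{#}}"])
next
  case (insert s S)
  \<comment> \<open>\<open>r\<close> forgets the exponent of the new variable \<open>s\<close>;
    divisibility after \<open>r\<close> together with an inequality of \<open>s\<close>-exponents is
    divisibility.\<close>
  define r where "r = filter_mset (\<lambda>x. x \<noteq> s)"
  have sub: "f \<subseteq># u" if "r f \<subseteq># r u" "count f s \<le> count u s" for f u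
  proof (rule mset_subset_eqI)
    fix x show "count f x \<le> count u x"
      using that mset_subset_eq_count[OF that(1), of x] by (cases "x = s") (auto simp: r_def)
  qed
  \<comment> \<open>The induction hypothesis for the image of \<open>V\<close> under
    \<open>r\<close>, with preimages chosen in \<open>V\<close>. It is used for \<open>U\<close>
    itself and for each slice of constant \<open>s\<close>-exponent.\<close>
  have step: "\<exists>G\<subseteq>V. finite G \<and> (\<forall>u\<in>V. \<exists>g\<in>G. r g \<subseteq># r u)" if "V \<subseteq> U" for V
  proof -
    have "r ` V \<subseteq> {m. set_mset m \<subseteq> S}"
    proof
      fix m assume "m \<in> r ` V"
      then obtain v where "v \<in> V" "m = r v" by blast
      then show "m \<in> {m. set_mset m \<subseteq> S}" using that insert.prems unfolding r_def by fastforce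
    qed
    from insert.IH[OF this] obtain F
      where F: "F \<subseteq> r ` V" "finite F" "\<forall>u\<in>r ` V. \<exists>f\<in>F. f \<subseteq># u" by blast
    from F(1) obtain G where "G \<subseteq> V" "F = r ` G" "finite G"
      using F(2) by (meson finite_subset_image)
    with F(3) show ?thesis by (intro exI[where x = G]) auto
  qed
  from step[of U] obtain G where G: "G \<subseteq> U" "finite G" "\<forall>u\<in>U. \<exists>g\<in>G. r g \<subseteq># r u" by blast
  have "\<forall>k. \<exists>G. G \<subseteq> {u\<in>U. count u s = k} \<and> finite G \<and>
      (\<forall>u\<in>{u\<in>U. count u s = k}. \<exists>g\<in>G. r g \<subseteq># r u)"
  proof
    fix k
    have "{u\<in>U. count u s = k} \<subseteq> U" by auto
    from step[OF this] show "\<exists>G. G \<subseteq> {u\<in>U. count u s = k} \<and> finite G \<and>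
      (\<forall>u\<in>{u\<in>U. count u s = k}. \<exists>g\<in>G. r g \<subseteq># r u)" by (elim exE) (rule exI)
  qed
  from choice[OF this] obtain H where H': "\<forall>k. H k \<subseteq> {u\<in>U. count u s = k} \<and> finite (H k) \<and>
      (\<forall>u\<in>{u\<in>U. count u s = k}. \<exists>g\<in>H k. r g \<subseteq># r u)" by (elim exE)
  have H: "H k \<subseteq> {u\<in>U. count u s = k}" "finite (H k)"
      "u \<in> U \<Longrightarrow> count u s = k \<Longrightarrow> \<exists>g\<in>H k. r g \<subseteq># r u" for k u
    using H' by auto
  \<comment> \<open>A crude bound for the \<open>s\<close>-exponents in \<open>G\<close>. Monomials
    of exponent at least \<open>K\<close> are covered by \<open>G\<close>, and each of the finitely
    many smaller exponents by its slice \<open>H k\<close>.\<close>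
  define K where "K = (\<Sum>g\<in>G. count g s)"
  have K: "count g s \<le> K" if "g \<in> G" for g
    unfolding K_def using that G(2) by (intro member_le_sum) auto
  show ?case
  proof (intro exI[where x = "G \<union> (\<Union>k<K. H k)"] conjI ballI)
    fix u assume u: "u \<in> U"
    show "\<exists>f\<in>G \<union> (\<Union>k<K. H k). f \<subseteq># u"
    proof (cases "count u s < K")
      case True
      obtain g where g: "g \<in> H (count u s)" "r g \<subseteq># r u" using H(3)[OF u refl] by blast
      then have "count g s = count u s" using H(1)[of "count u s"] by blast
      with g True sub[of g u] show ?thesis by auto
    next
      case False
      obtain g where g: "g \<in> G" "r g \<subseteq># r u" using G(3) u by blast
      with False K[of g] sub[of g u] show ?thesis by auto
    qed
  next
    show "G \<union> (\<Union>k<K. H k) \<subseteq> U" using G(1) H(1) by blast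
    show "finite (G \<union> (\<Union>k<K. H k))" using G(2) H(2) by simp
  qed
qed

text \<open>Integer polynomials are ordered by the sign of the leading coefficient, so that
  \<open>m \<mapsto> |m| X\<^sup>N + \<Sum>\<^sub>x count m x X\<^bsup>idx x\<^esup>\<close> pulls back to a degree-compatible monomial order.\<close>

lemma monomial_order:
  assumes "finite S"
  obtains key :: "'x multiset \<Rightarrow> int poly"
  where "\<And>m m'. key (m + m') = key m + key m'"
    and "inj_on key {m. set_mset m \<subseteq> S}"
    and "\<And>m. set_mset m \<subseteq> S \<Longrightarrow> finite {u. set_mset u \<subseteq> S \<and> key u < key m}"
proof -
  obtain idx and N :: nat where idx: "idx ` S = {i. i < N}" "inj_on idx S"
    using finite_imp_inj_to_nat_seg[OF assms] by blast
  \<comment> \<open>Values in an ordered abelian group make the order compatible with products. All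
    indices \<open>idx x\<close> are below \<open>N\<close>, so the top coefficient is the total
    degree. Letters outside \<open>S\<close> get the dummy index \<open>0\<close>.\<close>
  define key :: "'x multiset \<Rightarrow> int poly" where "key m = (\<Sum>x\<in>#m. Polynomial.monom 1 N + Polynomial.monom 1 (if x \<in> S then idx x else 0))"
    for m
  have add: "key (m + m') = key m + key m'" for m m'
    by (simp add: key_def)
  have less_N: "idx x < N" if "x \<in> S" for x using idx that by auto
  have coeff_idx: "Polynomial.coeff (key m) (idx x) = int (count m x)" if "set_mset m \<subseteq> S" "x \<in> S" for m x
    using that(1)
  proof (induction m)
    case (add y m)
    then have "idx y = idx x \<longleftrightarrow> y = x" using inj_onD[OF idx(2)] that(2) by auto
    then show ?case using add less_N[OF that(2)] by (auto simp: key_def)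
  qed (simp add: key_def)
  have coeff_N: "Polynomial.coeff (key m) N = int (size m)" if "set_mset m \<subseteq> S" for m
    using that
  proof (induction m)
    case (add y m)
    then show ?case using less_N[of y] by (auto simp: key_def)
  qed (simp add: key_def)
  have coeff_gt: "Polynomial.coeff (key m) i = 0" if "set_mset m \<subseteq> S" "i > N" for m i
    using that(1)
  proof (induction m)
    case (add y m)
    then show ?case using less_N[of y] that(2) by (auto simp: key_def)
  qed (simp add: key_def)
  have inj: "inj_on key {m. set_mset m \<subseteq> S}"
  proof (rule inj_onI, rule multiset_eqI)
    fix m m' x assume *: "m \<in> {m. set_mset m \<subseteq> S}" "m' \<in> {m. set_mset m \<subseteq> S}" "key m = key m'"
    show "count m x = count m' x"
    proof (cases "x \<in> S")
      case True
      then show ?thesis using * coeff_idx[of m x] coeff_idx[of m' x] by simp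
    next
      case False
      then show ?thesis using * by (metis (mono_tags, lifting) count_eq_zero_iff mem_Collect_eq subsetD)
    qed
  qed
  \<comment> \<open>The coefficient of \<open>key u - key m\<close> at \<open>N\<close> is the
    difference of the sizes and the higher ones vanish; a positive difference would be the leading
    coefficient and force \<open>key m < key u\<close>.\<close>
  have size_le: "size u \<le> size m" if "set_mset u \<subseteq> S" "set_mset m \<subseteq> S" "key u < key m" for u m
  proof (rule ccontr)
    assume "\<not> size u \<le> size m"
    then have c: "Polynomial.coeff (key u - key m) N > 0" using coeff_N that by simp
    have "Polynomial.coeff (key u - key m) i = 0" if "i > N" for i
      using coeff_gt[OF _ that] \<open>set_mset u \<subseteq> S\<close> \<open>set_mset m \<subseteq> S\<close> by simp
    then have "Polynomial.degree (key u - key m) \<le> N" by (simp add: Polynomial.degree_le)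
    moreover have "N \<le> Polynomial.degree (key u - key m)" using c by (intro le_degree) simp
    ultimately have "pos_poly (key u - key m)" using c by (simp add: pos_poly_def)
    then have "key m < key u" by (simp add: less_poly_def)
    with that(3) show False by simp
  qed
  show ?thesis
  proof
    fix m :: "'x multiset"
    assume "set_mset m \<subseteq> S"
    then have "{u. set_mset u \<subseteq> S \<and> key u < key m} \<subseteq> (\<Union>n\<le>size m. multisets_of_size S n)"
      using size_le by (auto simp: multisets_of_size_def)
    then show "finite {u. set_mset u \<subseteq> S \<and> key u < key m}"
      by (rule finite_subset) (simp add: finite_multisets_of_size assms)
  qed (fact add inj)+
qed

lemma ideal_power_series_sum:
  fixes J :: "('x multiset \<Rightarrow> 'k::field) set"
  assumes "ideal J (power_series S :: ('k, 'x multiset \<Rightarrow> 'k) module)" "finite F" "\<And>v. v \<in> F \<Longrightarrow> t v \<in> J"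
  shows "(\<lambda>m. \<Sum>v\<in>F. t v m) \<in> J"
proof -
  let ?P = "power_series S :: ('k, 'x multiset \<Rightarrow> 'k) module"
  interpret ideal J ?P by fact
  show ?thesis using assms(2,3)
  proof (induction F rule: finite_induct)
    case empty
    have "\<zero>\<^bsub>?P\<^esub> \<in> J" by (rule additive_subgroup.zero_closed) (rule is_additive_subgroup)
    then show ?case by (simp add: power_series_simps)
  next
    case (insert v F)
    then have "t v \<oplus>\<^bsub>?P\<^esub> (\<lambda>m. \<Sum>v\<in>F. t v m) \<in> J"
      by (intro additive_subgroup.a_closed[OF is_additive_subgroup]) auto
    then show ?case using insert.hyps by (simp add: power_series_simps)
  qed
qed

text \<open>Dickson's lemma yields finitely many \<open>g v \<in> I\<close> such that every leading monomial \<open>u\<close> of \<open>I\<close> is the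
  leading monomial of a monomial multiple \<open>G u\<close> of some \<open>g v\<close>. For \<open>f \<in> I\<close> the coefficients \<open>c\<close> are
  determined recursively by the condition that \<open>f - \<Sum> c u G u\<close> vanishes at all leading monomials of
  \<open>I\<close>; this difference lies in \<open>I\<close>, hence it is \<open>0\<close>.\<close>

theorem power_series_noetherian:
  fixes I :: "('x multiset \<Rightarrow> 'k::field) set"
  assumes fin: "finite S" and I: "ideal I (power_series S :: ('k, 'x multiset \<Rightarrow> 'k) module)"
  shows "finitely_generated_ideal I (power_series S :: ('k, 'x multiset \<Rightarrow> 'k) module)"
proof -
  let ?P = "power_series S :: ('k, 'x multiset \<Rightarrow> 'k) module"
  interpret P: cring ?P by (rule cring_power_series)
  interpret I: ideal I ?P by (rule I)
  define Mon where "Mon = {m. set_mset m \<subseteq> S}"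
  obtain key :: "'x multiset \<Rightarrow> int poly" where key_add: "\<And>m m'. key (m + m') = key m + key m'"
    and inj: "inj_on key {m. set_mset m \<subseteq> S}"
    and kfin: "\<And>m. set_mset m \<subseteq> S \<Longrightarrow> finite {u. set_mset u \<subseteq> S \<and> key u < key m}"
    by (rule monomial_order[OF fin]) (rule that; assumption)
  have key_inj: "inj_on key Mon" and key_fin: "m \<in> Mon \<Longrightarrow> finite {u\<in>Mon. key u < key m}" for m
    using inj kfin[of m] by (simp_all add: Mon_def)
  \<comment> \<open>The position in the monomial order, a natural number by \<open>key_fin\<close>;
    it yields minimal elements and a measure for the recursion.\<close>
  define rk where "rk m = card {u\<in>Mon. key u < key m}" for m
  have rk: "rk u < rk m" if "u \<in> Mon" "m \<in> Mon" "key u < key m" for u m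
    unfolding rk_def by (rule psubset_card_mono) (use that key_fin in auto)
  \<comment> \<open>The leading monomial is the smallest one in the support, which exists for every
    nonzero power series.\<close>
  define lead where "lead f m \<longleftrightarrow> m \<in> Mon \<and> f m \<noteq> 0 \<and> (\<forall>u\<in>Mon. key u < key m \<longrightarrow> f u = 0)"
    for f :: "'x multiset \<Rightarrow> 'k" and m
  have lead_ex: "\<exists>m. lead f m" if "f \<in> carrier ?P" "f m0 \<noteq> 0" for f m0
  proof -
    from that(2) obtain m where m: "f m \<noteq> 0" "\<And>u. f u \<noteq> 0 \<Longrightarrow> rk m \<le> rk u"
      using ex_has_least_nat[of "\<lambda>m. f m \<noteq> 0" m0 rk] by blast
    have "m \<in> Mon" using that(1) m(1) by (auto simp: power_series_simps Mon_def)
    then have "lead f m" unfolding lead_def using m rk by (meson not_le)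
    then show ?thesis ..
  qed
  define U where "U = {m. \<exists>f\<in>I. lead f m}"
  have U_Mon: "U \<subseteq> Mon" by (auto simp: U_def lead_def)
  then obtain F where F: "F \<subseteq> U" "finite F" "\<And>u. u \<in> U \<Longrightarrow> \<exists>f\<in>F. f \<subseteq># u"
    using dickson[OF fin, of U] unfolding Mon_def by blast
  have "\<forall>v\<in>F. \<exists>f. f \<in> I \<and> lead f v" using F(1) by (auto simp: U_def)
  from bchoice[OF this] obtain g where g: "\<And>v. v \<in> F \<Longrightarrow> g v \<in> I" "\<And>v. v \<in> F \<Longrightarrow> lead (g v) v"
    by blast
  have "\<forall>u\<in>U. \<exists>v. v \<in> F \<and> v \<subseteq># u" using F(3) by blast
  from bchoice[OF this] obtain d where d: "\<And>u. u \<in> U \<Longrightarrow> d u \<in> F" "\<And>u. u \<in> U \<Longrightarrow> d u \<subseteq># u"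
    by blast
  \<comment> \<open>The multiple of \<open>g (d u)\<close> by the monomial \<open>u - d u\<close>,
    written in coefficients and scaled to have coefficient \<open>1\<close> at
    \<open>u\<close>.\<close>
  define G where "G u m = (if u - d u \<subseteq># m then g (d u) (m - (u - d u)) / g (d u) (d u) else 0)" for u m
  have G1: "G u u = 1" if "u \<in> U" for u
  proof -
    have "u - (u - d u) = d u" using d(2)[OF that] by (simp add: subset_mset.diff_diff_right)
    then show ?thesis using g(2)[OF d(1)[OF that]] by (simp add: G_def lead_def)
  qed
  have G0: "G u m = 0" if "u \<in> U" "m \<in> Mon" "key m < key u" for u m
  proof (cases "u - d u \<subseteq># m")
    case True
    have "key m = key (m - (u - d u)) + key (u - d u)"
      using key_add[of "m - (u - d u)" "u - d u"] True by simp
    moreover have "key u = key (d u) + key (u - d u)"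
      using key_add[of "d u" "u - d u"] d(2)[OF that(1)] by (simp add: subset_mset.add_diff_inverse)
    ultimately have "key (m - (u - d u)) < key (d u)" using that(3) by simp
    moreover have "m - (u - d u) \<in> Mon" using that(2) unfolding Mon_def by (auto dest: in_diffD)
    ultimately show ?thesis using g(2)[OF d(1)[OF that(1)]] by (simp add: G_def lead_def)
  qed (simp add: G_def)
  have Idl: "f \<in> Idl\<^bsub>?P\<^esub> (g ` F)" if f: "f \<in> I" for f
  proof -
    define R where "R = {(u, m). u \<in> Mon \<and> m \<in> Mon \<and> key u < key m}"
    have wf: "wf R" by (rule wf_subset[OF wf_measure[of rk]]) (auto simp: R_def rk)
    \<comment> \<open>As \<open>G u\<close> vanishes below \<open>u\<close> and
      \<open>G m m = 1\<close>, the conditions on \<open>c\<close> form a triangular system, solved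
      here for \<open>c m\<close> in terms of the values at smaller monomials.\<close>
    define H where "H c m = (if m \<in> U then f m - (\<Sum>u\<in>{u\<in>U. key u < key m}. c u * G u m) else 0)"
      for c :: "'x multiset \<Rightarrow> 'k" and m
    define c where "c = wfrec R H"
    have c: "c m = H c m" for m
    proof -
      have "c m = H (cut c R m) m" unfolding c_def by (rule wfrec[OF wf])
      also have "\<dots> = H c m" unfolding H_def
      proof (rule if_cong[OF refl _ refl])
        assume "m \<in> U"
        then have "cut c R m u = c u" if "u \<in> {u\<in>U. key u < key m}" for u
          using that U_Mon by (auto simp: cut_def R_def)
        then show "f m - (\<Sum>u\<in>{u\<in>U. key u < key m}. cut c R m u * G u m) =
          f m - (\<Sum>u\<in>{u\<in>U. key u < key m}. c u * G u m)" by simp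
      qed
      finally show ?thesis .
    qed
    \<comment> \<open>Collects the coefficients of all \<open>u\<close> assigned to the same
      generator \<open>v\<close>, shifted down by \<open>v\<close>. The infinite combination of the
      \<open>G u\<close> thereby becomes a finite sum of multiples of generators, and its membership
      in an ideal needs no limit argument.\<close>
    define q where "q v = (\<lambda>a. if a + v \<in> U \<and> d (a + v) = v then c (a + v) / g v v else 0)" for v
    have q: "q v \<in> carrier ?P" for v
    proof -
      have "set_mset m \<subseteq> S" if "m + v \<in> U" for m using that U_Mon unfolding Mon_def by fastforce
      then show ?thesis by (auto simp: q_def power_series_simps split: if_splits)
    qed
    define s where "s = (\<lambda>m. \<Sum>v\<in>F. conv (q v) (g v) m)"
    \<comment> \<open>Stated for any \<open>J\<close> because it serves twice: for \<open>I\<close>,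
      so that the remainder stays in \<open>I\<close>, and for the ideal generated by the
      \<open>g v\<close>.\<close>
    have s_in: "s \<in> J" if "ideal J ?P" "g ` F \<subseteq> J" for J
    proof -
      interpret J: ideal J ?P by fact
      have "q v \<otimes>\<^bsub>?P\<^esub> g v \<in> J" if "v \<in> F" for v
        using \<open>g ` F \<subseteq> J\<close> that by (intro J.I_l_closed q) auto
      then show ?thesis
        unfolding s_def by (intro ideal_power_series_sum[OF \<open>ideal J ?P\<close> F(2)]) (simp add: power_series_simps)
    qed
    \<comment> \<open>A generator \<open>v\<close> and an exponent \<open>a\<close> in
      \<open>q v\<close> correspond to \<open>u = a + v\<close>; the assignment \<open>d\<close>
      provides the inverse. At a fixed monomial only finitely many \<open>u\<close>
      contribute.\<close>
    have s_eq: "s m = (\<Sum>u\<in>{u\<in>U. key u \<le> key m}. c u * G u m)" if m: "m \<in> Mon" for m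
    proof -
      let ?A = "SIGMA v:F. {a. a \<subseteq># m \<and> a + v \<in> U \<and> d (a + v) = v}"
      let ?B = "{u\<in>U. u - d u \<subseteq># m}"
      have bij: "bij_betw (\<lambda>(v, a). a + v) ?A ?B"
      proof (rule bij_betw_byWitness[where f' = "\<lambda>u. (d u, u - d u)"])
        show "\<forall>x\<in>?A. (d (case x of (v, a) \<Rightarrow> a + v), (case x of (v, a) \<Rightarrow> a + v) - d (case x of (v, a) \<Rightarrow> a + v)) = x"
          by auto
        show "\<forall>u\<in>?B. (case (d u, u - d u) of (v, a) \<Rightarrow> a + v) = u"
          using d by auto
        show "(\<lambda>(v, a). a + v) ` ?A \<subseteq> ?B" by auto
        show "(\<lambda>u. (d u, u - d u)) ` ?B \<subseteq> ?A" using d by auto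
      qed
      have finA: "finite ?A"
        by (rule finite_SigmaI[OF F(2)]) (rule finite_subset[OF _ finite_submultisets[of m]], auto)
      then have finB: "finite ?B" using bij_betw_finite[OF bij] by simp
      have "{u\<in>U. key u \<le> key m} \<subseteq> insert m {u\<in>Mon. key u < key m}"
        using U_Mon m inj_onD[OF key_inj] by (force simp: le_less)
      then have finC: "finite {u\<in>U. key u \<le> key m}"
        using key_fin[OF m] finite_subset by blast
      have "s m = (\<Sum>v\<in>F. \<Sum>a\<in>{a. a \<subseteq># m \<and> a + v \<in> U \<and> d (a + v) = v}. q v a * g v (m - a))"
        unfolding s_def conv_def
        by (intro sum.cong refl sum.mono_neutral_right finite_submultisets) (auto simp: q_def)
      also have "\<dots> = (\<Sum>(v, a)\<in>?A. q v a * g v (m - a))"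
        by (rule sum.Sigma[OF F(2)]) (auto intro: finite_subset[OF _ finite_submultisets[of m]])
      also have "\<dots> = (\<Sum>(v, a)\<in>?A. c (a + v) * G (a + v) m)"
        by (rule sum.cong) (auto simp: q_def G_def)
      also have "\<dots> = (\<Sum>u\<in>?B. c u * G u m)"
        using sum.reindex_bij_betw[OF bij, of "\<lambda>u. c u * G u m"] by (simp add: case_prod_unfold)
      also have "\<dots> = (\<Sum>u\<in>{u\<in>U. u - d u \<subseteq># m \<and> key u \<le> key m}. c u * G u m)"
      proof (rule sum.mono_neutral_right[OF finB])
        show "\<forall>i\<in>?B - {u\<in>U. u - d u \<subseteq># m \<and> key u \<le> key m}. c i * G i m = 0"
          using G0[OF _ m] by (auto simp flip: not_less)
      qed auto
      also have "\<dots> = (\<Sum>u\<in>{u\<in>U. key u \<le> key m}. c u * G u m)"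
        by (rule sum.mono_neutral_left[OF finC]) (auto simp: G_def)
      finally show ?thesis .
    qed
    define h where "h = f \<ominus>\<^bsub>?P\<^esub> s"
    have f_carr: "f \<in> carrier ?P" using f by (rule I.Icarr)
    have s_I: "s \<in> I" by (rule s_in[OF I]) (use g in auto)
    then have s_carr: "s \<in> carrier ?P" by (rule I.Icarr)
    have h_I: "h \<in> I" unfolding h_def using f s_I by (simp add: P.minus_eq)
    have fh: "f = h \<oplus>\<^bsub>?P\<^esub> s" unfolding h_def using f_carr s_carr
      by (simp add: P.minus_eq P.a_assoc P.l_neg)
    have hm: "h m = f m - s m" for m
      using fun_cong[OF fh, of m] by (simp add: power_series_simps)
    have h0: "h m = 0" if "m \<in> U" for m
    proof -
      have mM: "m \<in> Mon" using that U_Mon by auto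
      have *: "{u\<in>U. key u \<le> key m} = insert m {u\<in>U. key u < key m}"
        using U_Mon mM that inj_onD[OF key_inj] by (force simp: le_less)
      have "finite {u\<in>U. key u < key m}"
        by (rule finite_subset[OF _ key_fin[OF mM]]) (use U_Mon in auto)
      then have "s m = c m * G m m + (\<Sum>u\<in>{u\<in>U. key u < key m}. c u * G u m)"
        unfolding s_eq[OF mM] * by (subst sum.insert) auto
      also have "\<dots> = f m" using that by (subst c) (simp add: H_def G1)
      finally show ?thesis by (simp add: hm)
    qed
    \<comment> \<open>A nonzero \<open>h\<close> would have a lowest monomial; it belongs to
      \<open>U\<close> because \<open>h\<close> is in \<open>I\<close>, but \<open>h\<close>
      vanishes on \<open>U\<close>.\<close>
    have "h m = 0" for m
    proof (rule ccontr)
      assume "h m \<noteq> 0"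
      then obtain m' where "lead h m'" using lead_ex[OF I.Icarr[OF h_I]] by blast
      then have "m' \<in> U" "h m' \<noteq> 0" using h_I by (auto simp: U_def lead_def)
      with h0 show False by blast
    qed
    then have "f = s" using fh by (simp add: power_series_simps)
    moreover have "g ` F \<subseteq> carrier ?P" using g(1) I.Icarr by blast
    ultimately show ?thesis using s_in[OF P.genideal_ideal P.genideal_self] by simp
  qed
  have "g ` F \<subseteq> carrier ?P" using g(1) I.Icarr by blast
  moreover have "I = Idl\<^bsub>?P\<^esub> (g ` F)" using Idl P.genideal_minimal[OF I] g(1) by blast
  ultimately show ?thesis unfolding finitely_generated_ideal_def using I F(2) by blast
qed

section \<open>Vector spaces as records\<close>

lemma ring_of_type_algebra_simps [simp]:
  "carrier (ring_of_type_algebra :: 'k::field ring) = UNIV"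
  "x \<oplus>\<^bsub>(ring_of_type_algebra :: 'k::field ring)\<^esub> y = x + y"
  "x \<otimes>\<^bsub>(ring_of_type_algebra :: 'k::field ring)\<^esub> y = x * y"
  "\<zero>\<^bsub>(ring_of_type_algebra :: 'k::field ring)\<^esub> = 0"
  "\<one>\<^bsub>(ring_of_type_algebra :: 'k::field ring)\<^esub> = 1"
  by (simp_all add: ring_of_type_algebra_def)

lemma (in abelian_monoid) finsum_Sigma:
  assumes "finite A" "\<And>a. a \<in> A \<Longrightarrow> finite (B a)" "\<And>a b. a \<in> A \<Longrightarrow> b \<in> B a \<Longrightarrow> f a b \<in> carrier G"
  shows "finsum G (\<lambda>a. finsum G (f a) (B a)) A = finsum G (\<lambda>(a, b). f a b) (Sigma A B)"
  using assms
proof (induction A rule: finite_induct)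
  case (insert x A)
  have eq: "Sigma (insert x A) B = Pair x ` B x \<union> Sigma A B" by auto
  have "finsum G (\<lambda>(a, b). f a b) (Sigma (insert x A) B) =
    finsum G (\<lambda>(a, b). f a b) (Pair x ` B x) \<oplus> finsum G (\<lambda>(a, b). f a b) (Sigma A B)"
    unfolding eq by (rule finsum_Un_disjoint) (use insert in auto)
  also have "finsum G (\<lambda>(a, b). f a b) (Pair x ` B x) = finsum G (f x) (B x)"
    by (subst finsum_reindex) (use insert.prems in \<open>auto simp: inj_on_def\<close>)
  finally show ?case
    using insert by (subst finsum_insert) auto
qed simp

lemma (in abelian_monoid) finsum_closed_subset:
  assumes "finite A" "\<zero> \<in> W" "\<And>x y. x \<in> W \<Longrightarrow> y \<in> W \<Longrightarrow> x \<oplus> y \<in> W" "W \<subseteq> carrier G"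
    "\<And>i. i \<in> A \<Longrightarrow> f i \<in> W"
  shows "finsum G f A \<in> W"
  using assms(1,5)
proof (induction A rule: finite_induct)
  case (insert i A)
  then show ?case using assms(2-4) by (subst finsum_insert) (auto simp: Pi_iff)
qed (use assms in simp)

locale vector_module = module "ring_of_type_algebra :: 'k ring" V for V :: "('k::field, 'v) module" (structure)
begin

abbreviation subspace :: "'v set \<Rightarrow> bool" where
  "subspace W \<equiv> submodule W (ring_of_type_algebra :: 'k ring) V"

lemma smult_in [simp, intro]: "x \<in> carrier V \<Longrightarrow> c \<odot> x \<in> carrier V"
  by (rule smult_closed) simp_all

lemma smult_add_left: "x \<in> carrier V \<Longrightarrow> (a + b) \<odot> x = a \<odot> x \<oplus> b \<odot> x"
  using smult_l_distr[of a b x] by simp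

lemma smult_add_right: "x \<in> carrier V \<Longrightarrow> y \<in> carrier V \<Longrightarrow> c \<odot> (x \<oplus> y) = c \<odot> x \<oplus> c \<odot> y"
  by (rule smult_r_distr) simp_all

lemma smult_mult: "x \<in> carrier V \<Longrightarrow> (a * b) \<odot> x = a \<odot> (b \<odot> x)"
  using smult_assoc1[of a b x] by simp

lemma smult_1 [simp]: "x \<in> carrier V \<Longrightarrow> 1 \<odot> x = x"
  using smult_one[of x] by simp

lemma smult_0 [simp]: "x \<in> carrier V \<Longrightarrow> 0 \<odot> x = \<zero>"
  using smult_l_null[of x] by simp

lemma smult_zero [simp]: "c \<odot> \<zero> = \<zero>"
  using smult_r_null[of c] by simp

lemma smult_minus_one: "x \<in> carrier V \<Longrightarrow> (- 1) \<odot> x = \<ominus> x"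
proof -
  assume x: "x \<in> carrier V"
  have "(- 1) \<odot> x \<oplus> x = (- 1 + 1) \<odot> x" using x by (subst smult_add_left) simp_all
  then have "(- 1) \<odot> x \<oplus> x = \<zero>" using x by simp
  then show ?thesis using x by (simp add: M.minus_equality)
qed

lemma smult_finsum:
  assumes "f \<in> A \<rightarrow> carrier V"
  shows "c \<odot> finsum V f A = finsum V (\<lambda>i. c \<odot> f i) A"
  using assms
proof (induction A rule: infinite_finite_induct)
  case (insert i A)
  then show ?case by (simp add: Pi_iff smult_add_right M.finsum_closed)
qed (simp_all add: M.finsum_infinite)

lemma subspaceI:
  assumes "W \<subseteq> carrier V" "\<zero> \<in> W" "\<And>x y. x \<in> W \<Longrightarrow> y \<in> W \<Longrightarrow> x \<oplus> y \<in> W"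
    "\<And>c x. x \<in> W \<Longrightarrow> c \<odot> x \<in> W"
  shows "subspace W"
proof (rule submoduleI)
  show "\<ominus> a \<in> W" if "a \<in> W" for a
    using assms(1,4) that smult_minus_one by (metis subsetD)
qed (use assms in auto)

lemma subspaceD:
  assumes "subspace W"
  shows "W \<subseteq> carrier V" "\<zero> \<in> W" "x \<in> W \<Longrightarrow> y \<in> W \<Longrightarrow> x \<oplus> y \<in> W" "x \<in> W \<Longrightarrow> c \<odot> x \<in> W"
    "x \<in> W \<Longrightarrow> \<ominus> x \<in> W" "x \<in> W \<Longrightarrow> y \<in> W \<Longrightarrow> x \<ominus> y \<in> W"
proof -
  show sub: "W \<subseteq> carrier V" and add: "\<And>x y. x \<in> W \<Longrightarrow> y \<in> W \<Longrightarrow> x \<oplus> y \<in> W"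
    and "x \<in> W \<Longrightarrow> c \<odot> x \<in> W" and minus: "\<And>x. x \<in> W \<Longrightarrow> \<ominus> x \<in> W"
    using submoduleE[OF assms] by auto
  then show "x \<in> W \<Longrightarrow> y \<in> W \<Longrightarrow> x \<ominus> y \<in> W" by (simp add: M.minus_eq)
  obtain x where "x \<in> W" using submoduleE(2)[OF assms] by auto
  then have "\<zero> = 0 \<odot> x" "0 \<odot> x \<in> W" using sub submoduleE(4)[OF assms, of 0] by auto
  then show "\<zero> \<in> W" by simp
qed

lemma subspace_carrier: "subspace (carrier V)"
  by (rule subspaceI) auto

lemma subspace_finsum:
  assumes "subspace W" "\<And>i. i \<in> A \<Longrightarrow> f i \<in> W"
  shows "finsum V f A \<in> W"
proof (cases "finite A")
  case True
  then show ?thesis by (rule M.finsum_closed_subset) (use subspaceD[OF assms(1)] assms(2) in auto)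
qed (use subspaceD(2)[OF assms(1)] in \<open>simp add: M.finsum_infinite\<close>)

lemma subspace_abelian_subgroup:
  assumes "subspace W"
  shows "abelian_subgroup W V"
proof (rule abelian_subgroupI3)
  show "additive_subgroup W V"
    using assms by (simp add: additive_subgroup_def submodule_def)
qed (rule M.abelian_group_axioms)

lemma coset_eq_iff:
  assumes W: "subspace W" and x: "x \<in> carrier V" and y: "y \<in> carrier V"
  shows "W +> x = W +> y \<longleftrightarrow> x \<ominus> y \<in> W"
proof -
  interpret W: abelian_subgroup W V by (rule subspace_abelian_subgroup[OF W])
  show ?thesis
    using W.a_rcos_module[OF y x] x y W.a_repr_independence'[of x y] W.a_rcos_self[OF x]
    by (metis M.a_repr_independence W.a_subgroup M.minus_eq)
qed

lemma mem_cosetD: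
  assumes "subspace W" "x \<in> carrier V" "z \<in> W +> x"
  shows "z \<in> carrier V" "z \<ominus> x \<in> W"
proof -
  interpret W: abelian_subgroup W V by (rule subspace_abelian_subgroup[OF assms(1)])
  show z: "z \<in> carrier V"
    using assms W.a_elemrcos_carrier by blast
  show "z \<ominus> x \<in> W" using W.a_rcos_module[OF assms(2) z] assms(3) by (simp add: M.minus_eq)
qed

lemma coset_self: "subspace W \<Longrightarrow> x \<in> carrier V \<Longrightarrow> x \<in> W +> x"
  by (rule abelian_subgroup.a_rcos_self[OF subspace_abelian_subgroup])

lemma coset_add:
  assumes "subspace W" "x \<in> carrier V" "y \<in> carrier V"
  shows "(W +> x) <+> (W +> y) = W +> (x \<oplus> y)"
  by (rule abelian_subgroup.a_rcos_sum[OF subspace_abelian_subgroup]) fact+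

lemma coset_zero: "subspace W \<Longrightarrow> W +> \<zero> = W"
  using subspaceD(1) by (rule M.a_coset_add_zero)

lemma smult_diff: "x \<in> carrier V \<Longrightarrow> y \<in> carrier V \<Longrightarrow> c \<odot> (x \<ominus> y) = c \<odot> x \<ominus> c \<odot> y"
  by (simp add: M.minus_eq smult_add_right flip: smult_minus_one smult_mult)

text \<open>Scalar multiplication on quotients is defined as a union over representatives; all of
  them give the same coset, so the union collapses.\<close>

lemma coset_smult:
  assumes W: "subspace W" and x: "x \<in> carrier V"
  shows "(\<Union>z\<in>W +> x. W +> (c \<odot> z)) = W +> (c \<odot> x)"
proof -
  have "W +> (c \<odot> z) = W +> (c \<odot> x)" if "z \<in> W +> x" for z
    using mem_cosetD[OF W x that] subspaceD(4)[OF W, of "z \<ominus> x" c] W x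
    by (simp add: coset_eq_iff smult_diff)
  then show ?thesis using coset_self[OF W x] by blast
qed

lemma subquotient_simps:
  "carrier (subquotient V U W) = (\<lambda>u. W +> u) ` U"
  "\<zero>\<^bsub>subquotient V U W\<^esub> = W"
  "Y \<oplus>\<^bsub>subquotient V U W\<^esub> Z = Y <+> Z"
  "c \<odot>\<^bsub>subquotient V U W\<^esub> Y = (\<Union>z\<in>Y. W +> (c \<odot> z))"
  by (simp_all add: subquotient_def)

lemma subquotient_cosets:
  assumes "subspace W" "x \<in> carrier V"
  shows "y \<in> carrier V \<Longrightarrow> (W +> x) \<oplus>\<^bsub>subquotient V U W\<^esub> (W +> y) = W +> (x \<oplus> y)"
    and "c \<odot>\<^bsub>subquotient V U W\<^esub> (W +> x) = W +> (c \<odot> x)"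
  unfolding subquotient_simps using coset_add[OF assms] coset_smult[OF assms] by blast+

lemma vector_module_subquotient:
  assumes U: "subspace U" and W: "subspace W"
  shows "vector_module (subquotient V U W)"
proof -
  note UD = subspaceD[OF U]
  have in_V: "x \<in> carrier V" if "x \<in> U" for x using that UD(1) by auto
  show ?thesis unfolding vector_module_def
  proof (rule moduleI)
    show "cring (ring_of_type_algebra :: 'k ring)" by (rule cring_from_type_algebra)
    show "abelian_group (subquotient V U W)"
    proof (rule abelian_groupI)
      fix x assume "x \<in> carrier (subquotient V U W)"
      then obtain u where u: "u \<in> U" "x = W +> u" by (auto simp: subquotient_simps)
      then show "\<exists>y\<in>carrier (subquotient V U W). y \<oplus>\<^bsub>subquotient V U W\<^esub> x = \<zero>\<^bsub>subquotient V U W\<^esub>"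
        using UD(5)[of u] W in_V[of u]
        by (intro bexI[where x = "W +> (\<ominus> u)"]) (auto simp: subquotient_simps coset_add M.l_neg coset_zero)
    next
      show "\<zero>\<^bsub>subquotient V U W\<^esub> \<in> carrier (subquotient V U W)"
        using UD(2) coset_zero[OF W] by (force simp: subquotient_simps)
      show "\<zero>\<^bsub>subquotient V U W\<^esub> \<oplus>\<^bsub>subquotient V U W\<^esub> x = x" if "x \<in> carrier (subquotient V U W)" for x
      proof -
        from that obtain u where u: "u \<in> U" "x = W +> u" by (auto simp: subquotient_simps)
        then show ?thesis
          using coset_add[OF W M.zero_closed in_V[OF u(1)]] in_V[OF u(1)] by (simp add: subquotient_simps coset_zero[OF W])
      qed
    qed (use UD(3) W in_V in \<open>auto simp: subquotient_simps(1) subquotient_cosets M.a_ac\<close>)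
  qed (use UD(3,4) W in_V in \<open>auto simp: subquotient_simps(1) subquotient_cosets smult_add_left
      smult_add_right smult_mult\<close>)
qed

lemma finsum_subquotient:
  assumes U: "subspace U" and W: "subspace W" and f: "\<And>i. i \<in> A \<Longrightarrow> f i \<in> U"
  shows "finsum (subquotient V U W) (\<lambda>i. W +> f i) A = W +> finsum V f A"
proof -
  interpret Q: vector_module "subquotient V U W" by (rule vector_module_subquotient[OF U W])
  note in_V = subsetD[OF subspaceD(1)[OF U]]
  show ?thesis using f
  proof (induction A rule: infinite_finite_induct)
    case (insert i A)
    then have "f j \<in> carrier V" if "j \<in> insert i A" for j using in_V that by blast
    then show ?case using insert
      by (subst Q.M.finsum_insert, simp_all add: Pi_iff subquotient_simps)
         (simp add: coset_add[OF W] M.finsum_closed Pi_iff)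
  qed (use W in \<open>simp_all add: Q.M.finsum_infinite M.finsum_infinite subquotient_simps coset_zero\<close>)
qed

section \<open>Functionals and coordinates\<close>

lemma dual_iff:
  "\<xi> \<in> carrier (dual V) \<longleftrightarrow> (\<forall>v\<in>carrier V. \<forall>w\<in>carrier V. \<xi> (v \<oplus> w) = \<xi> v + \<xi> w) \<and>
     (\<forall>c. \<forall>v\<in>carrier V. \<xi> (c \<odot> v) = c * \<xi> v) \<and> (\<forall>v. v \<notin> carrier V \<longrightarrow> \<xi> v = 0)"
  by (simp add: dual_def)

lemma dual_finsum:
  assumes "\<xi> \<in> carrier (dual V)" "f \<in> A \<rightarrow> carrier V" "finite A"
  shows "\<xi> (finsum V f A) = (\<Sum>i\<in>A. \<xi> (f i))"
  using assms(3,2)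
proof (induction A rule: finite_induct)
  case empty
  have "\<xi> (0 \<odot> \<zero>) = 0 * \<xi> \<zero>" using assms(1) by (metis dual_iff M.zero_closed)
  then show ?case by simp
next
  case (insert i A)
  then show ?case using assms(1) by (simp add: dual_iff Pi_iff M.finsum_closed)
qed

text \<open>Uniqueness of the coefficients in \<open>is_basis\<close> forces them to be additive and
  homogeneous in the vector, hence elements of the dual.\<close>

lemma basis_coordinates:
  assumes T: "is_basis V T" "finite T"
  obtains x :: "'v \<Rightarrow> 'v \<Rightarrow> 'k"
  where "\<And>b. b \<in> T \<Longrightarrow> x b \<in> carrier (dual V)"
    and "\<And>v. v \<in> carrier V \<Longrightarrow> v = finsum V (\<lambda>b. x b v \<odot> b) T"
    and "\<And>b b'. b \<in> T \<Longrightarrow> b' \<in> T \<Longrightarrow> x b b' = (if b = b' then 1 else 0)"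
proof -
  have T_V: "b \<in> carrier V" if "b \<in> T" for b using T(1) that by (auto simp: is_basis_def)
  \<comment> \<open>\<open>is_basis\<close> sums over the support of the coefficients, which varies
    with the vector; only sums over the fixed set \<open>T\<close> can be added termwise.\<close>
  have extend: "finsum V (\<lambda>b. c b \<odot> b) {b. c b \<noteq> 0} = finsum V (\<lambda>b. c b \<odot> b) T"
    if "{b. c b \<noteq> 0} \<subseteq> T" for c :: "'v \<Rightarrow> 'k"
    by (rule M.add.finprod_mono_neutral_cong_left) (use that T_V T(2) in auto)
  have ex: "\<exists>c. (\<forall>b. b \<notin> T \<longrightarrow> c b = 0) \<and> v = finsum V (\<lambda>b. c b \<odot> b) T" if "v \<in> carrier V" for v
  proof -
    from that T(1) obtain c where "finite {b. c b \<noteq> 0} \<and> {b. c b \<noteq> 0} \<subseteq> T \<and>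
       v = finsum V (\<lambda>b. c b \<odot> b) {b. c b \<noteq> 0}" unfolding is_basis_def by blast
    then show ?thesis using extend[of c] by (intro exI[where x = c]) auto
  qed
  have uniq: "c = c'" if "\<And>b. b \<notin> T \<Longrightarrow> c b = 0" "\<And>b. b \<notin> T \<Longrightarrow> c' b = 0"
     "finsum V (\<lambda>b. c b \<odot> b) T = finsum V (\<lambda>b. c' b \<odot> b) T" for c c' :: "'v \<Rightarrow> 'k"
  proof -
    have sub: "{b. c b \<noteq> 0} \<subseteq> T" "{b. c' b \<noteq> 0} \<subseteq> T" using that by auto
    define v where "v = finsum V (\<lambda>b. c b \<odot> b) T"
    have "v \<in> carrier V" unfolding v_def using T_V by (auto intro!: M.finsum_closed)
    then have "\<exists>!c. finite {b. c b \<noteq> 0} \<and> {b. c b \<noteq> 0} \<subseteq> T \<and> v = finsum V (\<lambda>b. c b \<odot> b) {b. c b \<noteq> 0}"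
      using T(1) unfolding is_basis_def by blast
    moreover have "finite {b. c b \<noteq> 0} \<and> {b. c b \<noteq> 0} \<subseteq> T \<and> v = finsum V (\<lambda>b. c b \<odot> b) {b. c b \<noteq> 0}"
      using extend[OF sub(1)] sub(1) T(2) by (auto simp: v_def intro: finite_subset)
    moreover have "finite {b. c' b \<noteq> 0} \<and> {b. c' b \<noteq> 0} \<subseteq> T \<and> v = finsum V (\<lambda>b. c' b \<odot> b) {b. c' b \<noteq> 0}"
      using extend[OF sub(2)] sub(2) T(2) that(3) by (auto simp: v_def intro: finite_subset)
    ultimately show ?thesis by blast
  qed
  have "\<forall>v\<in>carrier V. \<exists>c. (\<forall>b. b \<notin> T \<longrightarrow> c b = 0) \<and> v = finsum V (\<lambda>b. c b \<odot> b) T"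
    using ex by blast
  from bchoice[OF this] obtain C
    where C': "\<forall>v\<in>carrier V. (\<forall>b. b \<notin> T \<longrightarrow> C v b = 0) \<and> v = finsum V (\<lambda>b. C v b \<odot> b) T" by (elim exE)
  have C: "b \<notin> T \<Longrightarrow> C v b = 0" "v = finsum V (\<lambda>b. C v b \<odot> b) T" if "v \<in> carrier V" for v b
    using C' that by blast+
  define x where "x b v = (if v \<in> carrier V then C v b else 0)" for b v
  have T_fun: "(\<lambda>b. c b \<odot> b) \<in> T \<rightarrow> carrier V" for c :: "'v \<Rightarrow> 'k" using T_V by auto
  have sum_unique: "C v = c" if "v \<in> carrier V" "\<And>b. b \<notin> T \<Longrightarrow> c b = 0" "v = finsum V (\<lambda>b. c b \<odot> b) T" for v c
    using uniq[of "C v" c] that C by auto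
  show ?thesis
  proof
    fix b assume b: "b \<in> T"
    have "C (v \<oplus> w) = (\<lambda>b. C v b + C w b)" if "v \<in> carrier V" "w \<in> carrier V" for v w
    proof (rule sum_unique)
      have "finsum V (\<lambda>b. (C v b + C w b) \<odot> b) T = finsum V (\<lambda>b. C v b \<odot> b \<oplus> C w b \<odot> b) T"
        by (rule M.finsum_cong') (use T_V in \<open>auto simp: smult_add_left\<close>)
      also have "\<dots> = v \<oplus> w" using C(2) that by (subst M.finsum_addf[OF T_fun T_fun]) simp
      finally show "v \<oplus> w = finsum V (\<lambda>b. (C v b + C w b) \<odot> b) T" by simp
    qed (use that C(1) in auto)
    moreover have "C (c \<odot> v) = (\<lambda>b. c * C v b)" if "v \<in> carrier V" for c v
    proof (rule sum_unique)
      have "finsum V (\<lambda>b. (c * C v b) \<odot> b) T = finsum V (\<lambda>b. c \<odot> (C v b \<odot> b)) T"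
        by (rule M.finsum_cong') (use T_V in \<open>auto simp: smult_mult\<close>)
      also have "\<dots> = c \<odot> v" using C(2)[OF that] by (subst smult_finsum[OF T_fun, symmetric]) simp
      finally show "c \<odot> v = finsum V (\<lambda>b. (c * C v b) \<odot> b) T" by simp
    qed (use that C(1) in auto)
    ultimately show "x b \<in> carrier (dual V)" by (simp add: dual_iff x_def)
  next
    fix v assume "v \<in> carrier V"
    then show "v = finsum V (\<lambda>b. x b v \<odot> b) T" using C(2)[of v] by (simp add: x_def)
  next
    fix b b' assume b: "b \<in> T" "b' \<in> T"
    have "C b' = (\<lambda>b. if b = b' then 1 else 0)"
    proof (rule sum_unique)
      have "finsum V (\<lambda>b. (if b = b' then 1 else 0) \<odot> b) T = finsum V (\<lambda>b. if b' = b then b' else \<zero>) T"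
        by (rule M.finsum_cong') (use T_V b in auto)
      also have "\<dots> = b'" by (rule M.finsum_singleton[OF b(2) T(2)]) (use T_V b in auto)
      finally show "b' = finsum V (\<lambda>b. (if b = b' then 1 else 0) \<odot> b) T" by simp
    qed (use b T_V in auto)
    then show "x b b' = (if b = b' then 1 else 0)" using b T_V by (simp add: x_def)
  qed
qed

end

section \<open>Complete local bases\<close>

declare max_power.simps(2) [simp del]

locale local_base = A: cring A + vector_module A for A :: "('k::field, 'a) module" (structure) +
  assumes base: "complete_local_base A"

lemma complete_local_base_imp_local_base:
  fixes A :: "('k::field, 'a) module"
  assumes "complete_local_base A"
  shows "local_base A"
proof -
  have "algebra (ring_of_type_algebra :: 'k ring) A" using assms by (simp add: complete_local_base_def)
  then interpret algebra "ring_of_type_algebra :: 'k ring" A .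
  show ?thesis
    by (intro local_base.intro vector_module.intro local_base_axioms.intro assms module M_cring)
qed

context local_base
begin

abbreviation P where "P \<equiv> max_power A"

lemma algebra: "algebra (ring_of_type_algebra :: 'k ring) A"
  and ex1_maximalideal: "\<exists>!I. maximalideal I A"
  and bij_residue_field: "bij_betw (\<lambda>c. max_ideal A +> (c \<odot> \<one>)) UNIV (carrier (A Quot max_ideal A))"
  and inverse_limit: "\<forall>x. (\<forall>n. x n \<in> carrier (truncation A n)) \<and>
          (\<forall>n. coset_map A (P n) (\<lambda>a. a) (x (Suc n)) = x n) \<longrightarrow>
          (\<exists>!a. a \<in> carrier A \<and> (\<forall>n. x n = P n +> a))"
  and finite_dimensional_gr: "\<forall>k. finite_dimensional (subquotient A (P k) (P (Suc k)))"
  using base unfolding complete_local_base_def by blast+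

lemma smult_mult_left: "x \<in> carrier A \<Longrightarrow> y \<in> carrier A \<Longrightarrow> (c \<odot> x) \<otimes> y = c \<odot> (x \<otimes> y)"
  using algebra.smult_assoc2[OF algebra, of c x y] by simp

lemma smult_mult_right: "x \<in> carrier A \<Longrightarrow> y \<in> carrier A \<Longrightarrow> x \<otimes> (c \<odot> y) = c \<odot> (x \<otimes> y)"
  by (metis A.m_comm smult_in smult_mult_left)

lemma maximalideal_max_ideal: "maximalideal (max_ideal A) A"
  unfolding max_ideal_def by (rule theI'[OF ex1_maximalideal])

lemma ideal_max_ideal: "ideal (max_ideal A) A"
  using maximalideal_max_ideal by (simp add: maximalideal_def)

lemma ideal_P: "ideal (P n) A"
  by (induction n) (simp_all add: max_power.simps A.oneideal A.ideal_prod_is_ideal ideal_max_ideal)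

lemma P_1: "P 1 = max_ideal A"
  using A.ideal_prod_one(1)[OF ideal_max_ideal] by (simp add: max_power.simps)

lemma P_0 [simp]: "P 0 = carrier A"
  by simp

lemma P_Suc_subset: "P (Suc n) \<subseteq> P n"
  using A.ideal_prod_inter[OF ideal_max_ideal ideal_P[of n]] by (auto simp: max_power.simps)

lemma P_antimono: "m \<le> n \<Longrightarrow> P n \<subseteq> P m"
  by (rule lift_Suc_antimono_le[of P]) (use P_Suc_subset in auto)

lemma P_carrier: "a \<in> P n \<Longrightarrow> a \<in> carrier A"
  by (rule ideal.Icarr[OF ideal_P])

lemma P_mult_left: "a \<in> carrier A \<Longrightarrow> b \<in> P n \<Longrightarrow> a \<otimes> b \<in> P n"
  by (rule ideal.I_l_closed[OF ideal_P])

lemma subspace_P: "subspace (P n)"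
proof (rule subspaceI)
  fix c a assume a: "a \<in> P n"
  have "c \<odot> a = (c \<odot> \<one>) \<otimes> a" using P_carrier[OF a] by (simp add: smult_mult_left)
  then show "c \<odot> a \<in> P n" using P_mult_left[OF _ a, of "c \<odot> \<one>"] by simp
qed (use P_carrier ideal_P in \<open>auto simp: additive_subgroup.zero_closed additive_subgroup.a_closed ideal.axioms\<close>)

lemmas P_subspaceD = subspaceD[OF subspace_P]

text \<open>\<open>max_power\<close> adds one factor of the maximal ideal at a time on the left, so
  induction on \<open>i\<close> moves the factors over to \<open>b\<close> by associativity; sums in
  \<open>ideal_prod\<close> are handled by distributivity.\<close>

lemma P_mult: "a \<in> P i \<Longrightarrow> b \<in> P j \<Longrightarrow> a \<otimes> b \<in> P (i + j)"
proof (induction i arbitrary: a b)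
  case (Suc i)
  from Suc.prems(1) have "a \<in> ideal_prod A (max_ideal A) (P i)" by (simp add: max_power.simps)
  then show ?case
  proof (induction rule: ideal_prod.induct)
    case (prod x y)
    have "x \<in> carrier A" using prod(1) ideal.Icarr[OF ideal_max_ideal] by auto
    then have "x \<otimes> y \<otimes> b = x \<otimes> (y \<otimes> b)" using P_carrier[OF prod(2)] P_carrier[OF Suc.prems(2)]
      by (rule A.m_assoc)
    then show ?case using ideal_prod.prod[OF prod(1) Suc.IH[OF prod(2) Suc.prems(2)]] by (simp add: max_power.simps)
  next
    case (sum x y)
    have "ideal_prod A (max_ideal A) (P i) \<subseteq> carrier A" using P_carrier[of _ "Suc i"] by (auto simp: max_power.simps)
    then have "(x \<oplus> y) \<otimes> b = x \<otimes> b \<oplus> y \<otimes> b"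
      using sum.hyps(1,2) P_carrier[OF Suc.prems(2)] by (intro A.l_distr) auto
    then show ?case using P_subspaceD(3)[OF sum.IH] by simp
  qed
qed (use P_mult_left in simp)

text \<open>Congruence modulo \<open>P n\<close>. Membership in the carrier is built in, so that the
  rules for transitivity, sums and products have no side conditions.\<close>

definition cg :: "nat \<Rightarrow> 'a \<Rightarrow> 'a \<Rightarrow> bool" where
  "cg n a b \<longleftrightarrow> a \<in> carrier A \<and> b \<in> carrier A \<and> a \<ominus> b \<in> P n"

lemma cg_carrier: "cg n a b \<Longrightarrow> a \<in> carrier A" "cg n a b \<Longrightarrow> b \<in> carrier A"
  by (simp_all add: cg_def)

lemma cg_refl [simp]: "a \<in> carrier A \<Longrightarrow> cg n a a"
  by (simp add: cg_def P_subspaceD(2) A.minus_eq A.r_neg)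

lemma cg_sym: "cg n a b \<Longrightarrow> cg n b a"
proof -
  assume *: "cg n a b"
  then have "b \<ominus> a = \<ominus> (a \<ominus> b)" unfolding cg_def by algebra
  with * P_subspaceD(5)[of "a \<ominus> b" n] show ?thesis by (simp add: cg_def)
qed

lemma cg_trans: "cg n a b \<Longrightarrow> cg n b c \<Longrightarrow> cg n a c"
proof -
  assume *: "cg n a b" "cg n b c"
  then have "a \<ominus> c = (a \<ominus> b) \<oplus> (b \<ominus> c)" unfolding cg_def by algebra
  with * P_subspaceD(3)[of "a \<ominus> b" n "b \<ominus> c"] show ?thesis by (simp add: cg_def)
qed

lemma cg_mono: "cg n a b \<Longrightarrow> m \<le> n \<Longrightarrow> cg m a b"
  using P_antimono by (auto simp: cg_def)

lemma cg_add: "cg n a b \<Longrightarrow> cg n a' b' \<Longrightarrow> cg n (a \<oplus> a') (b \<oplus> b')"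
proof -
  assume *: "cg n a b" "cg n a' b'"
  then have "(a \<oplus> a') \<ominus> (b \<oplus> b') = (a \<ominus> b) \<oplus> (a' \<ominus> b')" unfolding cg_def by algebra
  with * P_subspaceD(3)[of "a \<ominus> b" n "a' \<ominus> b'"] show ?thesis by (simp add: cg_def)
qed

lemma cg_mult: "cg n a b \<Longrightarrow> cg n a' b' \<Longrightarrow> cg n (a \<otimes> a') (b \<otimes> b')"
proof -
  assume *: "cg n a b" "cg n a' b'"
  then have "(a \<otimes> a') \<ominus> (b \<otimes> b') = a' \<otimes> (a \<ominus> b) \<oplus> b \<otimes> (a' \<ominus> b')" unfolding cg_def by algebra
  with * P_subspaceD(3)[of "a' \<otimes> (a \<ominus> b)" n "b \<otimes> (a' \<ominus> b')"] P_mult_left show ?thesis by (simp add: cg_def)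
qed

lemma cg_smult: "cg n a b \<Longrightarrow> cg n (c \<odot> a) (c \<odot> b)"
  using P_subspaceD(4)[of "a \<ominus> b" n c] by (simp add: cg_def smult_diff)

lemma cg_zero_iff: "cg n a \<zero> \<longleftrightarrow> a \<in> P n"
  using P_carrier by (auto simp: cg_def A.minus_eq)

lemma cg_add_P: "a \<in> carrier A \<Longrightarrow> b \<in> P n \<Longrightarrow> cg n (a \<oplus> b) a"
  using cg_add[of n a a b \<zero>] by (simp add: cg_zero_iff)

lemma coset_P_eq_iff: "a \<in> carrier A \<Longrightarrow> b \<in> carrier A \<Longrightarrow> P n +> a = P n +> b \<longleftrightarrow> cg n a b"
  using coset_eq_iff[OF subspace_P] by (simp add: cg_def)

lemma carrier_truncation: "carrier (truncation A n) = (\<lambda>a. P n +> a) ` carrier A"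
  by (auto simp: truncation_def quot_algebra_def FactRing_def A_RCOSETS_def')

lemma augmentation_ex1:
  assumes a: "a \<in> carrier A"
  shows "\<exists>!c. cg 1 a (c \<odot> \<one>)"
proof -
  have "bij_betw (\<lambda>c. P 1 +> (c \<odot> \<one>)) UNIV (carrier (A Quot P 1))"
    using bij_residue_field by (simp add: P_1 del: One_nat_def)
  moreover have "P 1 +> a \<in> carrier (A Quot P 1)"
    using a by (auto simp: FactRing_def A_RCOSETS_def')
  ultimately have "\<exists>!c. P 1 +> a = P 1 +> (c \<odot> \<one>)" unfolding bij_betw_def inj_on_def by blast
  then show ?thesis using a by (simp add: coset_P_eq_iff del: One_nat_def)
qed

lemma augmentation_eq: "a \<in> carrier A \<Longrightarrow> augmentation A a = (THE c. cg 1 a (c \<odot> \<one>))"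
  unfolding augmentation_def P_1[symmetric] by (subst coset_P_eq_iff) auto

lemma cg_augmentation: "a \<in> carrier A \<Longrightarrow> cg 1 a (augmentation A a \<odot> \<one>)"
  unfolding augmentation_eq by (rule theI'[OF augmentation_ex1])

lemma augmentation_unique: "cg 1 a (c \<odot> \<one>) \<Longrightarrow> augmentation A a = c"
  using augmentation_ex1[of a] cg_augmentation[of a] by (auto simp: cg_carrier)

lemma augmentation_add: "a \<in> carrier A \<Longrightarrow> b \<in> carrier A \<Longrightarrow>
    augmentation A (a \<oplus> b) = augmentation A a + augmentation A b"
  by (rule augmentation_unique) (simp add: smult_add_left cg_add cg_augmentation del: One_nat_def)

lemma augmentation_smult: "a \<in> carrier A \<Longrightarrow> augmentation A (c \<odot> a) = c * augmentation A a"
  by (rule augmentation_unique) (simp add: smult_mult cg_smult cg_augmentation del: One_nat_def)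

lemma augmentation_mult: "a \<in> carrier A \<Longrightarrow> b \<in> carrier A \<Longrightarrow>
    augmentation A (a \<otimes> b) = augmentation A a * augmentation A b"
  using cg_mult[OF cg_augmentation cg_augmentation, of a b]
  by (intro augmentation_unique) (simp add: smult_mult smult_mult_left del: One_nat_def)

lemma augmentation_one: "augmentation A \<one> = 1"
  by (rule augmentation_unique) simp

lemma augmentation_eq_0_iff: "a \<in> carrier A \<Longrightarrow> augmentation A a = 0 \<longleftrightarrow> a \<in> P 1"
  using cg_augmentation[of a] augmentation_unique[of a 0] by (auto simp: cg_zero_iff simp del: One_nat_def)

lemma coset_map_P:
  assumes "a \<in> carrier A" "m \<le> n"
  shows "coset_map A (P m) (\<lambda>a. a) (P n +> a) = P m +> a"
proof -
  have "P m <+> (P n +> a) = (P m <+> P n) +> a"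
    using A.a_setmult_rcos_assoc[of "P m" "P n" a] P_carrier assms(1) by blast
  also have "P m <+> P n = P m"
  proof
    show "P m <+> P n \<subseteq> P m"
      using P_antimono[OF assms(2)] P_subspaceD(3) by (auto simp: set_add_def')
    show "P m \<subseteq> P m <+> P n"
    proof
      fix x assume x: "x \<in> P m"
      then have "x = x \<oplus> \<zero>" using P_carrier by simp
      then show "x \<in> P m <+> P n" using x P_subspaceD(2)[of n] unfolding set_add_def' by blast
    qed
  qed
  finally show ?thesis by (simp add: coset_map_def)
qed

text \<open>Completeness for sequences of representatives: the congruences of successive terms say
  that their cosets form a point of the inverse limit.\<close>

lemma complete_ex1:
  assumes a: "\<And>n. a n \<in> carrier A" "\<And>n. cg n (a (Suc n)) (a n)"
  shows "\<exists>!b. b \<in> carrier A \<and> (\<forall>n. cg n b (a n))"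
proof -
  have "(\<forall>n. (\<lambda>n. P n +> a n) n \<in> carrier (truncation A n)) \<and>
    (\<forall>n. coset_map A (P n) (\<lambda>a. a) ((\<lambda>n. P n +> a n) (Suc n)) = (\<lambda>n. P n +> a n) n)"
    using a by (auto simp: carrier_truncation coset_map_P coset_P_eq_iff)
  then have "\<exists>!b. b \<in> carrier A \<and> (\<forall>n. P n +> a n = P n +> b)"
    using spec[OF inverse_limit, of "\<lambda>n. P n +> a n"] by (rule rev_mp)
  moreover have "(b \<in> carrier A \<and> (\<forall>n. P n +> a n = P n +> b)) \<longleftrightarrow> (b \<in> carrier A \<and> (\<forall>n. cg n b (a n)))" for b
    using a(1) coset_P_eq_iff by metis
  ultimately show ?thesis by simp
qed

text \<open>Separatedness of the topology is the uniqueness half of completeness, applied to a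
  constant sequence.\<close>

lemma cg_all_imp_eq: "(\<And>n. cg n a b) \<Longrightarrow> a = b"
  using complete_ex1[of "\<lambda>n. b"] cg_carrier by (metis cg_refl)

text \<open>\<open>E\<close> is a basis of the cotangent space, hence consists of cosets.
  \<open>t\<close> picks representatives, at which power series can be evaluated, and
  \<open>x\<close> composes the coordinate functionals with the projection.\<close>

lemma cotangent_basis:
  obtains E :: "'a set set" and t :: "'a set \<Rightarrow> 'a" and x :: "'a set \<Rightarrow> 'a \<Rightarrow> 'k"
  where "finite E" "\<And>e. e \<in> E \<Longrightarrow> t e \<in> P 1"
    "\<And>a. a \<in> P 1 \<Longrightarrow> cg 2 a (\<Oplus>e\<in>E. x e a \<odot> t e)"
    "\<And>e a b. e \<in> E \<Longrightarrow> a \<in> P 1 \<Longrightarrow> b \<in> P 1 \<Longrightarrow> x e (a \<oplus> b) = x e a + x e b"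
    "\<And>e a c. e \<in> E \<Longrightarrow> a \<in> P 1 \<Longrightarrow> x e (c \<odot> a) = c * x e a"
    "\<And>e a. e \<in> E \<Longrightarrow> a \<in> P 2 \<Longrightarrow> x e a = 0"
    "\<And>e e'. e \<in> E \<Longrightarrow> e' \<in> E \<Longrightarrow> x e (t e') = (if e = e' then 1 else 0)"
proof -
  let ?Q = "subquotient A (P 1) (P 2)"
  interpret Q: vector_module ?Q by (rule vector_module_subquotient[OF subspace_P subspace_P])
  obtain E where E: "finite E" "is_basis ?Q E"
    using spec[OF finite_dimensional_gr, of 1] unfolding finite_dimensional_def numeral_2_eq_2 One_nat_def by blast
  obtain y where y: "\<And>b. b \<in> E \<Longrightarrow> y b \<in> carrier (dual ?Q)"
    "\<And>v. v \<in> carrier ?Q \<Longrightarrow> v = finsum ?Q (\<lambda>b. y b v \<odot>\<^bsub>?Q\<^esub> b) E"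
    "\<And>b b'. b \<in> E \<Longrightarrow> b' \<in> E \<Longrightarrow> y b b' = (if b = b' then 1 else 0)"
    by (rule Q.basis_coordinates[OF E(2,1)]) (rule that; assumption)
  have carr: "carrier ?Q = (\<lambda>a. P 2 +> a) ` P 1" by (rule subquotient_simps(1))
  have "\<forall>e\<in>E. \<exists>a. a \<in> P 1 \<and> e = P 2 +> a" using E(2) unfolding is_basis_def carr by blast
  from bchoice[OF this] obtain t where t: "\<forall>e\<in>E. t e \<in> P 1 \<and> e = P 2 +> t e" by (elim exE)
  have tc: "t e \<in> carrier A" if "e \<in> E" for e using t that P_carrier by blast
  define x where "x e a = y e (P 2 +> a)" for e a
  have mem: "P 2 +> a \<in> carrier ?Q" if "a \<in> P 1" for a using that carr by blast
  show ?thesis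
  proof
    fix a assume a: "a \<in> P 1"
    have "P 2 +> a = finsum ?Q (\<lambda>b. y b (P 2 +> a) \<odot>\<^bsub>?Q\<^esub> b) E" by (rule y(2)[OF mem[OF a]])
    also have "\<dots> = finsum ?Q (\<lambda>b. P 2 +> (x b a \<odot> t b)) E"
    proof (rule Q.M.finsum_cong')
      fix b assume b: "b \<in> E"
      then have "y b (P 2 +> a) \<odot>\<^bsub>?Q\<^esub> b = x b a \<odot>\<^bsub>?Q\<^esub> (P 2 +> t b)" using t by (simp add: x_def)
      then show "y b (P 2 +> a) \<odot>\<^bsub>?Q\<^esub> b = P 2 +> (x b a \<odot> t b)"
        using subquotient_cosets(2)[OF subspace_P tc[OF b]] by simp
    next
      show "(\<lambda>b. P 2 +> (x b a \<odot> t b)) \<in> E \<rightarrow> carrier ?Q"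
        using t by (intro Pi_I mem P_subspaceD(4)) blast
    qed simp
    also have "\<dots> = P 2 +> (\<Oplus>e\<in>E. x e a \<odot> t e)"
      by (rule finsum_subquotient[OF subspace_P subspace_P]) (use t P_subspaceD(4) in blast)
    finally show "cg 2 a (\<Oplus>e\<in>E. x e a \<odot> t e)"
      using P_carrier[OF a] tc by (subst coset_P_eq_iff[symmetric]) (auto intro!: A.finsum_closed)
  next
    fix e a b assume e: "e \<in> E" and ab: "a \<in> P 1" "b \<in> P 1"
    then have "y e ((P 2 +> a) \<oplus>\<^bsub>?Q\<^esub> (P 2 +> b)) = x e a + x e b"
      using y(1)[OF e] mem unfolding Q.dual_iff x_def by blast
    then show "x e (a \<oplus> b) = x e a + x e b"
      using subquotient_cosets(1)[OF subspace_P[of 2], where x = a and y = b and U = "P 1"] ab P_carrier by (simp add: x_def)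
  next
    fix e a c assume e: "e \<in> E" and ab: "a \<in> P 1"
    then have "y e (c \<odot>\<^bsub>?Q\<^esub> (P 2 +> a)) = c * x e a"
      using y(1)[OF e] mem unfolding Q.dual_iff x_def by blast
    then show *: "x e (c \<odot> a) = c * x e a"
      using subquotient_cosets(2)[OF subspace_P[of 2], where x = a and c = c and U = "P 1"] ab P_carrier by (simp add: x_def)
  next
    fix e a assume e: "e \<in> E" and a: "a \<in> P 2"
    have "P 2 +> a = P 2 +> (0 \<odot> \<zero>)" using a P_carrier by (simp add: coset_P_eq_iff cg_zero_iff)
    also have "\<dots> = 0 \<odot>\<^bsub>?Q\<^esub> (P 2 +> \<zero>)" by (simp add: subquotient_cosets(2)[OF subspace_P])
    finally have "x e a = y e (0 \<odot>\<^bsub>?Q\<^esub> (P 2 +> \<zero>))" by (simp add: x_def)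
    also have "\<dots> = 0 * y e (P 2 +> \<zero>)"
      using y(1)[OF e] mem[of \<zero>] P_subspaceD(2) unfolding Q.dual_iff by blast
    finally show "x e a = 0" by simp
  next
    show "x e (t e') = (if e = e' then 1 else 0)" if "e \<in> E" "e' \<in> E" for e e'
      using y(3)[OF that] t that by (simp add: x_def)
  qed (use E t in auto)
qed

end

section \<open>Evaluation of power series in a complete local base\<close>

locale generated_base = local_base A for A :: "('k::field, 'a) module" (structure) +
  fixes S :: "'x set" and t :: "'x \<Rightarrow> 'a"
  assumes finite_S: "finite S"
    and t_P: "s \<in> S \<Longrightarrow> t s \<in> P 1"
    and t_generates: "a \<in> P 1 \<Longrightarrow> \<exists>c. cg 2 a (\<Oplus>s\<in>S. c s \<odot> t s)"
begin

abbreviation PS :: "('k, 'x multiset \<Rightarrow> 'k) module" where "PS \<equiv> power_series S"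

lemma t_carrier: "s \<in> S \<Longrightarrow> t s \<in> carrier A"
  using t_P P_carrier by blast

definition mon :: "'x multiset \<Rightarrow> 'a" where
  "mon m = (\<Otimes>s\<in>S. t s [^] count m s)"

lemma mon_carrier [simp]: "mon m \<in> carrier A"
  unfolding mon_def by (rule A.finprod_closed) (use t_carrier in auto)

lemma mon_empty [simp]: "mon {#} = \<one>"
  unfolding mon_def by (simp add: A.finprod_one_eqI)

lemma mon_add: "mon (m + m') = mon m \<otimes> mon m'"
proof -
  have "mon (m + m') = (\<Otimes>s\<in>S. t s [^] count m s \<otimes> t s [^] count m' s)"
    unfolding mon_def by (rule A.finprod_cong') (use t_carrier in \<open>auto simp: A.nat_pow_mult\<close>)
  also have "\<dots> = mon m \<otimes> mon m'"
    unfolding mon_def by (rule A.finprod_multf) (use t_carrier in auto)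
  finally show ?thesis .
qed

lemma mon_single: "s \<in> S \<Longrightarrow> mon {#s#} = t s"
proof -
  assume s: "s \<in> S"
  have "mon {#s#} = (\<Otimes>s'\<in>S. if s = s' then t s' else \<one>)"
    unfolding mon_def by (rule A.finprod_cong') (use t_carrier in auto)
  also have "\<dots> = t s"
    by (rule A.finprod_singleton[OF s finite_S]) (use t_carrier in auto)
  finally show ?thesis .
qed

lemma mon_P: "set_mset m \<subseteq> S \<Longrightarrow> mon m \<in> P (size m)"
proof (induction m)
  case (add s m)
  then show ?case
    using P_mult[of "t s" 1 "mon m" "size m"] t_P[of s] mon_add[of "{#s#}" m] mon_single[of s] by simp
qed simp

definition deg :: "nat \<Rightarrow> 'x multiset set" where
  "deg n = multisets_of_size S n"

definition Mon :: "nat \<Rightarrow> 'x multiset set" where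
  "Mon n = {m. set_mset m \<subseteq> S \<and> size m < n}"

lemma finite_deg [simp]: "finite (deg n)"
  using finite_S by (simp add: deg_def finite_multisets_of_size)

lemma Mon_Suc: "Mon (Suc n) = Mon n \<union> deg n"
  by (auto simp: Mon_def deg_def multisets_of_size_def)

lemma finite_Mon [simp]: "finite (Mon n)"
proof (rule finite_subset)
  show "Mon n \<subseteq> (\<Union>k<n. deg k)" by (auto simp: Mon_def deg_def multisets_of_size_def)
qed simp

text \<open>The part of degree at least \<open>n\<close> evaluates into \<open>P n\<close>, so this
  finite sum is the value of the series modulo \<open>P n\<close>.\<close>

definition pol :: "nat \<Rightarrow> ('x multiset \<Rightarrow> 'k) \<Rightarrow> 'a" where
  "pol n p = (\<Oplus>m\<in>Mon n. p m \<odot> mon m)"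

lemma pol_carrier [simp]: "pol n p \<in> carrier A"
  unfolding pol_def by (rule A.finsum_closed) auto

lemma pol_Suc: "pol (Suc n) p = pol n p \<oplus> (\<Oplus>m\<in>deg n. p m \<odot> mon m)"
  unfolding pol_def Mon_Suc
proof (rule A.finsum_Un_disjoint)
  show "Mon n \<inter> deg n = {}" by (auto simp: Mon_def deg_def multisets_of_size_def)
qed auto

lemma deg_P: "(\<Oplus>m\<in>deg n. p m \<odot> mon m) \<in> P n"
  by (rule subspace_finsum[OF subspace_P])
     (use mon_P P_subspaceD(4) in \<open>force simp: deg_def multisets_of_size_def\<close>)

lemma cg_pol_Suc: "cg n (pol (Suc n) p) (pol n p)"
  unfolding pol_Suc by (rule cg_add_P) (simp_all add: deg_P)

lemma pol_cong: "(\<And>m. m \<in> Mon n \<Longrightarrow> p m = q m) \<Longrightarrow> pol n p = pol n q"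
  unfolding pol_def by (rule A.finsum_cong') auto

definition ev :: "('x multiset \<Rightarrow> 'k) \<Rightarrow> 'a" where
  "ev p = (THE a. a \<in> carrier A \<and> (\<forall>n. cg n a (pol n p)))"

lemma ev: "ev p \<in> carrier A" "cg n (ev p) (pol n p)"
proof -
  have "ev p \<in> carrier A \<and> (\<forall>n. cg n (ev p) (pol n p))"
    unfolding ev_def by (rule theI'[OF complete_ex1]) (simp_all add: cg_pol_Suc)
  then show "ev p \<in> carrier A" "cg n (ev p) (pol n p)" by auto
qed

lemma ev_eqI:
  assumes "\<And>n. cg n a (pol n p)"
  shows "ev p = a"
proof (rule cg_all_imp_eq)
  show "cg n (ev p) a" for n using cg_trans[OF ev(2) cg_sym[OF assms]] .
qed

lemma pol_add: "pol n (\<lambda>m. p m + q m) = pol n p \<oplus> pol n q"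
proof -
  have "pol n (\<lambda>m. p m + q m) = (\<Oplus>m\<in>Mon n. p m \<odot> mon m \<oplus> q m \<odot> mon m)"
    unfolding pol_def by (rule A.finsum_cong') (auto simp: smult_add_left)
  then show ?thesis unfolding pol_def by (simp add: A.finsum_addf)
qed

lemma pol_smult: "pol n (\<lambda>m. c * p m) = c \<odot> pol n p"
proof -
  have "pol n (\<lambda>m. c * p m) = (\<Oplus>m\<in>Mon n. c \<odot> (p m \<odot> mon m))"
    unfolding pol_def by (rule A.finsum_cong') (auto simp: smult_mult)
  then show ?thesis unfolding pol_def by (simp add: smult_finsum)
qed

lemma ev_add: "ev (\<lambda>m. p m + q m) = ev p \<oplus> ev q"
  by (rule ev_eqI) (simp add: pol_add cg_add ev(2))

lemma ev_smult: "ev (\<lambda>m. c * p m) = c \<odot> ev p"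
  by (rule ev_eqI) (simp add: pol_smult cg_smult ev(2))

lemma ev_zero: "ev (\<lambda>m. 0) = \<zero>"
  using ev_smult[of 0 "\<lambda>m. 0"] ev(1) by simp

lemma smult_sum_left:
  assumes "finite B" "x \<in> carrier A"
  shows "(\<Sum>b\<in>B. c b) \<odot> x = (\<Oplus>b\<in>B. c b \<odot> x)"
  using assms(1)
proof (induction B rule: finite_induct)
  case (insert b B)
  then show ?case using assms(2) by (simp add: smult_add_left)
qed (simp add: assms(2))

text \<open>In the product of the truncations the pairs of monomials of total degree below
  \<open>n\<close> give exactly the truncated convolution; all other pairs lie in \<open>P n\<close>
  by \<open>mon_P\<close>.\<close>

lemma pol_mult: "cg n (pol n p \<otimes> pol n q) (pol n (conv p q))"
proof -
  let ?f = "\<lambda>(x, y). (p x * q y) \<odot> mon (x + y)"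
  let ?D = "{(x, y). (x, y) \<in> Mon n \<times> Mon n \<and> size (x + y) < n}"
  let ?R = "{(x, y). (x, y) \<in> Mon n \<times> Mon n \<and> n \<le> size (x + y)}"
  have fin: "finite (Mon n \<times> Mon n)" by simp
  have "pol n p \<otimes> pol n q = (\<Oplus>x\<in>Mon n. \<Oplus>y\<in>Mon n. (p x \<odot> mon x) \<otimes> (q y \<odot> mon y))"
    unfolding pol_def
    by (subst A.finsum_ldistr, simp, simp, force, rule A.finsum_cong', simp, force,
        subst A.finsum_rdistr, auto)
  also have "\<dots> = (\<Oplus>x\<in>Mon n. \<Oplus>y\<in>Mon n. (p x * q y) \<odot> mon (x + y))"
    by (intro A.finsum_cong') (auto simp: smult_mult_left smult_mult_right mon_add mult.commute
          intro!: A.finsum_closed simp flip: smult_mult)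
  also have "\<dots> = (\<Oplus>xy\<in>Mon n \<times> Mon n. ?f xy)"
    by (subst A.finsum_Sigma) (simp_all add: case_prod_beta')
  also have "Mon n \<times> Mon n = ?D \<union> ?R" by auto
  also have "(\<Oplus>xy\<in>?D \<union> ?R. ?f xy) = (\<Oplus>xy\<in>?D. ?f xy) \<oplus> (\<Oplus>xy\<in>?R. ?f xy)"
    by (rule A.finsum_Un_disjoint) (auto intro: finite_subset[OF _ fin])
  finally have 1: "pol n p \<otimes> pol n q = (\<Oplus>xy\<in>?D. ?f xy) \<oplus> (\<Oplus>xy\<in>?R. ?f xy)" .
  have "?f xy \<in> P n" if xy: "xy \<in> ?R" for xy
  proof -
    obtain x y where "xy = (x, y)" "set_mset (x + y) \<subseteq> S" "n \<le> size (x + y)"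
      using xy by (auto simp: Mon_def)
    then show ?thesis using mon_P[of "x + y"] P_antimono[of n "size (x + y)"] P_subspaceD(4) by auto
  qed
  then have 2: "(\<Oplus>xy\<in>?R. ?f xy) \<in> P n" by (rule subspace_finsum[OF subspace_P])
  have "pol n (conv p q) = (\<Oplus>m\<in>Mon n. \<Oplus>x\<in>{x. x \<subseteq># m}. (p x * q (m - x)) \<odot> mon m)"
    unfolding pol_def conv_def
    by (rule A.finsum_cong') (auto simp: smult_sum_left finite_submultisets intro!: A.finsum_closed)
  also have "\<dots> = finsum A (\<lambda>(m, x). (p x * q (m - x)) \<odot> mon m) (SIGMA m:Mon n. {x. x \<subseteq># m})"
    by (subst A.finsum_Sigma) (simp_all add: finite_submultisets)
  \<comment> \<open>A monomial of degree below \<open>n\<close> with a divisor is the same as a pair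
    of cofactors of total degree below \<open>n\<close>; both cofactors then automatically have
    degree below \<open>n\<close>.\<close>
  also have "(SIGMA m:Mon n. {x. x \<subseteq># m}) = (\<lambda>(x, y). (x + y, x)) ` ?D"
  proof (intro equalityI subsetI)
    fix mx assume "mx \<in> (SIGMA m:Mon n. {x. x \<subseteq># m})"
    then obtain m x where mx: "mx = (m, x)" "m \<in> Mon n" "x \<subseteq># m" by auto
    then have "m = x + (m - x)" by simp
    then have "size x + size (m - x) = size m" by (metis size_union)
    moreover have "x \<in> Mon n" "m - x \<in> Mon n"
      using mx set_mset_mono[OF mx(3)] size_mset_mono[OF mx(3)] unfolding Mon_def
      by (auto dest: in_diffD simp: size_Diff_submset)
    ultimately show "mx \<in> (\<lambda>(x, y). (x + y, x)) ` ?D"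
      using mx by (intro image_eqI[where x = "(x, m - x)"]) (auto simp: Mon_def)
  qed (auto simp: Mon_def)
  also have "finsum A (\<lambda>(m, x). (p x * q (m - x)) \<odot> mon m) ((\<lambda>(x, y). (x + y, x)) ` ?D) = (\<Oplus>xy\<in>?D. ?f xy)"
    by (subst A.finsum_reindex) (auto simp: inj_on_def case_prod_beta')
  finally have 3: "pol n (conv p q) = (\<Oplus>xy\<in>?D. ?f xy)" .
  have "(\<Oplus>xy\<in>?D. ?f xy) \<in> carrier A" by (rule A.finsum_closed) auto
  then show ?thesis unfolding 1 3 using 2 by (rule cg_add_P)
qed

lemma ev_mult: "ev (conv p q) = ev p \<otimes> ev q"
  by (rule ev_eqI) (rule cg_trans[OF cg_mult[OF ev(2) ev(2)] pol_mult])

lemma pol_single: "set_mset m \<subseteq> S \<Longrightarrow> size m < n \<Longrightarrow> pol n (\<lambda>m'. if m' = m then 1 else 0) = mon m"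
proof -
  assume m: "set_mset m \<subseteq> S" "size m < n"
  have "pol n (\<lambda>m'. if m' = m then 1 else 0) = (\<Oplus>m'\<in>Mon n. if m = m' then mon m' else \<zero>)"
    unfolding pol_def by (rule A.finsum_cong') auto
  also have "\<dots> = mon m" by (rule A.finsum_singleton) (use m in \<open>simp_all, simp add: Mon_def\<close>)
  finally show ?thesis .
qed

lemma ev_low:
  assumes "\<And>m. size m < k \<Longrightarrow> p m = 0"
  shows "ev p \<in> P k"
proof -
  have "pol k p = pol k (\<lambda>m. 0)" by (rule pol_cong) (use assms in \<open>auto simp: Mon_def\<close>)
  also have "\<dots> = \<zero>" using pol_smult[of k 0 "\<lambda>m. 0"] by simp
  finally show ?thesis using ev(2)[of k p] by (simp add: cg_zero_iff)
qed

lemma ev_single: "set_mset m \<subseteq> S \<Longrightarrow> ev (\<lambda>m'. if m' = m then 1 else 0) = mon m"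
proof (rule ev_eqI)
  fix n
  assume m: "set_mset m \<subseteq> S"
  show "cg n (mon m) (pol n (\<lambda>m'. if m' = m then 1 else 0))"
  proof (cases "size m < n")
    case False
    have "pol n (\<lambda>m'. if m' = m then 1 else 0) = pol n (\<lambda>m'. 0 * 0)"
      by (rule pol_cong) (use False in \<open>auto simp: Mon_def\<close>)
    also have "\<dots> = \<zero>" unfolding pol_smult by simp
    finally have "pol n (\<lambda>m'. if m' = m then 1 else 0) = \<zero>" .
    then show ?thesis using False mon_P[OF m] P_antimono[of n "size m"] by (auto simp: cg_zero_iff)
  qed (simp add: pol_single[OF m])
qed

lemma ev_sum: "finite B \<Longrightarrow> ev (\<lambda>m. \<Sum>b\<in>B. p b m) = (\<Oplus>b\<in>B. ev (p b))"
proof (induction B rule: finite_induct)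
  case (insert b B)
  then show ?case by (simp add: ev_add ev(1))
qed (simp add: ev_zero)

text \<open>The approximation step behind surjectivity of \<open>ev\<close>: generation of the
  maximal ideal modulo its square propagates to all graded pieces, by multiplying a linear form with
  a form of degree one less.\<close>

lemma P_deg:
  assumes "a \<in> P k"
  shows "\<exists>c. cg (Suc k) a (\<Oplus>m\<in>deg k. c m \<odot> mon m)"
proof -
  define Q where "Q k = {a \<in> carrier A. \<exists>c. cg (Suc k) a (\<Oplus>m\<in>deg k. c m \<odot> mon m)}" for k
  have Q_add: "a \<oplus> b \<in> Q k" if ab: "a \<in> Q k" "b \<in> Q k" for a b k
  proof -
    from ab obtain c d where cd: "cg (Suc k) a (\<Oplus>m\<in>deg k. c m \<odot> mon m)"
      "cg (Suc k) b (\<Oplus>m\<in>deg k. d m \<odot> mon m)" unfolding Q_def by blast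
    have "(\<Oplus>m\<in>deg k. (c m + d m) \<odot> mon m) = (\<Oplus>m\<in>deg k. c m \<odot> mon m \<oplus> d m \<odot> mon m)"
      by (rule A.finsum_cong') (auto simp: smult_add_left)
    also have "\<dots> = (\<Oplus>m\<in>deg k. c m \<odot> mon m) \<oplus> (\<Oplus>m\<in>deg k. d m \<odot> mon m)"
      by (rule A.finsum_addf) auto
    finally have "cg (Suc k) (a \<oplus> b) (\<Oplus>m\<in>deg k. (c m + d m) \<odot> mon m)" using cg_add[OF cd] by simp
    then show ?thesis using ab unfolding Q_def
      by (intro CollectI conjI exI[where x = "\<lambda>m. c m + d m"]) auto
  qed
  have Q_P: "a \<in> Q k" if "a \<in> P (Suc k)" for a k
    unfolding Q_def using that P_carrier[OF that]
    by (intro CollectI conjI exI[where x = "\<lambda>m. 0"]) (simp_all add: cg_zero_iff)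
  have Q_mon: "c \<odot> mon m \<in> Q k" if "m \<in> deg k" for c m k
  proof -
    have "(\<Oplus>m'\<in>deg k. (if m' = m then c else 0) \<odot> mon m') = (\<Oplus>m'\<in>deg k. if m = m' then c \<odot> mon m' else \<zero>)"
      by (rule A.finsum_cong') auto
    also have "\<dots> = c \<odot> mon m" by (rule A.finsum_singleton[OF that]) auto
    finally have "cg (Suc k) (c \<odot> mon m) (\<Oplus>m'\<in>deg k. (if m' = m then c else 0) \<odot> mon m')" by simp
    then show ?thesis unfolding Q_def
      by (intro CollectI conjI exI[where x = "\<lambda>m'. if m' = m then c else 0"]) auto
  qed
  have Q_zero: "\<zero> \<in> Q k" for k using Q_P P_subspaceD(2) by blast
  have Q_sum: "finsum A f B \<in> Q k" if "finite B" "\<And>i. i \<in> B \<Longrightarrow> f i \<in> Q k" for f B k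
    by (rule A.finsum_closed_subset[OF that(1) Q_zero Q_add _ that(2)]) (auto simp: Q_def)
  have "a \<in> Q k"
    using assms
  proof (induction k arbitrary: a)
    case 0
    \<comment> \<open>In degree \<open>0\<close> the claim is that the residue field is the ground
      field, and the coefficient is the augmentation.\<close>
    have "deg 0 = {{#}}" by (simp add: deg_def)
    then show ?case unfolding Q_def using cg_augmentation[of a] 0
      by (intro CollectI conjI exI[where x = "\<lambda>m. augmentation A a"]) simp_all
  next
    case (Suc k)
    have "a \<in> ideal_prod A (max_ideal A) (P k)" using Suc.prems by (simp add: max_power.simps)
    then show ?case
    proof (induction rule: ideal_prod.induct)
      case (prod x y)
      have x: "x \<in> P 1" using prod(1) by (simp only: P_1)
      have xc: "x \<in> carrier A" and yc: "y \<in> carrier A" using P_carrier x prod(2) by blast+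
      obtain c where c: "cg 2 x (\<Oplus>s\<in>S. c s \<odot> t s)" using t_generates[OF x] by blast
      obtain d where d: "cg (Suc k) y (\<Oplus>m\<in>deg k. d m \<odot> mon m)"
        using Suc.IH[OF prod(2)] unfolding Q_def by blast
      define x' where "x' = (\<Oplus>s\<in>S. c s \<odot> t s)"
      define y' where "y' = (\<Oplus>m\<in>deg k. d m \<odot> mon m)"
      have x'P: "x' \<in> P 1" unfolding x'_def
        by (rule subspace_finsum[OF subspace_P]) (rule P_subspaceD(4)[OF t_P])
      have x'c: "x' \<in> carrier A" and y'c: "y' \<in> carrier A"
        using cg_carrier[OF c] cg_carrier[OF d] by (simp_all add: x'_def y'_def)
      \<comment> \<open>Replacing both factors by forms leaves two errors, one in \<open>P 2\<close>
        times \<open>P k\<close> and one in \<open>P 1\<close> times \<open>P (Suc k)\<close>; both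
        lie one step deeper than the product.\<close>
      have "x \<otimes> y = x' \<otimes> y' \<oplus> ((x \<ominus> x') \<otimes> y \<oplus> x' \<otimes> (y \<ominus> y'))"
        using xc yc x'c y'c by algebra
      moreover have "(x \<ominus> x') \<otimes> y \<in> P (Suc (Suc k))"
        using P_mult[of "x \<ominus> x'" 2 y k] c prod(2) by (simp add: cg_def x'_def)
      moreover have "x' \<otimes> (y \<ominus> y') \<in> P (Suc (Suc k))"
        using P_mult[OF x'P, of "y \<ominus> y'" "Suc k"] d by (simp add: cg_def y'_def)
      moreover have "x' \<otimes> y' \<in> Q (Suc k)"
      proof -
        have "x' \<otimes> y' = (\<Oplus>s\<in>S. (c s \<odot> t s) \<otimes> y')"
          unfolding x'_def by (rule A.finsum_ldistr[OF finite_S y'c]) (use t_carrier in auto)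
        moreover have "(c s \<odot> t s) \<otimes> y' \<in> Q (Suc k)" if s: "s \<in> S" for s
        proof -
          have "(c s \<odot> t s) \<otimes> y' = (\<Oplus>m\<in>deg k. (c s \<odot> t s) \<otimes> (d m \<odot> mon m))"
            unfolding y'_def by (rule A.finsum_rdistr) (use t_carrier s in auto)
          moreover have "(c s \<odot> t s) \<otimes> (d m \<odot> mon m) \<in> Q (Suc k)" if m: "m \<in> deg k" for m
          proof -
            have "(c s \<odot> t s) \<otimes> (d m \<odot> mon m) = (c s * d m) \<odot> mon (add_mset s m)"
              using mon_add[of "{#s#}" m] mon_single[OF s] t_carrier[OF s]
              by (simp add: smult_mult_left smult_mult_right mult.commute flip: smult_mult)
            moreover have "add_mset s m \<in> deg (Suc k)"
              using s m by (auto simp: deg_def multisets_of_size_def)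
            ultimately show ?thesis using Q_mon by simp
          qed
          ultimately show ?thesis using Q_sum[OF finite_deg] by simp
        qed
        ultimately show ?thesis using Q_sum[OF finite_S] by simp
      qed
      ultimately show ?case using Q_add Q_P P_subspaceD(3) by metis
    next
      case (sum x y)
      then show ?case using Q_add by blast
    qed
  qed
  then show ?thesis by (auto simp: Q_def)
qed

text \<open>Successive approximation by forms of increasing degree. That the series starts in degree
  \<open>n\<close> for elements of \<open>P n\<close> is what later makes division compatible with
  the filtration.\<close>

lemma ev_surj:
  assumes "a \<in> P n"
  obtains p where "p \<in> carrier PS" "\<And>m. size m < n \<Longrightarrow> p m = 0" "ev p = a"
proof -
  have "\<forall>k. \<forall>b\<in>P k. \<exists>c. cg (Suc k) b (\<Oplus>m\<in>deg k. c m \<odot> mon m)" using P_deg by blast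
  then have "\<forall>k. \<exists>C. \<forall>b\<in>P k. cg (Suc k) b (\<Oplus>m\<in>deg k. C b m \<odot> mon m)"
    by (intro allI bchoice) blast
  from choice[OF this] obtain C
    where C: "\<And>k b. b \<in> P k \<Longrightarrow> cg (Suc k) b (\<Oplus>m\<in>deg k. C k b m \<odot> mon m)" by blast
  \<comment> \<open>The remainder after \<open>j\<close> corrections. It lies in
    \<open>P (n + j)\<close>, and subtracting a form of degree \<open>n + j\<close> given by
    \<open>P_deg\<close> moves it one step deeper.\<close>
  define r where "r = rec_nat a (\<lambda>j b. b \<ominus> (\<Oplus>m\<in>deg (n + j). C (n + j) b m \<odot> mon m))"
  have r_0: "r 0 = a" and r_Suc: "r (Suc j) = r j \<ominus> (\<Oplus>m\<in>deg (n + j). C (n + j) (r j) m \<odot> mon m)" for j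
    by (simp_all add: r_def)
  have r_P: "r j \<in> P (n + j)" for j
  proof (induction j)
    case (Suc j)
    then show ?case using C[OF Suc] by (simp add: r_Suc cg_def)
  qed (simp add: r_0 assms)
  \<comment> \<open>The coefficients in degree \<open>n + j\<close> are those of the form subtracted
    from the remainder \<open>r j\<close>.\<close>
  define p where "p m = (if set_mset m \<subseteq> S \<and> n \<le> size m then C (size m) (r (size m - n)) m else 0)" for m
  have low: "p m = 0" if "size m < n" for m using that by (simp add: p_def)
  have pol_0: "pol n p = \<zero>"
  proof -
    have "pol n p = pol n (\<lambda>m. 0 * 0)" by (rule pol_cong) (auto simp: low Mon_def)
    then show ?thesis unfolding pol_smult by simp
  qed
  have pol_r: "a \<ominus> pol (n + j) p = r j" for j
  proof (induction j)
    case 0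
    then show ?case using P_carrier[OF assms] by (simp add: pol_0 r_0 A.minus_eq)
  next
    case (Suc j)
    have "(\<Oplus>m\<in>deg (n + j). p m \<odot> mon m) = (\<Oplus>m\<in>deg (n + j). C (n + j) (r j) m \<odot> mon m)"
      by (rule A.finsum_cong') (auto simp: p_def deg_def multisets_of_size_def)
    moreover have "(\<Oplus>m\<in>deg (n + j). C (n + j) (r j) m \<odot> mon m) \<in> carrier A"
      by (rule A.finsum_closed) auto
    ultimately have "a \<ominus> pol (n + Suc j) p = a \<ominus> pol (n + j) p \<ominus> (\<Oplus>m\<in>deg (n + j). C (n + j) (r j) m \<odot> mon m)"
      using P_carrier[OF assms] pol_carrier[of "n + j" p] unfolding add_Suc_right pol_Suc by (simp add: A.minus_eq A.minus_add A.a_assoc)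
    then show ?case by (simp add: Suc r_Suc)
  qed
  show ?thesis
  proof
    show "p \<in> carrier PS" by (auto simp: power_series_simps p_def)
    show "ev p = a"
    proof (rule ev_eqI)
      fix k
      have "cg (n + k) a (pol (n + k) p)"
        using r_P[of k] P_carrier[OF assms] by (simp add: cg_def pol_r)
      then have "cg k a (pol (n + k) p)" by (rule cg_mono) simp
      moreover have "cg k (pol (n + k) p) (pol k p)"
        using cg_trans[OF cg_sym[OF cg_mono[OF ev(2)]] ev(2), of k "n + k" p] by simp
      ultimately show "cg k a (pol k p)" by (rule cg_trans)
    qed
  qed (rule low)
qed

end

section \<open>Presentation of the base as a quotient of power series\<close>

lemma power_series_scale:
  "p \<in> carrier (power_series S) \<Longrightarrow> (\<lambda>m. c * p m) \<in> carrier (power_series S)"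
  unfolding power_series_simps mem_Collect_eq by (metis mult_zero_right)

context generated_base
begin

lemma ev_ring_hom: "ev \<in> ring_hom PS A"
proof (rule ring_hom_memI)
  show "ev \<one>\<^bsub>PS\<^esub> = \<one>" using ev_single[of "{#}"] by (simp add: power_series_simps)
qed (simp_all add: power_series_simps(2,5) ev_mult ev_add ev(1))

lemma ev_image: "ev ` carrier PS = carrier A"
proof
  show "carrier A \<subseteq> ev ` carrier PS"
  proof
    fix a assume "a \<in> carrier A"
    then have "a \<in> P 0" by simp
    then obtain p where "p \<in> carrier PS" "ev p = a" by (rule ev_surj)
    then show "a \<in> ev ` carrier PS" by blast
  qed
qed (use ev(1) in auto)

lemma ev_onto:
  assumes "a \<in> carrier A"
  obtains p where "p \<in> carrier PS" "ev p = a"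
  using assms unfolding ev_image[symmetric] by blast

theorem isomorphic_quotient_power_series:
  "\<exists>I. finitely_generated_ideal I PS \<and> algebra_isomorphic A (quot_algebra PS I)"
proof -
  interpret PS: cring PS by (rule cring_power_series)
  interpret h: ring_hom_ring PS A ev
    by (intro ring_hom_ringI2 PS.ring_axioms A.ring_axioms ev_ring_hom)
  define I where "I = a_kernel PS A ev"
  have I: "ideal I PS" unfolding I_def by (rule h.kernel_is_ideal)
  interpret I: ideal I PS by (rule I)
  let ?Q = "quot_algebra PS I"
  define g where "g = (\<lambda>Y. the_elem (ev ` Y))"
  have g: "g \<in> ring_iso (PS Quot I) A"
    unfolding g_def I_def by (rule h.FactRing_iso_set[OF ev_image])
  have quot: "ring (PS Quot I)" by (rule I.quotient_is_ring)
  define f where "f = inv_into (carrier (PS Quot I)) g"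
  have f: "f \<in> ring_iso A (PS Quot I)"
    unfolding f_def by (rule ring_iso_set_sym[OF quot g])
  have f_iso: "f \<in> ring_iso A ?Q"
    using f by (simp add: ring_iso_def ring_hom_def quot_algebra_def)
  have carr: "carrier (PS Quot I) = (\<lambda>p. I +>\<^bsub>PS\<^esub> p) ` carrier PS"
    by (auto simp: FactRing_def A_RCOSETS_def')
  have f_ev: "f (ev p) = I +>\<^bsub>PS\<^esub> p" if p: "p \<in> carrier PS" for p
  proof -
    have "g (I +>\<^bsub>PS\<^esub> p) = ev p" unfolding g_def I_def by (rule h.the_elem_simp[OF p])
    moreover have "inj_on g (carrier (PS Quot I))" using g by (simp add: ring_iso_def bij_betw_def)
    moreover have "I +>\<^bsub>PS\<^esub> p \<in> carrier (PS Quot I)" unfolding carr using p by (rule imageI)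
    ultimately show ?thesis unfolding f_def using inv_into_f_f[of g _ "I +>\<^bsub>PS\<^esub> p"] by simp
  qed
  have coset_eq: "I +>\<^bsub>PS\<^esub> p = I +>\<^bsub>PS\<^esub> q \<longleftrightarrow> ev p = ev q"
    if "p \<in> carrier PS" "q \<in> carrier PS" for p q
  proof -
    have "inj_on f (carrier A)" using f by (simp add: ring_iso_def bij_betw_def)
    from inj_on_eq_iff[OF this ev(1)[of p] ev(1)[of q]] show ?thesis
      unfolding f_ev[OF that(1)] f_ev[OF that(2)] .
  qed
  note scale = power_series_scale[of _ S]
  have "f (c \<odot> a) = c \<odot>\<^bsub>?Q\<^esub> f a" if a: "a \<in> carrier A" for c a
  proof -
    obtain p where p: "p \<in> carrier PS" "ev p = a" by (rule ev_onto[OF a])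
    have mem: "q \<in> carrier PS \<and> ev q = ev p" if q: "q \<in> I +>\<^bsub>PS\<^esub> p" for q
    proof -
      have qc: "q \<in> carrier PS" using q p(1) I.a_elemrcos_carrier by blast
      moreover have "I +>\<^bsub>PS\<^esub> p = I +>\<^bsub>PS\<^esub> q"
        by (rule PS.a_repr_independence[OF q p(1) I.a_subgroup])
      ultimately show ?thesis using coset_eq[OF p(1)] by simp
    qed
    have "c \<odot>\<^bsub>?Q\<^esub> f a = (\<Union>q\<in>I +>\<^bsub>PS\<^esub> p. I +>\<^bsub>PS\<^esub> (\<lambda>m. c * q m))"
      using f_ev[OF p(1)] p(2) by (simp add: quot_algebra_def power_series_simps)
    \<comment> \<open>The representatives of a coset have the same value under \<open>ev\<close>,
      and so have their multiples; hence all members of the union are equal.\<close>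
    also have "\<dots> = (\<Union>q\<in>I +>\<^bsub>PS\<^esub> p. I +>\<^bsub>PS\<^esub> (\<lambda>m. c * p m))"
    proof (rule SUP_cong[OF refl])
      fix q assume "q \<in> I +>\<^bsub>PS\<^esub> p"
      then have q: "q \<in> carrier PS" "ev q = ev p" using mem by blast+
      show "I +>\<^bsub>PS\<^esub> (\<lambda>m. c * q m) = I +>\<^bsub>PS\<^esub> (\<lambda>m. c * p m)"
        unfolding coset_eq[OF scale[OF q(1)] scale[OF p(1)]] ev_smult q(2) ..
    qed
    also have "\<dots> = I +>\<^bsub>PS\<^esub> (\<lambda>m. c * p m)" using I.a_rcos_self[OF p(1)] by blast
    also have "\<dots> = f (c \<odot> a)" using f_ev[OF scale[OF p(1)], of c] p(2) by (simp add: ev_smult)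
    finally show ?thesis by simp
  qed
  with f_iso have "algebra_isomorphic A ?Q" unfolding algebra_isomorphic_def by blast
  with power_series_noetherian[OF finite_S I] show ?thesis by blast
qed

text \<open>Division by the generators, obtained from a power series for \<open>a\<close> by
  removing one variable from each nonconstant monomial. The last clause is what keeps quotients of
  summable families summable.\<close>

lemma decompose:
  assumes a: "a \<in> carrier A"
  shows "\<exists>b. (\<forall>s\<in>S. b s \<in> carrier A) \<and> a = augmentation A a \<odot> \<one> \<oplus> (\<Oplus>s\<in>S. t s \<otimes> b s) \<and>
    (\<forall>n. a \<in> P (Suc n) \<longrightarrow> (\<forall>s\<in>S. b s \<in> P n))"
proof (cases "a = \<zero>")
  case True
  have "(\<Oplus>s\<in>S. t s \<otimes> \<zero>) = \<zero>"
    by (rule A.add.finprod_one_eqI) (use t_carrier in auto)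
  moreover have "augmentation A \<zero> = 0" using augmentation_eq_0_iff[of \<zero>] P_subspaceD(2) by auto
  ultimately show ?thesis using True P_subspaceD(2) by (intro exI[where x = "\<lambda>s. \<zero>"]) auto
next
  case False
  then obtain N where N: "a \<notin> P N" using cg_all_imp_eq[of a \<zero>] by (auto simp: cg_zero_iff)
  \<comment> \<open>The first power of the maximal ideal that misses \<open>a\<close>; its
    predecessor is the exact order of \<open>a\<close>. A series starting in that degree lets one
    choice of \<open>b\<close> serve all \<open>n\<close>.\<close>
  define k where "k = (LEAST N. a \<notin> P N)"
  have k: "a \<notin> P k" "\<And>j. j < k \<Longrightarrow> a \<in> P j"
    unfolding k_def using LeastI[of "\<lambda>N. a \<notin> P N", OF N] not_less_Least by auto
  then obtain n where n: "k = Suc n" using a by (metis P_0 not0_implies_Suc k(1))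
  then have "a \<in> P n" using k by simp
  then obtain p where p: "p \<in> carrier PS" "\<And>m. size m < n \<Longrightarrow> p m = 0" "ev p = a" by (rule ev_surj) (rule that; assumption)
  \<comment> \<open>Selects the variable to be removed from each nonempty monomial, so that no
    monomial is counted twice.\<close>
  define \<sigma> where "\<sigma> m = (SOME s. s \<in># m)" for m :: "'x multiset"
  have \<sigma>: "\<sigma> m \<in># m" if "m \<noteq> {#}" for m
    unfolding \<sigma>_def using multiset_nonemptyE[OF that] by (metis someI)
  define r where "r s m = (if \<sigma> (add_mset s m) = s then p (add_mset s m) else 0)" for s m
  define v where "v s = (\<lambda>m. if m = {#s#} then 1 else 0 :: 'k)" for s :: 'x
  have conv_v: "conv (v s) q m = (if s \<in># m then q (m - {#s#}) else 0)" for s q m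
  proof -
    have "conv (v s) q m = (\<Sum>x\<in>{x. x \<subseteq># m}. if x = {#s#} then q (m - {#s#}) else 0)"
      unfolding conv_def v_def by (rule sum.cong) auto
    then show ?thesis by (simp add: finite_submultisets)
  qed
  have p_eq: "p = (\<lambda>m. p {#} * (if m = {#} then 1 else 0) + (\<Sum>s\<in>S. conv (v s) (r s) m))"
  proof
    fix m
    show "p m = p {#} * (if m = {#} then 1 else 0) + (\<Sum>s\<in>S. conv (v s) (r s) m)"
    proof (cases "m = {#}")
      case m: False
      have "(\<Sum>s\<in>S. conv (v s) (r s) m) = (\<Sum>s\<in>S. if s = \<sigma> m then p m else 0)"
        by (rule sum.cong) (use \<sigma>[OF m] in \<open>auto simp: conv_v r_def\<close>)
      also have "\<dots> = (if \<sigma> m \<in> S then p m else 0)" using finite_S by simp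
      also have "\<dots> = p m" using \<sigma>[OF m] p(1) unfolding power_series_simps by auto
      finally show ?thesis using m by simp
    qed (simp add: conv_v)
  qed
  have "a = ev (\<lambda>m. p {#} * (if m = {#} then 1 else 0) + (\<Sum>s\<in>S. conv (v s) (r s) m))"
    using p(3) p_eq by simp
  also have "\<dots> = p {#} \<odot> \<one> \<oplus> (\<Oplus>s\<in>S. ev (conv (v s) (r s)))"
    unfolding ev_add ev_smult by (simp add: ev_sum[OF finite_S] ev_single)
  also have "(\<Oplus>s\<in>S. ev (conv (v s) (r s))) = (\<Oplus>s\<in>S. t s \<otimes> ev (r s))"
    by (rule A.finsum_cong') (use t_carrier ev(1) in \<open>auto simp: ev_mult v_def ev_single mon_single\<close>)
  finally have eq: "a = p {#} \<odot> \<one> \<oplus> (\<Oplus>s\<in>S. t s \<otimes> ev (r s))" .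
  have "(\<Oplus>s\<in>S. t s \<otimes> ev (r s)) \<in> P 1"
  proof (rule subspace_finsum[OF subspace_P])
    show "t s \<otimes> ev (r s) \<in> P 1" if "s \<in> S" for s
      using P_mult[of "t s" 1 "ev (r s)" 0] t_P[OF that] ev(1) by simp
  qed
  then have "cg 1 a (p {#} \<odot> \<one>)" by (subst eq) (rule cg_add_P, simp)
  then have "augmentation A a = p {#}" by (rule augmentation_unique)
  \<comment> \<open>If \<open>a\<close> is in \<open>P (Suc j)\<close>, then \<open>Suc j\<close> is
    at most the order of \<open>a\<close>, and removing one variable lowers the starting degree of
    the series by one.\<close>
  moreover have "ev (r s) \<in> P j" if "a \<in> P (Suc j)" for j s
  proof (rule ev_low)
    fix m :: "'x multiset"
    assume "size m < j"
    moreover have "Suc j < k" using k(1) that P_antimono[of k "Suc j"] by (meson not_le subsetD)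
    ultimately show "r s m = 0" using p(2)[of "add_mset s m"] n by (simp add: r_def)
  qed
  ultimately show ?thesis using eq ev(1) by (intro exI[where x = "\<lambda>s. ev (r s)"]) auto
qed

text \<open>The functional is constructed on the space of all functions on monomials, where the library
  provides bases, and descends along the surjection \<open>ev\<close>.\<close>

lemma separating_functional_generated:
  assumes a: "a \<in> carrier A" "a \<notin> P n"
  obtains g where "g \<in> carrier (dual A)" "\<And>b. b \<in> P n \<Longrightarrow> g b = 0" "g a = 1"
proof -
  let ?sc = "\<lambda>(c :: 'k) (p :: 'x multiset \<Rightarrow> 'k) m. c * p m"
  interpret F: vector_space ?sc
    by unfold_locales (auto simp: fun_eq_iff algebra_simps)
  interpret FK: vector_space_pair ?sc "(*) :: 'k \<Rightarrow> 'k \<Rightarrow> 'k"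
    by unfold_locales (auto simp: algebra_simps)
  \<comment> \<open>The preimage of \<open>P n\<close>. It contains the kernel of \<open>ev\<close>
    on power series, so a functional that kills \<open>J\<close> descends to the base.\<close>
  define J where "J = {p \<in> carrier PS. ev p \<in> P n}"
  have sumfun: "p + q = (\<lambda>m. p m + q m)" for p q :: "'x multiset \<Rightarrow> 'k"
    by (simp add: fun_eq_iff)
  have zerofun: "(0 :: 'x multiset \<Rightarrow> 'k) = (\<lambda>m. 0)" by (simp add: fun_eq_iff)
  have PS_add: "(\<lambda>m. p m + q m) \<in> carrier PS" if "p \<in> carrier PS" "q \<in> carrier PS" for p q
  proof -
    interpret PS: cring PS by (rule cring_power_series)
    show ?thesis using PS.a_closed[OF that] by (simp add: power_series_simps(5))
  qed
  note PS_scale = power_series_scale[of _ S]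
  have J: "F.subspace J"
    unfolding F.subspace_def sumfun zerofun J_def
    using PS_add PS_scale P_subspaceD(2,3,4)
    by (auto simp: ev_add ev_smult ev_zero power_series_simps(1))
  obtain B where B: "B \<subseteq> J" "F.independent B" "J \<subseteq> F.span B"
    by (rule F.maximal_independent_subset)
  have spanB: "F.span B = J" using B(1,3) F.span_minimal[OF B(1) J] by blast
  obtain p0 where p0: "p0 \<in> carrier PS" "ev p0 = a" by (rule ev_onto[OF a(1)])
  have "p0 \<notin> J" using p0 a(2) by (simp add: J_def)
  \<comment> \<open>\<open>p0\<close> is outside the span \<open>J\<close> of \<open>B\<close>, so
    the value \<open>1\<close> at \<open>p0\<close> can be prescribed together with zeros on
    \<open>B\<close>.\<close>
  then have "F.independent (insert p0 B)" using B(2) spanB F.independent_insert[of p0 B] by auto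
  from FK.linear_independent_extend[OF this, of "\<lambda>q. if q = p0 then 1 else 0"]
  obtain G where G: "Vector_Spaces.linear ?sc (*) G" "G p0 = 1" "\<And>q. q \<in> B \<Longrightarrow> q \<noteq> p0 \<Longrightarrow> G q = 0"
    by auto
  interpret G: Vector_Spaces.linear ?sc "(*)" G by (rule G(1))
  have "p0 \<notin> B" using \<open>p0 \<notin> J\<close> B(1) by blast
  then have G_J: "G q = 0" if "q \<in> J" for q
    using FK.linear_eq_0_on_span[OF G(1), of B q] G(3) that spanB by blast
  define g where "g b = (if b \<in> carrier A then G (SOME p. p \<in> carrier PS \<and> ev p = b) else 0)" for b
  have g_ev: "g (ev p) = G p" if p: "p \<in> carrier PS" for p
  proof -
    define q where "q = (SOME q. q \<in> carrier PS \<and> ev q = ev p)"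
    have q: "q \<in> carrier PS \<and> ev q = ev p" unfolding q_def by (rule someI[of _ p]) (simp add: p)
    have d: "p + (\<lambda>m. (-1) * q m) \<in> J"
    proof -
      have "ev (\<lambda>m. p m + (-1) * q m) = ev p \<oplus> (-1) \<odot> ev q" by (simp only: ev_add ev_smult)
      also have "\<dots> = \<zero>" using q ev(1) by (simp add: smult_minus_one A.r_neg)
      finally have "ev (\<lambda>m. p m + (-1) * q m) \<in> P n" using P_subspaceD(2) by simp
      then show ?thesis unfolding J_def sumfun using PS_add[OF p PS_scale[of q "- 1"]] q by simp
    qed
    have "G (p + (\<lambda>m. (-1) * q m)) = G p + (-1) * G q" by (simp only: G.add G.scale)
    then have "G p = G q" using G_J[OF d] by simp
    then show ?thesis by (simp add: g_def ev(1) q_def)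
  qed
  show ?thesis
  proof
    show "g \<in> carrier (dual A)"
      unfolding dual_iff
    proof (intro conjI ballI allI impI)
      fix b c assume "b \<in> carrier A" "c \<in> carrier A"
      then obtain p q where pq: "p \<in> carrier PS" "q \<in> carrier PS" "b = ev p" "c = ev q"
        by (metis ev_onto)
      then have "g (b \<oplus> c) = G (p + q)" using g_ev[OF PS_add[of p q]] by (simp add: ev_add sumfun)
      then show "g (b \<oplus> c) = g b + g c" using pq g_ev by (simp add: G.add)
    next
      fix c b assume "b \<in> carrier A"
      then obtain p where p: "p \<in> carrier PS" "b = ev p" by (metis ev_onto)
      then have "g (c \<odot> b) = G (\<lambda>m. c * p m)" using g_ev[OF PS_scale[of p c]] by (simp add: ev_smult)
      then show "g (c \<odot> b) = c * g b" using p g_ev by (simp add: G.scale)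
    qed (simp add: g_def)
    show "g b = 0" if "b \<in> P n" for b
    proof -
      have "b \<in> carrier A" by (rule P_carrier[OF that])
      then obtain p where "p \<in> carrier PS" "b = ev p" by (metis ev_onto)
      then show ?thesis using g_ev G_J that by (simp add: J_def)
    qed
    show "g a = 1" using g_ev[OF p0(1)] p0(2) G(2) by simp
  qed
qed

end

context local_base
begin

lemma generated_baseI:
  assumes "finite S" "\<And>s. s \<in> S \<Longrightarrow> t s \<in> P 1" "\<And>a. a \<in> P 1 \<Longrightarrow> \<exists>c. cg 2 a (\<Oplus>s\<in>S. c s \<odot> t s)"
  shows "generated_base A S t"
  by unfold_locales (fact assms)+

lemma separating_functional:
  assumes a: "a \<in> carrier A" "a \<notin> P n"
  obtains g where "g \<in> carrier (dual A)" "\<And>b. b \<in> P n \<Longrightarrow> g b = 0" "g a = 1"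
proof -
  obtain E :: "'a set set" and t x where "finite E" "\<And>e. e \<in> E \<Longrightarrow> t e \<in> P 1"
    "\<And>a. a \<in> P 1 \<Longrightarrow> cg 2 a (\<Oplus>e\<in>E. x e a \<odot> t e)"
    by (rule cotangent_basis) (rule that; assumption)
  then interpret generated_base A E t by (intro generated_baseI exI)
  show ?thesis by (rule separating_functional_generated[OF a]) (rule that)
qed

end

section \<open>Tensor products with a complete local base\<close>

context local_base
begin

lemma truncation_add: "a \<in> carrier A \<Longrightarrow> b \<in> carrier A \<Longrightarrow>
    (P n +> a) \<oplus>\<^bsub>truncation A n\<^esub> (P n +> b) = P n +> (a \<oplus> b)"
  by (simp add: truncation_def quot_algebra_def FactRing_def coset_add[OF subspace_P])

lemma truncation_smult: "a \<in> carrier A \<Longrightarrow> c \<odot>\<^bsub>truncation A n\<^esub> (P n +> a) = P n +> (c \<odot> a)"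
  using coset_smult[OF subspace_P, of a n c] by (simp add: truncation_def quot_algebra_def)

lemma truncation_one: "\<one>\<^bsub>truncation A n\<^esub> = P n +> \<one>"
  by (simp add: truncation_def quot_algebra_def FactRing_def)

lemma coset_in_truncation: "a \<in> carrier A \<Longrightarrow> P n +> a \<in> carrier (truncation A n)"
  by (simp add: carrier_truncation)

end

locale tensor_base = local_base A + L: vector_space sc
  for A :: "('k::field, 'a) module" (structure) and sc :: "'k \<Rightarrow> 'l::ab_group_add \<Rightarrow> 'l"
begin

abbreviation bil where "bil n \<equiv> bilinear_forms sc (truncation A n)"

text \<open>The image of \<open>a \<otimes> l\<close> in \<open>(A / \<mm>\<^sup>n) \<otimes> L\<close>.\<close>

definition pt :: "nat \<Rightarrow> 'a \<Rightarrow> 'l \<Rightarrow> ('k, 'a set, 'l) tensor" where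
  "pt n a l = pure_tensor sc (truncation A n) (P n +> a) l"

lemma bil_linear: "\<beta> \<in> bil n \<Longrightarrow> a \<in> carrier A \<Longrightarrow> Vector_Spaces.linear sc (*) (\<beta> (P n +> a))"
  by (simp add: bilinear_forms_def coset_in_truncation)

lemma bil_add: "\<beta> \<in> bil n \<Longrightarrow> a \<in> carrier A \<Longrightarrow> b \<in> carrier A \<Longrightarrow>
    \<beta> (P n +> (a \<oplus> b)) l = \<beta> (P n +> a) l + \<beta> (P n +> b) l"
  by (simp add: bilinear_forms_def coset_in_truncation flip: truncation_add)

lemma bil_smult: "\<beta> \<in> bil n \<Longrightarrow> a \<in> carrier A \<Longrightarrow> \<beta> (P n +> (c \<odot> a)) l = c * \<beta> (P n +> a) l"
  by (simp add: bilinear_forms_def coset_in_truncation flip: truncation_smult)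

lemma bil_add_right: "\<beta> \<in> bil n \<Longrightarrow> a \<in> carrier A \<Longrightarrow> \<beta> (P n +> a) (l + l') = \<beta> (P n +> a) l + \<beta> (P n +> a) l'"
  and bil_scale_right: "\<beta> \<in> bil n \<Longrightarrow> a \<in> carrier A \<Longrightarrow> \<beta> (P n +> a) (sc c l) = c * \<beta> (P n +> a) l"
proof -
  assume *: "\<beta> \<in> bil n" "a \<in> carrier A"
  interpret \<beta>: Vector_Spaces.linear sc "(*)" "\<beta> (P n +> a)" by (rule bil_linear[OF *])
  show "\<beta> (P n +> a) (l + l') = \<beta> (P n +> a) l + \<beta> (P n +> a) l'" by (rule \<beta>.add)
  show "\<beta> (P n +> a) (sc c l) = c * \<beta> (P n +> a) l" by (rule \<beta>.scale)
qed

lemma pt_outside: "\<beta> \<notin> bil n \<Longrightarrow> pt n a l \<beta> = 0"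
  by (simp add: pt_def pure_tensor_def)

lemma pt_inside: "\<beta> \<in> bil n \<Longrightarrow> pt n a l \<beta> = \<beta> (P n +> a) l"
  by (simp add: pt_def pure_tensor_def)

lemma pt_add_left: "a \<in> carrier A \<Longrightarrow> b \<in> carrier A \<Longrightarrow> pt n (a \<oplus> b) l \<beta> = pt n a l \<beta> + pt n b l \<beta>"
  by (cases "\<beta> \<in> bil n") (simp_all add: pt_outside pt_inside bil_add)

lemma pt_add_right: "a \<in> carrier A \<Longrightarrow> pt n a (l + l') \<beta> = pt n a l \<beta> + pt n a l' \<beta>"
  by (cases "\<beta> \<in> bil n") (simp_all add: pt_outside pt_inside bil_add_right)

lemma pt_smult: "a \<in> carrier A \<Longrightarrow> pt n (c \<odot> a) l = pt n a (sc c l)"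
proof
  fix \<beta> assume "a \<in> carrier A"
  then show "pt n (c \<odot> a) l \<beta> = pt n a (sc c l) \<beta>"
    by (cases "\<beta> \<in> bil n") (simp_all add: pt_outside pt_inside bil_smult bil_scale_right)
qed

lemma pt_cong: "cg n a b \<Longrightarrow> pt n a l = pt n b l"
  using coset_P_eq_iff[of a b n] by (simp add: pt_def cg_carrier)

lemma pt_zero_left [simp]: "pt n \<zero> l \<beta> = 0"
  by (metis A.l_zero A.zero_closed add_cancel_right_right pt_add_left)

lemma pt_zero_right [simp]: "a \<in> carrier A \<Longrightarrow> pt n a 0 \<beta> = 0"
  by (metis add.right_neutral add_cancel_right_right pt_add_right)

lemma pt_P: "a \<in> P n \<Longrightarrow> pt n a l \<beta> = 0"
  using pt_cong[of n a \<zero> l] by (simp add: cg_zero_iff)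

lemma pt_minus: "a \<in> carrier A \<Longrightarrow> pt n (\<ominus> a) l \<beta> = - pt n a l \<beta>"
  using pt_add_left[of "\<ominus> a" a n l \<beta>] by (simp add: A.l_neg eq_neg_iff_add_eq_0)

lemma pt_finsum_left: "finite I \<Longrightarrow> (\<And>i. i \<in> I \<Longrightarrow> a i \<in> carrier A) \<Longrightarrow>
    pt n (\<Oplus>i\<in>I. a i) l \<beta> = (\<Sum>i\<in>I. pt n (a i) l \<beta>)"
  by (induction I rule: finite_induct) (simp_all add: pt_add_left Pi_iff A.finsum_closed)

lemma pt_sum_right: "finite I \<Longrightarrow> a \<in> carrier A \<Longrightarrow> pt n a (\<Sum>i\<in>I. l i) \<beta> = (\<Sum>i\<in>I. pt n a (l i) \<beta>)"
  by (induction I rule: finite_induct) (simp_all add: pt_add_right)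

abbreviation T where "T n \<equiv> tensors sc (truncation A n)"

lemma sum_in_T:
  assumes "finite I" "\<And>i. i \<in> I \<Longrightarrow> a i \<in> carrier A"
  shows "(\<lambda>\<beta>. \<Sum>i\<in>I. pt n (a i) (l i) \<beta>) \<in> T n"
proof -
  obtain h where h: "bij_betw h {..<card I} I"
    using ex_bij_betw_nat_finite[OF assms(1)] by (auto simp: atLeast0LessThan)
  have "(\<lambda>\<beta>. \<Sum>i\<in>I. pt n (a i) (l i) \<beta>) = (\<lambda>\<beta>. \<Sum>j<card I. pure_tensor sc (truncation A n) (P n +> a (h j)) (l (h j)) \<beta>)"
    by (rule ext) (simp add: pt_def sum.reindex_bij_betw[OF h, symmetric])
  moreover have "\<forall>j<card I. P n +> a (h j) \<in> carrier (truncation A n)"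
    using bij_betwE[OF h] assms(2) by (auto intro: coset_in_truncation)
  ultimately show ?thesis
    unfolding tensors_def
    by (intro CollectI exI[where x = "card I"] exI[where x = "\<lambda>j. P n +> a (h j)"] exI[where x = "\<lambda>j. l (h j)"]) simp
qed

lemma T_cases:
  assumes "u \<in> T n"
  obtains N :: nat and a l where "\<And>i. a i \<in> carrier A" "u = (\<lambda>\<beta>. \<Sum>i<N. pt n (a i) (l i) \<beta>)"
proof -
  from assms obtain N :: nat and v l where u: "u = (\<lambda>\<beta>. \<Sum>i<N. pure_tensor sc (truncation A n) (v i) (l i) \<beta>)"
    "\<forall>i<N. v i \<in> carrier (truncation A n)" unfolding tensors_def by blast
  define a where "a i = (if i < N then SOME b. b \<in> carrier A \<and> v i = P n +> b else \<zero>)" for i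
  have a: "a i \<in> carrier A \<and> v i = P n +> a i" if "i < N" for i
  proof -
    have "\<exists>b. b \<in> carrier A \<and> v i = P n +> b" using u(2) that unfolding carrier_truncation by blast
    from someI_ex[OF this] show ?thesis using that by (simp add: a_def)
  qed
  show ?thesis
  proof
    show "a i \<in> carrier A" for i using a[of i] by (cases "i < N") (simp_all add: a_def)
    show "u = (\<lambda>\<beta>. \<Sum>i<N. pt n (a i) (l i) \<beta>)" unfolding u(1) pt_def using a by simp
  qed
qed

lemma T_add: "u \<in> T n \<Longrightarrow> w \<in> T n \<Longrightarrow> (\<lambda>\<beta>. u \<beta> + w \<beta>) \<in> T n"
proof -
  assume "u \<in> T n" "w \<in> T n"
  obtain N :: nat and a l where 1: "\<And>i. a i \<in> carrier A" "u = (\<lambda>\<beta>. \<Sum>i<N. pt n (a i) (l i) \<beta>)"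
    using \<open>u \<in> T n\<close> by (rule T_cases) (rule that; assumption)
  obtain M :: nat and b k where 2: "\<And>i. b i \<in> carrier A" "w = (\<lambda>\<beta>. \<Sum>i<M. pt n (b i) (k i) \<beta>)"
    using \<open>w \<in> T n\<close> by (rule T_cases) (rule that; assumption)
  have "(\<lambda>\<beta>. \<Sum>i\<in>{..<N} <+> {..<M}. pt n (case_sum a b i) (case_sum l k i) \<beta>) \<in> T n"
    by (rule sum_in_T) (use 1 2 in auto)
  then show ?thesis by (simp add: sum.Plus 1(2) 2(2))
qed

lemma T_pt: "a \<in> carrier A \<Longrightarrow> pt n a l \<in> T n"
  using sum_in_T[of "{()}" "\<lambda>_. a" n "\<lambda>_. l"] by simp

lemma T_zero: "(\<lambda>\<beta>. 0) \<in> T n"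
  using sum_in_T[of "{} :: unit set"] by simp

lemma T_induct [consumes 1, case_names zero add]:
  assumes "u \<in> T n" "Q (\<lambda>\<beta>. 0)"
    and "\<And>u a l. u \<in> T n \<Longrightarrow> Q u \<Longrightarrow> a \<in> carrier A \<Longrightarrow> Q (\<lambda>\<beta>. u \<beta> + pt n a l \<beta>)"
  shows "Q u"
proof -
  obtain N :: nat and a l where 1: "\<And>i. a i \<in> carrier A" "u = (\<lambda>\<beta>. \<Sum>i<N. pt n (a i) (l i) \<beta>)"
    using assms(1) by (rule T_cases) (rule that; assumption)
  have "Q (\<lambda>\<beta>. \<Sum>i<N. pt n (a i) (l i) \<beta>)"
  proof (induction N)
    case (Suc N)
    then show ?case using assms(3)[OF sum_in_T Suc 1(1)] 1(1) by simp
  qed (use assms(2) in simp)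
  then show ?thesis by (simp add: 1(2))
qed

text \<open>The product form sending the class of \<open>a\<close> and \<open>l\<close> to
  \<open>g a * h l\<close>; the chosen representative is immaterial once \<open>g\<close> vanishes
  on \<open>P n\<close>. Tensors are tested on these forms.\<close>

definition form :: "nat \<Rightarrow> ('a \<Rightarrow> 'k) \<Rightarrow> ('l \<Rightarrow> 'k) \<Rightarrow> 'a set \<Rightarrow> 'l \<Rightarrow> 'k" where
  "form n g h v l = (if v \<in> carrier (truncation A n)
     then g (SOME a. a \<in> carrier A \<and> v = P n +> a) * h l else 0)"

lemma form:
  assumes g: "g \<in> carrier (dual A)" "\<And>a. a \<in> P n \<Longrightarrow> g a = 0" and h: "Vector_Spaces.linear sc (*) h"
  shows "form n g h \<in> bil n" "a \<in> carrier A \<Longrightarrow> form n g h (P n +> a) l = g a * h l"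
proof -
  have val: "form n g h (P n +> a) l = g a * h l" if a: "a \<in> carrier A" for a l
  proof -
    define b where "b = (SOME b. b \<in> carrier A \<and> P n +> a = P n +> b)"
    have b: "b \<in> carrier A \<and> P n +> a = P n +> b" unfolding b_def by (rule someI[of _ a]) (simp add: a)
    then have ab: "a \<ominus> b \<in> P n" using coset_P_eq_iff[of a b n] a unfolding cg_def by blast
    have "a = (a \<ominus> b) \<oplus> b" using a b by (simp add: A.minus_eq A.a_assoc A.l_neg)
    then have "g a = g (a \<ominus> b) + g b" using g(1) a b unfolding dual_iff by (metis A.minus_closed)
    then have "g a = g b" using g(2)[OF ab] by simp
    then show ?thesis using a by (simp add: form_def coset_in_truncation b_def)
  qed
  then show "a \<in> carrier A \<Longrightarrow> form n g h (P n +> a) l = g a * h l" .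
  show "form n g h \<in> bil n"
    unfolding bilinear_forms_def
  proof (intro CollectI conjI ballI allI impI)
    fix v assume "v \<in> carrier (truncation A n)"
    then obtain a where a: "v = P n +> a" "a \<in> carrier A" unfolding carrier_truncation by blast
    interpret h: Vector_Spaces.linear sc "(*)" h by (rule h)
    have "form n g h v = (\<lambda>l. g a * h l)" by (rule ext) (simp add: a val)
    moreover have "Vector_Spaces.linear sc (*) (\<lambda>l. g a * h l)"
      using h unfolding Vector_Spaces.linear_def module_hom_def module_hom_axioms_def
      by (auto simp: distrib_left mult.left_commute)
    ultimately show "Vector_Spaces.linear sc (*) (form n g h v)" by (simp only:)
    show "form n g h (c \<odot>\<^bsub>truncation A n\<^esub> v) l = c * form n g h v l" for c l
      using g(1) a by (simp add: truncation_smult val dual_iff)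
    fix w l assume "w \<in> carrier (truncation A n)"
    then obtain b where b: "w = P n +> b" "b \<in> carrier A" unfolding carrier_truncation by blast
    show "form n g h (v \<oplus>\<^bsub>truncation A n\<^esub> w) l = form n g h v l + form n g h w l"
      using g(1) a b by (simp add: truncation_add val dual_iff algebra_simps)
  qed (simp add: form_def)
qed

section \<open>Coordinates of tensors with respect to a basis of \<open>L\<close>\<close>

definition Basis :: "'l set" where
  "Basis = (SOME B. L.independent B \<and> L.span B = UNIV)"

lemma Basis: "L.independent Basis" "L.span Basis = UNIV"
proof -
  obtain B where "B \<subseteq> UNIV" "L.independent B" "UNIV \<subseteq> L.span B"
    by (rule L.maximal_independent_subset)
  then have "L.independent B \<and> L.span B = UNIV" by blast
  then have "L.independent Basis \<and> L.span Basis = UNIV" unfolding Basis_def by (rule someI)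
  then show "L.independent Basis" "L.span Basis = UNIV" by auto
qed

abbreviation rep where "rep \<equiv> L.representation Basis"

lemma rep_linear: "Vector_Spaces.linear sc (*) (\<lambda>l. rep l b)"
proof -
  have "vector_space ((*) :: 'k \<Rightarrow> 'k \<Rightarrow> 'k)" by unfold_locales (auto simp: algebra_simps)
  then show ?thesis
    unfolding Vector_Spaces.linear_def module_hom_def module_hom_axioms_def module_iff_vector_space
    using L.vector_space_axioms Basis by (simp add: L.representation_add L.representation_scale)
qed

lemma rep_sum: "l = (\<Sum>b | rep l b \<noteq> 0. sc (rep l b) b)"
  using L.sum_nonzero_representation_eq[OF Basis(1), of l] Basis(2) by simp

lemma rep_finite: "finite {b. rep l b \<noteq> 0}" and rep_Basis: "rep l b \<noteq> 0 \<Longrightarrow> b \<in> Basis"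
  by (rule L.finite_representation) (rule L.representation_ne_zero)

text \<open>The family \<open>a\<close> encodes the convergent series \<open>\<Sum>\<^sub>b a b \<otimes> b\<close> over the elements \<open>b\<close> of a basis of \<open>L\<close>.\<close>

definition summable_family :: "('l \<Rightarrow> 'a) \<Rightarrow> bool" where
  "summable_family a \<longleftrightarrow> (\<forall>b. a b \<in> carrier A) \<and> (\<forall>n. finite {b\<in>Basis. a b \<notin> P n})"

definition ser :: "('l \<Rightarrow> 'a) \<Rightarrow> ('k, 'a, 'l) ctensor" where
  "ser a n = (\<lambda>\<beta>. \<Sum>b\<in>{b\<in>Basis. a b \<notin> P n}. pt n (a b) b \<beta>)"

lemma ser_eq:
  assumes "finite F" "\<And>b. b \<in> Basis \<Longrightarrow> a b \<notin> P n \<Longrightarrow> b \<in> F" "F \<subseteq> Basis"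
  shows "ser a n \<beta> = (\<Sum>b\<in>F. pt n (a b) b \<beta>)"
  unfolding ser_def by (rule sum.mono_neutral_left) (use assms pt_P in auto)

text \<open>Normal form of a tensor, found by expanding the right factors in the basis. The sum is
  given for every finite set containing the support, so that two families can be compared over a
  common index set.\<close>

lemma T_family:
  assumes "u \<in> T n"
  obtains a where "\<And>b. a b \<in> carrier A" "finite {b. a b \<noteq> \<zero>}" "{b. a b \<noteq> \<zero>} \<subseteq> Basis"
    "\<And>F \<beta>. finite F \<Longrightarrow> {b. a b \<noteq> \<zero>} \<subseteq> F \<Longrightarrow> u \<beta> = (\<Sum>b\<in>F. pt n (a b) b \<beta>)"
proof -
  have "\<exists>a. (\<forall>b. a b \<in> carrier A) \<and> finite {b. a b \<noteq> \<zero>} \<and> {b. a b \<noteq> \<zero>} \<subseteq> Basis \<and>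
    (\<forall>F \<beta>. finite F \<longrightarrow> {b. a b \<noteq> \<zero>} \<subseteq> F \<longrightarrow> u \<beta> = (\<Sum>b\<in>F. pt n (a b) b \<beta>))"
    using assms
  proof (induction rule: T_induct)
    case zero
    show ?case by (rule exI[where x = "\<lambda>b. \<zero>"]) auto
  next
    case (add u c l)
    then obtain a where a: "\<And>b. a b \<in> carrier A" "finite {b. a b \<noteq> \<zero>}" "{b. a b \<noteq> \<zero>} \<subseteq> Basis"
      "\<And>F \<beta>. finite F \<Longrightarrow> {b. a b \<noteq> \<zero>} \<subseteq> F \<Longrightarrow> u \<beta> = (\<Sum>b\<in>F. pt n (a b) b \<beta>)" by blast
    \<comment> \<open>The case distinction does not change the value, as \<open>a'_eq\<close> shows;
      it only makes the bound on the support immediate.\<close>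
    define a' where "a' b = (if a b = \<zero> \<and> rep l b = 0 then \<zero> else a b \<oplus> rep l b \<odot> c)" for b
    have a'_eq: "a' b = a b \<oplus> rep l b \<odot> c" for b using add.hyps by (simp add: a'_def)
    have sub: "{b. a' b \<noteq> \<zero>} \<subseteq> {b. a b \<noteq> \<zero>} \<union> {b. rep l b \<noteq> 0}" by (auto simp: a'_def)
    show ?case
    proof (intro exI[where x = a'] conjI allI impI)
      show "a' b \<in> carrier A" for b using a(1) add.hyps by (simp add: a'_eq)
      show "finite {b. a' b \<noteq> \<zero>}" using finite_subset[OF sub] a(2) rep_finite by simp
      show "{b. a' b \<noteq> \<zero>} \<subseteq> Basis" using sub a(3) rep_Basis by blast
      fix F \<beta> assume F: "finite F" "{b. a' b \<noteq> \<zero>} \<subseteq> F"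
      define G where "G = F \<union> ({b. a b \<noteq> \<zero>} \<union> {b. rep l b \<noteq> 0})"
      have aG: "{b. a b \<noteq> \<zero>} \<subseteq> G" unfolding G_def by (rule subset_trans[OF Un_upper1 Un_upper2])
      have G: "finite G" using F a(2) rep_finite by (simp add: G_def)
      have "pt n c l \<beta> = pt n c (\<Sum>b | rep l b \<noteq> 0. sc (rep l b) b) \<beta>" using rep_sum[of l] by simp
      also have "\<dots> = (\<Sum>b | rep l b \<noteq> 0. pt n c (sc (rep l b) b) \<beta>)"
        by (rule pt_sum_right[OF rep_finite add.hyps(2)])
      also have "\<dots> = (\<Sum>b\<in>G. pt n c (sc (rep l b) b) \<beta>)"
        by (rule sum.mono_neutral_left[OF G]) (use add.hyps in \<open>auto simp: G_def\<close>)
      finally have "u \<beta> + pt n c l \<beta> = (\<Sum>b\<in>G. pt n (a b) b \<beta> + pt n c (sc (rep l b) b) \<beta>)"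
        unfolding sum.distrib a(4)[OF G aG, of \<beta>] by (rule arg_cong)
      also have "\<dots> = (\<Sum>b\<in>G. pt n (a' b) b \<beta>)"
        using add.hyps a(1) by (simp add: a'_eq pt_add_left pt_smult)
      also have "\<dots> = (\<Sum>b\<in>F. pt n (a' b) b \<beta>)"
      proof (rule sum.mono_neutral_right[OF G])
        show "F \<subseteq> G" by (simp add: G_def)
        show "\<forall>b\<in>G - F. pt n (a' b) b \<beta> = 0"
        proof
          fix b assume "b \<in> G - F"
          then have "a' b = \<zero>" using F(2) by blast
          then show "pt n (a' b) b \<beta> = 0" by simp
        qed
      qed
      finally show "u \<beta> + pt n c l \<beta> = (\<Sum>b\<in>F. pt n (a' b) b \<beta>)" .
    qed
  qed
  then show ?thesis using that by blast
qed

text \<open>Basis elements of \<open>L\<close> are linearly independent over the truncation: a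
  functional separating \<open>a b\<close> from \<open>P n\<close>, multiplied with the coordinate
  at \<open>b\<close>, isolates a single coefficient.\<close>

lemma sum_pt_eq_0:
  assumes F: "finite F" "F \<subseteq> Basis" "\<And>b. b \<in> F \<Longrightarrow> a b \<in> carrier A"
    and zero: "\<And>\<beta>. (\<Sum>b\<in>F. pt n (a b) b \<beta>) = 0" and b: "b \<in> F"
  shows "a b \<in> P n"
proof (rule ccontr)
  assume "a b \<notin> P n"
  then obtain g where g: "g \<in> carrier (dual A)" "\<And>c. c \<in> P n \<Longrightarrow> g c = 0" "g (a b) = 1"
    using separating_functional[OF F(3)[OF b]] by blast
  note f = form[OF g(1,2) rep_linear[of b]]
  have "(\<Sum>c\<in>F. pt n (a c) c (form n g (\<lambda>l. rep l b))) = (\<Sum>c\<in>F. if c = b then 1 else 0)"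
    by (rule sum.cong)
       (use F g(3) in \<open>auto simp: pt_inside[OF f(1)] f(2) L.representation_basis[OF Basis(1)]\<close>)
  also have "\<dots> = 1" using F b by simp
  finally show False using zero by simp
qed

text \<open>A nonzero coordinate of \<open>l\<close> would put a nonzero multiple of
  \<open>a\<close>, and hence \<open>a\<close> itself, into \<open>P n\<close>. Uniqueness of the
  augmentation and of coordinates over the dual numbers rests on this.\<close>

lemma pt_eq_0:
  assumes a: "a \<in> carrier A" "a \<notin> P n" and zero: "\<And>\<beta>. pt n a l \<beta> = 0"
  shows "l = 0"
proof -
  have "(\<Sum>b\<in>{b. rep l b \<noteq> 0}. pt n (rep l b \<odot> a) b \<beta>) = pt n a l \<beta>" for \<beta>
    by (subst (3) rep_sum) (simp add: pt_sum_right rep_finite pt_smult a)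
  then have *: "rep l b \<odot> a \<in> P n" if "rep l b \<noteq> 0" for b
    using sum_pt_eq_0[of "{b. rep l b \<noteq> 0}" "\<lambda>b. rep l b \<odot> a" n b] rep_finite rep_Basis zero a that by auto
  have "rep l b = 0" for b
  proof (rule ccontr)
    assume "rep l b \<noteq> 0"
    moreover from *[OF this] have "inverse (rep l b) \<odot> (rep l b \<odot> a) \<in> P n" by (rule P_subspaceD(4))
    ultimately show False using a by (simp flip: smult_mult)
  qed
  then show ?thesis using rep_sum[of l] by simp
qed

lemma one_notin_P: "0 < n \<Longrightarrow> \<one> \<notin> P n"
  using augmentation_eq_0_iff[of \<one>] augmentation_one P_antimono[of 1 n] by auto

end

section \<open>The completed tensor product\<close>

locale two_bases = B: tensor_base B sc + tensor_base A sc
  for B :: "('k::field, 'b) module" and A :: "('k, 'a) module" (structure)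
    and sc :: "'k \<Rightarrow> 'l::ab_group_add \<Rightarrow> 'l"
begin

text \<open>What is needed to induce a map of truncations. The instances are the identity from level
  \<open>Suc n\<close> to level \<open>n\<close>, multiplication by an element, and homomorphisms of
  bases.\<close>

definition filtered_map :: "nat \<Rightarrow> nat \<Rightarrow> ('b \<Rightarrow> 'a) \<Rightarrow> bool" where
  "filtered_map n m f \<longleftrightarrow> (\<forall>x\<in>carrier B. f x \<in> carrier A) \<and>
     (\<forall>x\<in>carrier B. \<forall>y\<in>carrier B. f (x \<oplus>\<^bsub>B\<^esub> y) = f x \<oplus> f y) \<and>
     (\<forall>c. \<forall>x\<in>carrier B. f (c \<odot>\<^bsub>B\<^esub> x) = c \<odot> f x) \<and> (\<forall>x\<in>B.P n. f x \<in> P m)"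

abbreviation tmap :: "nat \<Rightarrow> nat \<Rightarrow> ('b \<Rightarrow> 'a) \<Rightarrow> ('k, 'b set, 'l) tensor \<Rightarrow> ('k, 'a set, 'l) tensor" where
  "tmap n m f \<equiv> tensor_map sc (truncation B n) (truncation A m) (coset_map A (P m) f)"

lemma coset_map_coset:
  assumes f: "filtered_map n m f" and b: "b \<in> carrier B"
  shows "coset_map A (P m) f (B.P n +>\<^bsub>B\<^esub> b) = P m +> f b"
proof (intro equalityI subsetI)
  have fD: "f x \<in> carrier A" "f (x \<oplus>\<^bsub>B\<^esub> y) = f x \<oplus> f y" "f (c \<odot>\<^bsub>B\<^esub> x) = c \<odot> f x"
    if "x \<in> carrier B" "y \<in> carrier B" for x y c
    using f that by (simp_all add: filtered_map_def)
  have fP: "f x \<in> P m" if "x \<in> B.P n" for x using f that by (simp add: filtered_map_def)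
  fix z
  {
    assume "z \<in> coset_map A (P m) f (B.P n +>\<^bsub>B\<^esub> b)"
    then obtain p x where px: "p \<in> P m" "x \<in> B.P n" "z = p \<oplus> f (x \<oplus>\<^bsub>B\<^esub> b)"
      unfolding coset_map_def set_add_def' a_r_coset_def' by blast
    then have "z = (p \<oplus> f x) \<oplus> f b"
      using fD b P_carrier B.P_carrier by (simp add: A.a_assoc)
    moreover have "p \<oplus> f x \<in> P m" using px fP P_subspaceD(3) by blast
    ultimately show "z \<in> P m +> f b" unfolding a_r_coset_def' by blast
  next
    assume "z \<in> P m +> f b"
    then obtain p where p: "p \<in> P m" "z = p \<oplus> f b" unfolding a_r_coset_def' by blast
    moreover have "b = \<zero>\<^bsub>B\<^esub> \<oplus>\<^bsub>B\<^esub> b" using b by simp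
    moreover have "\<zero>\<^bsub>B\<^esub> \<in> B.P n" by (rule B.P_subspaceD(2))
    ultimately show "z \<in> coset_map A (P m) f (B.P n +>\<^bsub>B\<^esub> b)"
      unfolding coset_map_def set_add_def' a_r_coset_def' by blast
  }
qed

text \<open>\<open>tensor_map\<close> evaluates a tensor at the pulled back form. Pure tensors have
  the default value \<open>0\<close> off the bilinear forms, so bilinearity of the pullback must be
  known before anything can be computed.\<close>

lemma bil_pullback:
  assumes f: "filtered_map n m f" and \<beta>: "\<beta> \<in> bil m"
  shows "(\<lambda>v l. if v \<in> carrier (truncation B n) then \<beta> (coset_map A (P m) f v) l else 0) \<in> B.bil n"
proof -
  define \<gamma> where "\<gamma> = (\<lambda>v l. if v \<in> carrier (truncation B n) then \<beta> (coset_map A (P m) f v) l else 0)"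
  have fD: "f x \<in> carrier A" "f (x \<oplus>\<^bsub>B\<^esub> y) = f x \<oplus> f y" "f (c \<odot>\<^bsub>B\<^esub> x) = c \<odot> f x"
    if "x \<in> carrier B" "y \<in> carrier B" for x y c
    using f that by (simp_all add: filtered_map_def)
  have val: "\<gamma> (B.P n +>\<^bsub>B\<^esub> b) = \<beta> (P m +> f b)" if "b \<in> carrier B" for b
    using that by (simp add: \<gamma>_def coset_map_coset[OF f] B.coset_in_truncation)
  have "\<gamma> \<in> B.bil n"
    unfolding bilinear_forms_def
  proof (intro CollectI conjI ballI allI impI)
    fix v assume "v \<in> carrier (truncation B n)"
    then obtain a where a: "v = B.P n +>\<^bsub>B\<^esub> a" "a \<in> carrier B" unfolding B.carrier_truncation by blast
    show "Vector_Spaces.linear sc (*) (\<gamma> v)"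
      unfolding a(1) val[OF a(2)] using bil_linear[OF \<beta>] fD a by blast
    show "\<gamma> (c \<odot>\<^bsub>truncation B n\<^esub> v) l = c * \<gamma> v l" for c l
      unfolding a(1) B.truncation_smult[OF a(2)] val[OF a(2)] val[OF B.smult_in[OF a(2)]]
      using fD a bil_smult[OF \<beta>] by simp
    fix w l assume "w \<in> carrier (truncation B n)"
    then obtain b where b: "w = B.P n +>\<^bsub>B\<^esub> b" "b \<in> carrier B" unfolding B.carrier_truncation by blast
    show "\<gamma> (v \<oplus>\<^bsub>truncation B n\<^esub> w) l = \<gamma> v l + \<gamma> w l"
      unfolding a(1) b(1) B.truncation_add[OF a(2) b(2)] val[OF a(2)] val[OF b(2)] val[OF B.A.a_closed[OF a(2) b(2)]]
      using fD a b bil_add[OF \<beta>] by simp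
  qed (simp add: \<gamma>_def)
  then show ?thesis unfolding \<gamma>_def .
qed

lemma tmap_pt:
  assumes f: "filtered_map n m f" and b: "b \<in> carrier B"
  shows "tmap n m f (B.pt n b l) = pt m (f b) l"
proof
  fix \<beta>
  show "tmap n m f (B.pt n b l) \<beta> = pt m (f b) l \<beta>"
  proof (cases "\<beta> \<in> bil m")
    case True
    then show ?thesis
      using coset_map_coset[OF f b] B.coset_in_truncation[OF b]
      by (simp add: tensor_map_def B.pt_inside[OF bil_pullback[OF f True]] pt_inside)
  qed (simp add: tensor_map_def pt_outside)
qed

lemma tmap_add: "tmap n m f (\<lambda>\<beta>. u \<beta> + w \<beta>) = (\<lambda>\<beta>. tmap n m f u \<beta> + tmap n m f w \<beta>)"
  by (rule ext) (simp add: tensor_map_def)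

lemma tmap_zero: "tmap n m f (\<lambda>\<beta>. 0) = (\<lambda>\<beta>. 0)"
  by (rule ext) (simp add: tensor_map_def)

lemma tmap_sum:
  assumes f: "filtered_map n m f" and I: "finite I" "\<And>i. i \<in> I \<Longrightarrow> b i \<in> carrier B"
  shows "tmap n m f (\<lambda>\<beta>. \<Sum>i\<in>I. B.pt n (b i) (l i) \<beta>) = (\<lambda>\<beta>. \<Sum>i\<in>I. pt m (f (b i)) (l i) \<beta>)"
  using I
proof (induction I rule: finite_induct)
  case (insert i I)
  then show ?case by (simp add: tmap_add tmap_pt[OF f])
qed (simp add: tmap_zero)

lemma tmap_T:
  assumes f: "filtered_map n m f" and u: "u \<in> B.T n"
  shows "tmap n m f u \<in> T m"
  using u
proof (induction rule: B.T_induct)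
  case (add u a l)
  then show ?case
    using f T_add[OF add.IH T_pt[of "f a" m l]] by (simp add: tmap_add tmap_pt filtered_map_def)
qed (simp add: tmap_zero T_zero)

end

context tensor_base
begin

lemma T_ext:
  assumes u: "u \<in> T n" and 0: "\<phi> (\<lambda>\<beta>. 0) = \<psi> (\<lambda>\<beta>. 0)"
    and pt: "\<And>a l. a \<in> carrier A \<Longrightarrow> \<phi> (pt n a l) = \<psi> (pt n a l)"
    and \<phi>: "\<And>u w. \<phi> (\<lambda>\<beta>. u \<beta> + w \<beta>) = (\<lambda>\<beta>. \<phi> u \<beta> + \<phi> w \<beta>)"
    and \<psi>: "\<And>u w. \<psi> (\<lambda>\<beta>. u \<beta> + w \<beta>) = (\<lambda>\<beta>. \<psi> u \<beta> + \<psi> w \<beta> :: 'c::plus)"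
  shows "\<phi> u = \<psi> u"
  using u
proof (induction rule: T_induct)
  case (add u a l)
  then show ?case unfolding \<phi> \<psi> using pt by simp
qed (rule 0)

text \<open>With both bases equal, the results on induced maps specialise to the transition maps
  \<open>trunc\<close> and to the multiplications \<open>mulm\<close>.\<close>

interpretation self: two_bases A A sc
  by unfold_locales

abbreviation M where "M \<equiv> completed_tensor sc A"

definition trunc where "trunc n = tensor_map sc (truncation A (Suc n)) (truncation A n) (coset_map A (P n) (\<lambda>a. a))"

definition mulm where "mulm n a = tensor_map sc (truncation A n) (truncation A n) (coset_map A (P n) (\<lambda>x. a \<otimes> x))"

lemma filtered_id: "self.filtered_map (Suc n) n (\<lambda>a. a)"
  using P_Suc_subset by (auto simp: self.filtered_map_def)

lemma filtered_mult: "a \<in> carrier A \<Longrightarrow> self.filtered_map n n (\<lambda>x. a \<otimes> x)"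
  using P_mult_left by (simp add: self.filtered_map_def A.r_distr smult_mult_right)

lemmas trunc_pt = self.tmap_pt[OF filtered_id, folded trunc_def]
  and trunc_add = self.tmap_add[of "Suc n" n "\<lambda>a. a" for n, folded trunc_def]
  and trunc_zero = self.tmap_zero[of "Suc n" n "\<lambda>a. a" for n, folded trunc_def]
  and trunc_sum = self.tmap_sum[OF filtered_id, folded trunc_def]
  and mulm_pt = self.tmap_pt[OF filtered_mult, folded mulm_def]
  and mulm_add = self.tmap_add[of n n "\<lambda>x. a \<otimes> x" for n a, folded mulm_def]
  and mulm_zero = self.tmap_zero[of n n "\<lambda>x. a \<otimes> x" for n a, folded mulm_def]
  and mulm_sum = self.tmap_sum[OF filtered_mult, folded mulm_def]
  and mulm_T = self.tmap_T[OF filtered_mult, folded mulm_def]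

lemma M_simps:
  "carrier M = {u. (\<forall>n. u n \<in> T n) \<and> (\<forall>n. trunc n (u (Suc n)) = u n)}"
  "\<zero>\<^bsub>M\<^esub> = (\<lambda>n \<beta>. 0)" "u \<oplus>\<^bsub>M\<^esub> v = (\<lambda>n \<beta>. u n \<beta> + v n \<beta>)"
  "a \<odot>\<^bsub>M\<^esub> u = (\<lambda>n. mulm n a (u n))"
  by (simp_all add: completed_tensor_def trunc_def mulm_def)

lemma M_T: "u \<in> carrier M \<Longrightarrow> u n \<in> T n"
  by (simp add: M_simps)

text \<open>Laws involving several scalars are checked level by level on pure tensors, where they
  reduce to laws of the base, and extend by additivity through \<open>T_ext\<close>.\<close>

lemma module_M: "module A M"
proof (rule moduleI)
  show "cring A" by (rule A.is_cring)
  have smult_closed: "a \<odot>\<^bsub>M\<^esub> u \<in> carrier M" if a: "a \<in> carrier A" and u: "u \<in> carrier M" for a u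
  proof -
    have "trunc n (mulm (Suc n) a (u (Suc n))) = mulm n a (u n)" for n
    proof -
      have "trunc n (mulm (Suc n) a (u (Suc n))) = mulm n a (trunc n (u (Suc n)))"
        by (rule T_ext[OF M_T[OF u, of "Suc n"]])
           (use a in \<open>simp_all add: mulm_zero trunc_zero mulm_pt trunc_pt mulm_add trunc_add\<close>)
      then show ?thesis using u by (simp add: M_simps)
    qed
    then show ?thesis using a u by (simp add: M_simps mulm_T)
  qed
  show "a \<odot>\<^bsub>M\<^esub> u \<in> carrier M" if "a \<in> carrier A" "u \<in> carrier M" for a u
    using smult_closed[OF that] .
  have smult_l: "(a \<oplus> b) \<odot>\<^bsub>M\<^esub> u = a \<odot>\<^bsub>M\<^esub> u \<oplus>\<^bsub>M\<^esub> b \<odot>\<^bsub>M\<^esub> u"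
    if "a \<in> carrier A" "b \<in> carrier A" "u \<in> carrier M" for a b u
    unfolding M_simps
  proof
    fix n
    show "mulm n (a \<oplus> b) (u n) = (\<lambda>\<beta>. mulm n a (u n) \<beta> + mulm n b (u n) \<beta>)"
      by (rule T_ext[OF M_T[OF that(3)], where \<phi> = "mulm n (a \<oplus> b)" and \<psi> = "\<lambda>w \<beta>. mulm n a w \<beta> + mulm n b w \<beta>"])
         (use that in \<open>simp_all add: mulm_zero mulm_pt mulm_add A.l_distr pt_add_left fun_eq_iff algebra_simps\<close>)
  qed
  then show "(a \<oplus> b) \<odot>\<^bsub>M\<^esub> u = a \<odot>\<^bsub>M\<^esub> u \<oplus>\<^bsub>M\<^esub> b \<odot>\<^bsub>M\<^esub> u"
    if "a \<in> carrier A" "b \<in> carrier A" "u \<in> carrier M" for a b u using that .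
  show "a \<odot>\<^bsub>M\<^esub> (u \<oplus>\<^bsub>M\<^esub> v) = a \<odot>\<^bsub>M\<^esub> u \<oplus>\<^bsub>M\<^esub> a \<odot>\<^bsub>M\<^esub> v" for a u v
    by (simp add: M_simps mulm_add)
  show "(a \<otimes> b) \<odot>\<^bsub>M\<^esub> u = a \<odot>\<^bsub>M\<^esub> (b \<odot>\<^bsub>M\<^esub> u)"
    if "a \<in> carrier A" "b \<in> carrier A" "u \<in> carrier M" for a b u
    unfolding M_simps
  proof
    fix n
    show "mulm n (a \<otimes> b) (u n) = mulm n a (mulm n b (u n))"
      by (rule T_ext[OF M_T[OF that(3)]])
         (use that in \<open>simp_all add: mulm_zero mulm_pt mulm_add A.m_assoc\<close>)
  qed
  have one: "\<one> \<odot>\<^bsub>M\<^esub> u = u" if "u \<in> carrier M" for u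
    unfolding M_simps
  proof
    fix n
    show "mulm n \<one> (u n) = u n"
      by (rule T_ext[OF M_T[OF that], where \<psi> = "\<lambda>w. w"]) (simp_all add: mulm_zero mulm_pt mulm_add)
  qed
  then show "\<one> \<odot>\<^bsub>M\<^esub> u = u" if "u \<in> carrier M" for u using that .
  show "abelian_group M"
  proof (rule abelian_groupI)
    show "u \<oplus>\<^bsub>M\<^esub> v \<in> carrier M" if "u \<in> carrier M" "v \<in> carrier M" for u v
      using that by (simp add: M_simps T_add trunc_add)
    show "\<zero>\<^bsub>M\<^esub> \<in> carrier M" by (simp add: M_simps T_zero trunc_zero)
    fix u assume u: "u \<in> carrier M"
    have zero: "\<zero> \<odot>\<^bsub>M\<^esub> u = \<zero>\<^bsub>M\<^esub>"
      unfolding M_simps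
    proof
      fix n
      show "mulm n \<zero> (u n) = (\<lambda>\<beta>. 0)"
        by (rule T_ext[OF M_T[OF u], where \<psi> = "\<lambda>w \<beta>. 0"]) (simp_all add: mulm_zero mulm_pt mulm_add fun_eq_iff)
    qed
    \<comment> \<open>Additive inverses are multiples by \<open>\<ominus> \<one>\<close>, so closure
      under scalars already provides them.\<close>
    have "(\<ominus> \<one>) \<odot>\<^bsub>M\<^esub> u \<oplus>\<^bsub>M\<^esub> u = (\<ominus> \<one>) \<odot>\<^bsub>M\<^esub> u \<oplus>\<^bsub>M\<^esub> \<one> \<odot>\<^bsub>M\<^esub> u" by (simp add: one u)
    also have "\<dots> = (\<ominus> \<one> \<oplus> \<one>) \<odot>\<^bsub>M\<^esub> u" by (subst smult_l) (simp_all add: u)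
    also have "\<dots> = \<zero>\<^bsub>M\<^esub>" by (simp add: A.l_neg zero)
    finally show "\<exists>y\<in>carrier M. y \<oplus>\<^bsub>M\<^esub> u = \<zero>\<^bsub>M\<^esub>"
      using smult_closed[OF _ u, of "\<ominus> \<one>"] by auto
  qed (simp_all add: M_simps add.assoc add.commute add.left_commute)
qed

sublocale Mod: module A M
  by (rule module_M)

lemma finsum_M:
  assumes "finite I" "\<And>i. i \<in> I \<Longrightarrow> u i \<in> carrier M"
  shows "finsum M u I = (\<lambda>n \<beta>. \<Sum>i\<in>I. u i n \<beta>)"
  using assms
proof (induction I rule: finite_induct)
  case (insert i I)
  then show ?case by (subst Mod.M.finsum_insert) (auto simp: M_simps(3))
qed (simp add: M_simps)

lemma ser_M:
  assumes a: "summable_family a"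
  shows "ser a \<in> carrier M"
proof -
  have aD: "a b \<in> carrier A" "finite {b\<in>Basis. a b \<notin> P n}" for b n
    using a by (auto simp: summable_family_def)
  have "trunc n (ser a (Suc n)) = ser a n" for n
  proof
    fix \<beta>
    have "trunc n (ser a (Suc n)) \<beta> = (\<Sum>b\<in>{b\<in>Basis. a b \<notin> P (Suc n)}. pt n (a b) b \<beta>)"
      unfolding ser_def using aD by (subst trunc_sum) auto
    also have "\<dots> = ser a n \<beta>"
      by (rule ser_eq[symmetric]) (use aD P_Suc_subset in auto)
    finally show "trunc n (ser a (Suc n)) \<beta> = ser a n \<beta>" .
  qed
  moreover have "ser a n \<in> T n" for n unfolding ser_def by (rule sum_in_T) (use aD in auto)
  ultimately show ?thesis by (simp add: M_simps)
qed

text \<open>The coordinates of the levels of \<open>u\<close> form, for each basis element, a Cauchy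
  sequence in the base; the limits are the coordinates of \<open>u\<close>.\<close>

lemma M_ser:
  assumes u: "u \<in> carrier M"
  obtains a where "summable_family a" "u = ser a"
proof -
  have "\<forall>n. \<exists>a. (\<forall>b. a b \<in> carrier A) \<and> finite {b. a b \<noteq> \<zero>} \<and> {b. a b \<noteq> \<zero>} \<subseteq> Basis \<and>
    (\<forall>F \<beta>. finite F \<longrightarrow> {b. a b \<noteq> \<zero>} \<subseteq> F \<longrightarrow> u n \<beta> = (\<Sum>b\<in>F. pt n (a b) b \<beta>))"
  proof
    fix n
    obtain a where "\<And>b. a b \<in> carrier A" "finite {b. a b \<noteq> \<zero>}" "{b. a b \<noteq> \<zero>} \<subseteq> Basis"
      "\<And>F \<beta>. finite F \<Longrightarrow> {b. a b \<noteq> \<zero>} \<subseteq> F \<Longrightarrow> u n \<beta> = (\<Sum>b\<in>F. pt n (a b) b \<beta>)"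
      using M_T[OF u, of n] by (rule T_family) (rule that; assumption)
    then show "\<exists>a. (\<forall>b. a b \<in> carrier A) \<and> finite {b. a b \<noteq> \<zero>} \<and> {b. a b \<noteq> \<zero>} \<subseteq> Basis \<and>
      (\<forall>F \<beta>. finite F \<longrightarrow> {b. a b \<noteq> \<zero>} \<subseteq> F \<longrightarrow> u n \<beta> = (\<Sum>b\<in>F. pt n (a b) b \<beta>))" by blast
  qed
  from choice[OF this] obtain c where c: "\<forall>n. (\<forall>b. c n b \<in> carrier A) \<and> finite {b. c n b \<noteq> \<zero>} \<and> {b. c n b \<noteq> \<zero>} \<subseteq> Basis \<and>
    (\<forall>F \<beta>. finite F \<longrightarrow> {b. c n b \<noteq> \<zero>} \<subseteq> F \<longrightarrow> u n \<beta> = (\<Sum>b\<in>F. pt n (c n b) b \<beta>))" by (elim exE)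
  have cA: "c n b \<in> carrier A" and cfin: "finite {b. c n b \<noteq> \<zero>}" and cB: "{b. c n b \<noteq> \<zero>} \<subseteq> Basis"
    and cu: "\<And>F \<beta>. finite F \<Longrightarrow> {b. c n b \<noteq> \<zero>} \<subseteq> F \<Longrightarrow> u n \<beta> = (\<Sum>b\<in>F. pt n (c n b) b \<beta>)" for n b
    using c by auto
  \<comment> \<open>Truncating the expansion at level \<open>Suc n\<close> gives the one at level
    \<open>n\<close>; independence of the basis then makes the coefficients congruent modulo
    \<open>P n\<close>.\<close>
  have "cg n (c (Suc n) b) (c n b)" for n b
  proof (cases "b \<in> {b. c (Suc n) b \<noteq> \<zero>} \<union> {b. c n b \<noteq> \<zero>}")
    case b: True
    define F where "F = {b. c (Suc n) b \<noteq> \<zero>} \<union> {b. c n b \<noteq> \<zero>}"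
    have F: "finite F" "F \<subseteq> Basis" "{b. c (Suc n) b \<noteq> \<zero>} \<subseteq> F" "{b. c n b \<noteq> \<zero>} \<subseteq> F"
      using cfin cB by (auto simp: F_def)
    have "c (Suc n) b \<ominus> c n b \<in> P n"
    proof (rule sum_pt_eq_0[OF F(1,2)])
      fix \<beta>
      have "u (Suc n) = (\<lambda>\<beta>. \<Sum>b\<in>F. pt (Suc n) (c (Suc n) b) b \<beta>)" using cu[OF F(1,3)] by blast
      moreover have "trunc n (u (Suc n)) = u n" using u by (simp add: M_simps)
      ultimately have "u n \<beta> = trunc n (\<lambda>\<beta>. \<Sum>b\<in>F. pt (Suc n) (c (Suc n) b) b \<beta>) \<beta>"
        by simp
      also have "\<dots> = (\<Sum>b\<in>F. pt n (c (Suc n) b) b \<beta>)" using trunc_sum[OF F(1)] cA by simp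
      finally show "(\<Sum>b\<in>F. pt n (c (Suc n) b \<ominus> c n b) b \<beta>) = 0"
        using cu[OF F(1,4)] cA by (simp add: A.minus_eq pt_add_left pt_minus sum_subtractf)
    qed (use cA b in \<open>auto simp: F_def\<close>)
    then show ?thesis using cA by (simp add: cg_def)
  qed simp
  then have "\<forall>b. \<exists>a. a \<in> carrier A \<and> (\<forall>n. cg n a (c n b))"
    using complete_ex1[of "\<lambda>n. c n b" for b] cA by blast
  from choice[OF this] obtain a where a: "\<And>b. a b \<in> carrier A" "\<And>n b. cg n (a b) (c n b)" by blast
  have sub: "{b\<in>Basis. a b \<notin> P n} \<subseteq> {b. c n b \<noteq> \<zero>}" for n
  proof
    fix b assume "b \<in> {b\<in>Basis. a b \<notin> P n}"
    then show "b \<in> {b. c n b \<noteq> \<zero>}" using a(2)[of n b] cg_zero_iff by auto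
  qed
  show ?thesis
  proof
    show "summable_family a" unfolding summable_family_def using a(1) finite_subset[OF sub cfin] by blast
    show "u = ser a"
    proof (intro ext)
      fix n \<beta>
      have "u n \<beta> = (\<Sum>b\<in>{b. c n b \<noteq> \<zero>}. pt n (c n b) b \<beta>)" by (rule cu[OF cfin order_refl])
      also have "\<dots> = (\<Sum>b\<in>{b. c n b \<noteq> \<zero>}. pt n (a b) b \<beta>)"
        by (rule sum.cong[OF refl]) (simp add: pt_cong[OF a(2)])
      also have "\<dots> = ser a n \<beta>"
        by (rule ser_eq[symmetric]) (use sub cfin cB in auto)
      finally show "u n \<beta> = ser a n \<beta>" .
    qed
  qed
qed

section \<open>Constant tensors and the augmentation\<close>

definition const :: "'l \<Rightarrow> ('k, 'a, 'l) ctensor" where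
  "const x = (\<lambda>n. pt n \<one> x)"

lemma const_M [simp]: "const x \<in> carrier M"
  by (simp add: M_simps const_def T_pt trunc_pt)

lemma const_add: "const (x + y) = const x \<oplus>\<^bsub>M\<^esub> const y"
  by (simp add: M_simps const_def pt_add_right fun_eq_iff)

lemma const_scale: "const (sc c x) = (c \<odot> \<one>) \<odot>\<^bsub>M\<^esub> const x"
  by (simp add: M_simps const_def mulm_pt pt_smult)

text \<open>At level \<open>1\<close> each coefficient may be replaced by its augmentation, a
  scalar, which then moves to the right factor.\<close>

lemma augmentation_exists:
  assumes "u \<in> carrier M"
  shows "\<exists>x. u 1 = pt 1 \<one> x"
proof -
  obtain a where a: "summable_family a" "u = ser a" by (rule M_ser[OF assms])
  let ?F = "{b\<in>Basis. a b \<notin> P 1}"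
  have aA: "a b \<in> carrier A" and F: "finite ?F" for b using a(1) by (auto simp: summable_family_def)
  have "u 1 \<beta> = pt 1 \<one> (\<Sum>b\<in>?F. sc (augmentation A (a b)) b) \<beta>" for \<beta>
  proof -
    have "u 1 \<beta> = (\<Sum>b\<in>?F. pt 1 (a b) b \<beta>)" by (simp add: a(2) ser_def)
    also have "\<dots> = (\<Sum>b\<in>?F. pt 1 \<one> (sc (augmentation A (a b)) b) \<beta>)"
      by (simp add: pt_cong[OF cg_augmentation[OF aA]] pt_smult del: One_nat_def)
    finally show ?thesis by (simp only: pt_sum_right[OF F A.one_closed])
  qed
  then show ?thesis by blast
qed

abbreviation taug where "taug \<equiv> tensor_augmentation sc A"

lemma taug_unique:
  assumes "u 1 = pt 1 \<one> x"
  shows "taug u = x"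
  unfolding tensor_augmentation_def truncation_one pt_def[symmetric]
proof (rule the_equality)
  fix y assume "u 1 = pt 1 \<one> y"
  then have "pt 1 \<one> (y - x) \<beta> = 0" for \<beta>
    using assms pt_add_right[of \<one> 1 "y - x" x \<beta>] by simp
  from pt_eq_0[OF A.one_closed one_notin_P this] have "y - x = 0" by simp
  then show "y = x" by simp
qed (rule assms)

lemma taug:
  assumes "u \<in> carrier M"
  shows "u 1 = pt 1 \<one> (taug u)"
proof -
  obtain x where x: "u 1 = pt 1 \<one> x" using augmentation_exists[OF assms] by (elim exE)
  show ?thesis unfolding taug_unique[of u x, OF x] by (rule x)
qed

lemma taug_const [simp]: "taug (const x) = x"
  by (rule taug_unique) (simp add: const_def)

lemma taug_add: "u \<in> carrier M \<Longrightarrow> v \<in> carrier M \<Longrightarrow> taug (u \<oplus>\<^bsub>M\<^esub> v) = taug u + taug v"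
  by (rule taug_unique) (simp add: M_simps(3) taug pt_add_right fun_eq_iff del: One_nat_def)

lemma taug_smult:
  assumes a: "a \<in> carrier A" and u: "u \<in> carrier M"
  shows "taug (a \<odot>\<^bsub>M\<^esub> u) = sc (augmentation A a) (taug u)"
proof (rule taug_unique)
  have "(a \<odot>\<^bsub>M\<^esub> u) 1 = pt 1 (a \<otimes> \<one>) (taug u)"
    unfolding M_simps(4) taug[OF u] by (rule mulm_pt[OF a A.one_closed])
  also have "\<dots> = pt 1 (augmentation A a \<odot> \<one>) (taug u)"
    unfolding A.r_one[OF a] by (rule pt_cong[OF cg_augmentation[OF a]])
  finally show "(a \<odot>\<^bsub>M\<^esub> u) 1 = pt 1 \<one> (sc (augmentation A a) (taug u))"
    unfolding pt_smult[OF A.one_closed] .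
qed

end

locale generated_tensor_base = generated_base A S t + tensor_base A sc
  for A :: "('k::field, 'a) module" (structure) and S :: "'x set" and t
    and sc :: "'k \<Rightarrow> 'l::ab_group_add \<Rightarrow> 'l"
begin

text \<open>Since the sum is finite, bilinear brackets on the completed tensor product are continuous.\<close>

lemma decompose_M:
  assumes u: "u \<in> carrier M"
  obtains w where "\<And>s. s \<in> S \<Longrightarrow> w s \<in> carrier M" "u = const (taug u) \<oplus>\<^bsub>M\<^esub> finsum M (\<lambda>s. t s \<odot>\<^bsub>M\<^esub> w s) S"
proof -
  obtain a where a: "summable_family a" "u = ser a" by (rule M_ser[OF u])
  have aA: "a b \<in> carrier A" and afin: "finite {b\<in>Basis. a b \<notin> P n}" for b n
    using a(1) by (auto simp: summable_family_def)
  have "\<forall>b. \<exists>d. (\<forall>s\<in>S. d s \<in> carrier A) \<and> a b = augmentation A (a b) \<odot> \<one> \<oplus> (\<Oplus>s\<in>S. t s \<otimes> d s) \<and>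
    (\<forall>n. a b \<in> P (Suc n) \<longrightarrow> (\<forall>s\<in>S. d s \<in> P n))"
    using decompose[OF aA] by blast
  from choice[OF this] obtain d where d: "\<forall>b. (\<forall>s\<in>S. d b s \<in> carrier A) \<and>
    a b = augmentation A (a b) \<odot> \<one> \<oplus> (\<Oplus>s\<in>S. t s \<otimes> d b s) \<and>
    (\<forall>n. a b \<in> P (Suc n) \<longrightarrow> (\<forall>s\<in>S. d b s \<in> P n))" by (elim exE)
  have dA: "d b s \<in> carrier A" if "s \<in> S" for b s using d that by blast
  have eq: "a b = augmentation A (a b) \<odot> \<one> \<oplus> (\<Oplus>s\<in>S. t s \<otimes> d b s)" for b using d by blast
  have dP: "d b s \<in> P n" if "s \<in> S" "a b \<in> P (Suc n)" for b s n using d that by blast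
  define w where "w s = ser (\<lambda>b. d b s)" for s
  \<comment> \<open>The filtration clause of \<open>decompose\<close> enters here: a quotient
    \<open>d b s\<close> outside \<open>P n\<close> forces \<open>a b\<close> outside
    \<open>P (Suc n)\<close>, which happens for finitely many \<open>b\<close>.\<close>
  have sf: "summable_family (\<lambda>b. d b s)" if "s \<in> S" for s
    unfolding summable_family_def
  proof (intro conjI allI)
    show "finite {b \<in> Basis. d b s \<notin> P n}" for n
      by (rule finite_subset[OF _ afin[of "Suc n"]]) (use dP[OF that] in auto)
  qed (rule dA[OF that])
  have wM: "w s \<in> carrier M" if "s \<in> S" for s unfolding w_def by (rule ser_M[OF sf[OF that]])
  have twM: "t s \<odot>\<^bsub>M\<^esub> w s \<in> carrier M" if "s \<in> S" for s
    by (rule Mod.smult_closed[OF t_carrier[OF that] wM[OF that]])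
  have fin: "finsum M (\<lambda>s. t s \<odot>\<^bsub>M\<^esub> w s) S = (\<lambda>n \<beta>. \<Sum>s\<in>S. (t s \<odot>\<^bsub>M\<^esub> w s) n \<beta>)"
    by (rule finsum_M[OF finite_S twM])
  define x where "x = (\<Sum>b\<in>{b\<in>Basis. a b \<notin> P 1}. sc (augmentation A (a b)) b)"
  have main: "u = const x \<oplus>\<^bsub>M\<^esub> finsum M (\<lambda>s. t s \<odot>\<^bsub>M\<^esub> w s) S"
  proof (intro ext)
    fix n \<beta>
    \<comment> \<open>Contains every index that matters at level \<open>n\<close>; the shift to
      \<open>Suc n\<close> accounts for the filtration step lost by the quotients
      \<open>d b s\<close>.\<close>
    define F where "F = {b\<in>Basis. a b \<notin> P (Suc n)} \<union> {b\<in>Basis. a b \<notin> P 1}"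
    have F: "finite F" "F \<subseteq> Basis" using afin by (auto simp: F_def)
    have "u n \<beta> = (\<Sum>b\<in>F. pt n (a b) b \<beta>)"
      unfolding a(2) by (rule ser_eq) (use F P_Suc_subset[of n] in \<open>auto simp: F_def\<close>)
    also have "\<dots> = (\<Sum>b\<in>F. pt n \<one> (sc (augmentation A (a b)) b) \<beta> + (\<Sum>s\<in>S. pt n (t s \<otimes> d b s) b \<beta>))"
    proof (rule sum.cong[OF refl])
      fix b
      have "pt n (a b) b \<beta> = pt n (augmentation A (a b) \<odot> \<one> \<oplus> (\<Oplus>s\<in>S. t s \<otimes> d b s)) b \<beta>" using eq by simp
      also have "\<dots> = pt n (augmentation A (a b) \<odot> \<one>) b \<beta> + pt n (\<Oplus>s\<in>S. t s \<otimes> d b s) b \<beta>"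
        using dA t_carrier by (intro pt_add_left A.finsum_closed) auto
      also have "pt n (\<Oplus>s\<in>S. t s \<otimes> d b s) b \<beta> = (\<Sum>s\<in>S. pt n (t s \<otimes> d b s) b \<beta>)"
        using dA t_carrier by (intro pt_finsum_left finite_S) auto
      finally show "pt n (a b) b \<beta> = pt n \<one> (sc (augmentation A (a b)) b) \<beta> + (\<Sum>s\<in>S. pt n (t s \<otimes> d b s) b \<beta>)"
        by (simp add: pt_smult)
    qed
    also have "\<dots> = (\<Sum>b\<in>F. pt n \<one> (sc (augmentation A (a b)) b) \<beta>) + (\<Sum>s\<in>S. \<Sum>b\<in>F. pt n (t s \<otimes> d b s) b \<beta>)"
      by (simp add: sum.distrib sum.swap[of _ F S])
    also have "(\<Sum>b\<in>F. pt n \<one> (sc (augmentation A (a b)) b) \<beta>) = const x n \<beta>"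
    proof -
      have "(\<Sum>b\<in>F. pt n \<one> (sc (augmentation A (a b)) b) \<beta>) =
        (\<Sum>b\<in>{b\<in>Basis. a b \<notin> P 1}. pt n \<one> (sc (augmentation A (a b)) b) \<beta>)"
        by (rule sum.mono_neutral_right[OF F(1)])
           (use aA in \<open>auto simp: F_def augmentation_eq_0_iff[symmetric] simp del: One_nat_def\<close>)
      then show ?thesis by (simp add: const_def x_def pt_sum_right[OF afin] del: One_nat_def)
    qed
    also have "(\<Sum>s\<in>S. \<Sum>b\<in>F. pt n (t s \<otimes> d b s) b \<beta>) = finsum M (\<lambda>s. t s \<odot>\<^bsub>M\<^esub> w s) S n \<beta>"
      unfolding fin
    proof (rule sum.cong[OF refl])
      fix s assume s: "s \<in> S"
      have "w s n = (\<lambda>\<beta>. \<Sum>b\<in>F. pt n (d b s) b \<beta>)"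
        unfolding w_def by (rule ext, rule ser_eq) (use F dP[OF s] in \<open>auto simp: F_def\<close>)
      then show "(\<Sum>b\<in>F. pt n (t s \<otimes> d b s) b \<beta>) = (t s \<odot>\<^bsub>M\<^esub> w s) n \<beta>"
        using mulm_sum[OF t_carrier[OF s] F(1)] dA[OF s] by (simp add: M_simps(4))
    qed
    finally show "u n \<beta> = (const x \<oplus>\<^bsub>M\<^esub> finsum M (\<lambda>s. t s \<odot>\<^bsub>M\<^esub> w s) S) n \<beta>" by (simp add: M_simps(3))
  qed
  have "taug u = x"
  proof (rule taug_unique)
    \<comment> \<open>Multiples by elements of the maximal ideal vanish at level \<open>1\<close>,
      so only \<open>const x\<close> contributes to the augmentation of \<open>u\<close>.\<close>
    have "(\<Sum>s\<in>S. (t s \<odot>\<^bsub>M\<^esub> w s) 1 \<beta>) = 0" for \<beta>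
    proof (rule sum.neutral, rule ballI)
      fix s assume s: "s \<in> S"
      have "(t s \<odot>\<^bsub>M\<^esub> w s) 1 = pt 1 (t s) (taug (w s))"
        using taug[OF wM[OF s]] t_carrier[OF s] by (simp add: M_simps(4) mulm_pt del: One_nat_def)
      then show "(t s \<odot>\<^bsub>M\<^esub> w s) 1 \<beta> = 0" using pt_P[OF t_P[OF s]] by simp
    qed
    then show "u 1 = pt 1 \<one> x"
      by (subst main) (simp add: M_simps(3) fin const_def del: One_nat_def)
  qed
  then have "u = const (taug u) \<oplus>\<^bsub>M\<^esub> finsum M (\<lambda>s. t s \<odot>\<^bsub>M\<^esub> w s) S" using main by (simp only:)
  with wM show ?thesis by (rule that)
qed

end

section \<open>Functoriality of the completed tensor product in the base\<close>

context two_bases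
begin

text \<open>Preserving the augmentation means mapping the maximal ideal into the maximal ideal;
  multiplicativity carries this over to all powers.\<close>

lemma base_hom_filtered:
  assumes f: "base_hom B A f"
  shows "filtered_map n n f"
proof -
  have hom: "f \<in> ring_hom B A" and lin: "\<And>c b. b \<in> carrier B \<Longrightarrow> f (c \<odot>\<^bsub>B\<^esub> b) = c \<odot> f b"
    and aug: "\<And>b. b \<in> carrier B \<Longrightarrow> augmentation A (f b) = augmentation B b"
    using f by (simp_all add: base_hom_def)
  have closed: "f b \<in> carrier A" if "b \<in> carrier B" for b using ring_hom_closed[OF hom that] .
  have P1: "f b \<in> P 1" if "b \<in> B.P 1" for b
    using B.augmentation_eq_0_iff[of b] augmentation_eq_0_iff[of "f b"] aug closed B.P_carrier that by auto
  have "f b \<in> P n" if "b \<in> B.P n" for b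
    using that
  proof (induction n arbitrary: b)
    case (Suc n)
    have "b \<in> ideal_prod B (max_ideal B) (B.P n)" using Suc.prems by (simp add: max_power.simps)
    then show ?case
    proof (induction rule: ideal_prod.induct)
      case (prod i j)
      have i: "i \<in> B.P 1" using prod(1) by (simp only: B.P_1)
      have "f (i \<otimes>\<^bsub>B\<^esub> j) = f i \<otimes> f j"
        by (rule ring_hom_mult[OF hom B.P_carrier[OF i] B.P_carrier[OF prod(2)]])
      then show ?case using P_mult[OF P1[OF i] Suc.IH[OF prod(2)]] by simp
    next
      case (sum x y)
      have "x \<in> B.P (Suc n)" "y \<in> B.P (Suc n)" using sum by (simp_all add: max_power.simps)
      then have "f (x \<oplus>\<^bsub>B\<^esub> y) = f x \<oplus> f y" by (intro ring_hom_add[OF hom] B.P_carrier)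
      then show ?case using sum.IH P_subspaceD(3) by simp
    qed
  qed (simp add: closed)
  then show ?thesis
    unfolding filtered_map_def using closed lin ring_hom_add[OF hom] by blast
qed

definition F where "F f = completed_tensor_map sc B A f"

lemma F_level: "F f u n = tmap n n f (u n)"
  by (simp add: F_def completed_tensor_map_def)

lemma F_carrier:
  assumes f: "base_hom B A f" and u: "u \<in> carrier B.M"
  shows "F f u \<in> carrier M"
proof -
  note fil = base_hom_filtered[OF f]
  have fA: "f b \<in> carrier A" if "b \<in> carrier B" for b using fil that by (simp add: filtered_map_def)
  have "trunc n (tmap (Suc n) (Suc n) f (u (Suc n))) = tmap n n f (u n)" for n
  proof -
    have "trunc n (tmap (Suc n) (Suc n) f (u (Suc n))) = tmap n n f (B.trunc n (u (Suc n)))"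
      by (rule B.T_ext[OF B.M_T[OF u, of "Suc n"]])
         (simp_all add: tmap_zero trunc_zero B.trunc_zero tmap_pt[OF fil] trunc_pt B.trunc_pt fA
           tmap_add trunc_add B.trunc_add)
    then show ?thesis using u by (simp add: B.M_simps)
  qed
  then show ?thesis using tmap_T[OF fil B.M_T[OF u]] by (simp add: M_simps F_level)
qed

lemma F_add: "F f (u \<oplus>\<^bsub>B.M\<^esub> v) = F f u \<oplus>\<^bsub>M\<^esub> F f v"
  by (rule ext) (simp add: F_level M_simps(3) B.M_simps(3) tmap_add)

lemma F_zero: "F f \<zero>\<^bsub>B.M\<^esub> = \<zero>\<^bsub>M\<^esub>"
  by (rule ext) (simp add: F_level M_simps(2) B.M_simps(2) tmap_zero)

lemma F_smult:
  assumes f: "base_hom B A f" and b: "b \<in> carrier B" and u: "u \<in> carrier B.M"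
  shows "F f (b \<odot>\<^bsub>B.M\<^esub> u) = f b \<odot>\<^bsub>M\<^esub> F f u"
proof
  fix n
  note fil = base_hom_filtered[OF f]
  have fA: "f b \<in> carrier A" if "b \<in> carrier B" for b using fil that by (simp add: filtered_map_def)
  have fm: "f (b \<otimes>\<^bsub>B\<^esub> c) = f b \<otimes> f c" if "c \<in> carrier B" for c
    using f b that by (simp add: base_hom_def ring_hom_mult)
  have "tmap n n f (B.mulm n b (u n)) = mulm n (f b) (tmap n n f (u n))"
    by (rule B.T_ext[OF B.M_T[OF u]])
       (simp_all add: tmap_zero mulm_zero B.mulm_zero tmap_pt[OF fil] mulm_pt B.mulm_pt b fA fm
         tmap_add mulm_add B.mulm_add)
  then show "F f (b \<odot>\<^bsub>B.M\<^esub> u) n = (f b \<odot>\<^bsub>M\<^esub> F f u) n" by (simp add: F_level M_simps(4) B.M_simps(4))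
qed

lemma F_const:
  assumes f: "base_hom B A f"
  shows "F f (B.const x) = const x"
proof
  fix n
  have "f \<one>\<^bsub>B\<^esub> = \<one>" using f by (simp add: base_hom_def ring_hom_one)
  then show "F f (B.const x) n = const x n"
    using tmap_pt[OF base_hom_filtered[OF f]] by (simp add: F_level B.const_def const_def)
qed

lemma F_finsum:
  assumes f: "base_hom B A f" and I: "finite I" "\<And>i. i \<in> I \<Longrightarrow> u i \<in> carrier B.M"
  shows "F f (finsum B.M u I) = finsum M (\<lambda>i. F f (u i)) I"
  using I
proof (induction I rule: finite_induct)
  case (insert i I)
  then show ?case using F_carrier[OF f]
    by (subst B.Mod.M.finsum_insert) (auto simp: F_add)
qed (simp add: F_zero)

lemma taug_F:
  assumes f: "base_hom B A f" and u: "u \<in> carrier B.M"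
  shows "taug (F f u) = B.taug u"
proof (rule taug_unique)
  have "f \<one>\<^bsub>B\<^esub> = \<one>" using f by (simp add: base_hom_def ring_hom_one)
  then show "F f u 1 = pt 1 \<one> (B.taug u)"
    using tmap_pt[OF base_hom_filtered[OF f], of "\<one>\<^bsub>B\<^esub>" 1 "B.taug u"] B.taug[OF u] by (simp add: F_level del: One_nat_def)
qed

end

section \<open>Dual numbers\<close>

context vector_module
begin

lemma is_basis_empty: "carrier V = {\<zero>} \<Longrightarrow> is_basis V {}"
  unfolding is_basis_def
  by (auto intro!: ex1I[where a = "\<lambda>x. 0"])

lemma is_basis_singleton:
  assumes e: "e \<in> carrier V" and ex1: "\<And>v. v \<in> carrier V \<Longrightarrow> \<exists>!k. v = k \<odot> e"
  shows "is_basis V {e}"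
proof -
  have sum: "finsum V (\<lambda>x. c x \<odot> x) {x. c x \<noteq> 0} = c e \<odot> e" if "{x. c x \<noteq> 0} \<subseteq> {e}" for c :: "'v \<Rightarrow> 'k"
  proof (cases "c e = 0")
    case True
    then have "{x. c x \<noteq> 0} = {}" using that by auto
    then show ?thesis using True e by (simp only: M.finsum_empty smult_0)
  next
    case False
    then have "{x. c x \<noteq> 0} = {e}" using that by auto
    then show ?thesis using e by (simp add: M.finsum_insert)
  qed
  have "\<exists>!c. finite {x. c x \<noteq> 0} \<and> {x. c x \<noteq> 0} \<subseteq> {e} \<and> v = finsum V (\<lambda>x. c x \<odot> x) {x. c x \<noteq> 0}"
    if v: "v \<in> carrier V" for v
  proof -
    obtain k where k: "v = k \<odot> e" "\<And>k'. v = k' \<odot> e \<Longrightarrow> k' = k" using ex1[OF v] by (elim ex1E) (rule that; blast)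
    show ?thesis
    proof (rule ex1I[where a = "\<lambda>x. if x = e then k else 0"])
      have "{x. (if x = e then k else 0) \<noteq> 0} \<subseteq> {e}" by auto
      then show "finite {x. (if x = e then k else 0) \<noteq> 0} \<and> {x. (if x = e then k else 0) \<noteq> 0} \<subseteq> {e} \<and>
        v = finsum V (\<lambda>x. (if x = e then k else 0) \<odot> x) {x. (if x = e then k else 0) \<noteq> 0}"
        using sum[of "\<lambda>x. if x = e then k else 0"] k(1) by (auto intro: finite_subset)
    next
      fix c assume c: "finite {x. c x \<noteq> 0} \<and> {x. c x \<noteq> 0} \<subseteq> {e} \<and> v = finsum V (\<lambda>x. c x \<odot> x) {x. c x \<noteq> 0}"
      then have "c e = k" using sum[of c] k(2) by simp
      then show "c = (\<lambda>x. if x = e then k else 0)" using c by (auto simp: fun_eq_iff)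
    qed
  qed
  then show ?thesis using e by (simp add: is_basis_def)
qed

end

text \<open>\<open>el a b\<close> stands for \<open>a + b \<epsilon>\<close>. Elements are functions on \<open>nat\<close> because the test bases in
  \<^const>\<open>miniversal\<close> have such carriers.\<close>

definition el :: "'k::field \<Rightarrow> 'k \<Rightarrow> nat \<Rightarrow> 'k" where
  "el a b = (\<lambda>i. if i = 0 then a else if i = 1 then b else 0)"

lemma el_eq_iff [simp]: "el a b = el c d \<longleftrightarrow> a = c \<and> b = d"
  by (auto simp: el_def fun_eq_iff)

definition dual_numbers :: "('k::field, nat \<Rightarrow> 'k) module" where
  "dual_numbers =
     \<lparr>carrier = {el a b | a b. True},
      monoid.mult = (\<lambda>x y. el (x 0 * y 0) (x 0 * y 1 + x 1 * y 0)), monoid.one = el 1 0,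
      ring.zero = el 0 0, ring.add = (\<lambda>x y. el (x 0 + y 0) (x 1 + y 1)),
      module.smult = (\<lambda>c x. el (c * x 0) (c * x 1))\<rparr>"

lemma dual_numbers_simps [simp]:
  "carrier dual_numbers = {el a b | a b. True}"
  "el a b \<otimes>\<^bsub>dual_numbers\<^esub> el c d = el (a * c) (a * d + b * c)"
  "el a b \<oplus>\<^bsub>dual_numbers\<^esub> el c d = el (a + c) (b + d)"
  "c \<odot>\<^bsub>dual_numbers\<^esub> el a b = el (c * a) (c * b)"
  "\<one>\<^bsub>dual_numbers\<^esub> = el 1 0" "\<zero>\<^bsub>dual_numbers\<^esub> = el 0 0"
  by (simp_all add: dual_numbers_def el_def fun_eq_iff)

lemma cring_dual_numbers: "cring (dual_numbers :: ('k::field, nat \<Rightarrow> 'k) module)"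
proof (rule cringI)
  show "abelian_group (dual_numbers :: ('k, nat \<Rightarrow> 'k) module)"
  proof (rule abelian_groupI)
    fix x :: "nat \<Rightarrow> 'k" assume "x \<in> carrier dual_numbers"
    then obtain a b where x: "x = el a b" by auto
    then have "el (- a) (- b) \<oplus>\<^bsub>dual_numbers\<^esub> x = \<zero>\<^bsub>dual_numbers\<^esub>" by simp
    then show "\<exists>y\<in>carrier dual_numbers. y \<oplus>\<^bsub>dual_numbers\<^esub> x = \<zero>\<^bsub>dual_numbers\<^esub>"
      by (intro bexI[where x = "el (- a) (- b)"]) auto
  qed (auto simp: algebra_simps)
  show "comm_monoid (dual_numbers :: ('k, nat \<Rightarrow> 'k) module)"
    by (rule comm_monoidI) (auto simp: algebra_simps)
qed (auto simp: algebra_simps)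

lemma algebra_dual_numbers:
  "algebra (ring_of_type_algebra :: 'k::field ring) (dual_numbers :: ('k, nat \<Rightarrow> 'k) module)"
  by (rule algebraI[OF cring_from_type_algebra cring_dual_numbers]) (auto simp: algebra_simps)

interpretation dn: cring "dual_numbers :: ('k::field, nat \<Rightarrow> 'k) module"
  by (rule cring_dual_numbers)

interpretation dnV: vector_module "dual_numbers :: ('k::field, nat \<Rightarrow> 'k) module"
  by (intro vector_module.intro algebra.module algebra_dual_numbers)

lemma dual_numbers_minus: "el a b \<ominus>\<^bsub>dual_numbers\<^esub> el c d = el (a - c) (b - d)"
proof -
  have "\<ominus>\<^bsub>dual_numbers\<^esub> el c d = el (- c) (- d)"
    by (rule dn.minus_equality) auto
  then show ?thesis by (simp add: dn.minus_eq)
qed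

definition nilp :: "(nat \<Rightarrow> 'k::field) set" where
  "nilp = {el 0 b | b. True}"

lemma nilp_simps [simp]: "el a b \<in> nilp \<longleftrightarrow> a = 0"
  by (auto simp: nilp_def)

lemma ideal_nilp: "ideal nilp (dual_numbers :: ('k::field, nat \<Rightarrow> 'k) module)"
proof (rule idealI)
  have "submodule nilp (ring_of_type_algebra :: 'k ring) (dual_numbers :: ('k, nat \<Rightarrow> 'k) module)"
    by (rule dnV.subspaceI) (auto simp: nilp_def)
  then show "subgroup nilp (add_monoid (dual_numbers :: ('k, nat \<Rightarrow> 'k) module))"
    by (simp add: submodule_def)
qed (auto simp: nilp_def dn.ring_axioms)

lemma ideal_subset_nilp:
  assumes I: "ideal I (dual_numbers :: ('k::field, nat \<Rightarrow> 'k) module)" and "I \<noteq> carrier dual_numbers"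
  shows "I \<subseteq> nilp"
proof
  fix x assume x: "x \<in> I"
  interpret I: ideal I dual_numbers by (rule I)
  obtain a b where ab: "x = el a b" using I.Icarr[OF x] by auto
  show "x \<in> nilp"
  proof (rule ccontr)
    assume "x \<notin> nilp"
    then have a: "a \<noteq> 0" by (simp add: ab)
    \<comment> \<open>The factor is the inverse of \<open>a + b \<epsilon>\<close>, namely
      \<open>1 / a\<close> minus \<epsilon> times \<open>b\<close> over the square of
      \<open>a\<close>.\<close>
    have "el (1 / a) (- b / (a * a)) \<otimes>\<^bsub>dual_numbers\<^esub> x \<in> I" by (rule I.I_l_closed[OF x]) auto
    moreover have "el (1 / a) (- b / (a * a)) \<otimes>\<^bsub>dual_numbers\<^esub> x = \<one>\<^bsub>dual_numbers\<^esub>"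
      using a by (simp add: ab)
    ultimately have "I = carrier dual_numbers" using I.one_imp_carrier by simp
    with assms(2) show False by simp
  qed
qed

lemma maximalideal_dual_numbers_iff:
  "maximalideal I (dual_numbers :: ('k::field, nat \<Rightarrow> 'k) module) \<longleftrightarrow> I = nilp"
proof
  have "el 1 0 \<notin> (nilp :: (nat \<Rightarrow> 'k) set)" "el 1 0 \<in> carrier (dual_numbers :: ('k, nat \<Rightarrow> 'k) module)"
    by auto
  then have ne: "nilp \<noteq> carrier (dual_numbers :: ('k, nat \<Rightarrow> 'k) module)" by metis
  have sub: "nilp \<subseteq> carrier (dual_numbers :: ('k, nat \<Rightarrow> 'k) module)" by (auto simp: nilp_def)
  assume "maximalideal I (dual_numbers :: ('k, nat \<Rightarrow> 'k) module)"
  then interpret I: maximalideal I "dual_numbers :: ('k, nat \<Rightarrow> 'k) module" .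
  have "I \<subseteq> nilp" by (rule ideal_subset_nilp[OF I.is_ideal]) (use I.I_notcarr in simp)
  from I.I_maximal[OF ideal_nilp this sub] show "I = nilp" using ne by metis
next
  have "maximalideal nilp (dual_numbers :: ('k, nat \<Rightarrow> 'k) module)"
  proof (rule maximalidealI[OF ideal_nilp])
    have "el 1 0 \<notin> (nilp :: (nat \<Rightarrow> 'k) set)" "el 1 0 \<in> carrier (dual_numbers :: ('k, nat \<Rightarrow> 'k) module)"
      by auto
    then show "carrier (dual_numbers :: ('k, nat \<Rightarrow> 'k) module) \<noteq> nilp" by metis
    fix J assume "ideal J (dual_numbers :: ('k, nat \<Rightarrow> 'k) module)" "nilp \<subseteq> J" "J \<subseteq> carrier dual_numbers"
    then show "J = nilp \<or> J = carrier dual_numbers" using ideal_subset_nilp by blast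
  qed
  then show "I = nilp \<Longrightarrow> maximalideal I (dual_numbers :: ('k, nat \<Rightarrow> 'k) module)" by simp
qed

lemma max_ideal_dual_numbers: "max_ideal (dual_numbers :: ('k::field, nat \<Rightarrow> 'k) module) = nilp"
  by (simp add: max_ideal_def maximalideal_dual_numbers_iff)

lemma max_power_dual_numbers:
  "max_power (dual_numbers :: ('k::field, nat \<Rightarrow> 'k) module) 1 = nilp"
  "n \<ge> 2 \<Longrightarrow> max_power (dual_numbers :: ('k::field, nat \<Rightarrow> 'k) module) n = {el 0 0}"
proof -
  show 1: "max_power (dual_numbers :: ('k::field, nat \<Rightarrow> 'k) module) 1 = nilp"
    using dn.ideal_prod_one(1)[OF ideal_nilp] by (simp add: max_power.simps max_ideal_dual_numbers)
  \<comment> \<open>Products of two elements of \<open>nilp\<close> are zero, so a single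
    computation covers the square and all higher powers.\<close>
  have prod: "ideal_prod dual_numbers nilp J = {el 0 0}" if "el 0 0 \<in> J" "J \<subseteq> nilp" for J :: "(nat \<Rightarrow> 'k) set"
  proof (intro equalityI subsetI)
    fix x :: "nat \<Rightarrow> 'k" assume "x \<in> ideal_prod dual_numbers nilp J"
    then show "x \<in> {el 0 0}"
    proof (induction rule: ideal_prod.induct)
      case (prod i j)
      then have "j \<in> nilp" using that by auto
      then show ?case using prod by (auto simp: nilp_def)
    qed auto
  next
    fix x :: "nat \<Rightarrow> 'k" assume "x \<in> {el 0 0}"
    then have "x = el 0 0 \<otimes>\<^bsub>dual_numbers\<^esub> el 0 0" by simp
    moreover have "el 0 0 \<in> (nilp :: (nat \<Rightarrow> 'k) set)" by simp
    ultimately show "x \<in> ideal_prod dual_numbers nilp J" using ideal_prod.prod that(1) by metis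
  qed
  show "max_power (dual_numbers :: ('k::field, nat \<Rightarrow> 'k) module) n = {el 0 0}" if "n \<ge> 2"
    using that
  proof (induction n rule: dec_induct)
    case base
    show ?case unfolding numeral_2_eq_2 max_power.simps(2)[of _ "Suc 0"] max_ideal_dual_numbers
      by (rule prod) (use 1 in simp_all)
  next
    case (step n)
    then show ?case unfolding max_power.simps(2) max_ideal_dual_numbers by (intro prod) simp_all
  qed
qed

lemma subspace_dual_numbers_power: "dnV.subspace (max_power (dual_numbers :: ('k::field, nat \<Rightarrow> 'k) module) n)"
proof -
  consider "n = 0" | "n = 1" | "n \<ge> 2" by linarith
  then show ?thesis
  proof cases
    case 1
    then show ?thesis using dnV.subspace_carrier by simp
  next
    case 2
    show ?thesis unfolding 2 max_power_dual_numbers(1) by (rule dnV.subspaceI) (auto simp: nilp_def)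
  next
    case 3
    show ?thesis unfolding max_power_dual_numbers(2)[OF 3] by (rule dnV.subspaceI) auto
  qed
qed

text \<open>From level \<open>2\<close> on the truncation is the whole algebra, so a compatible
  sequence is constant there; its value determines levels \<open>1\<close> and
  \<open>0\<close>.\<close>

lemma dual_numbers_complete:
  fixes x :: "nat \<Rightarrow> (nat \<Rightarrow> 'k::field) set"
  assumes x: "\<And>n. x n \<in> carrier (truncation (dual_numbers :: ('k, nat \<Rightarrow> 'k) module) n)"
    "\<And>n. coset_map dual_numbers (max_power dual_numbers n) (\<lambda>a. a) (x (Suc n)) = x n"
  shows "\<exists>!a. a \<in> carrier (dual_numbers :: ('k, nat \<Rightarrow> 'k) module) \<and> (\<forall>n. x n = max_power dual_numbers n +>\<^bsub>dual_numbers\<^esub> a)"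
proof -
  let ?A = "dual_numbers :: ('k, nat \<Rightarrow> 'k) module"
  have carr: "carrier (truncation ?A n) = (\<lambda>a. max_power ?A n +>\<^bsub>?A\<^esub> a) ` carrier ?A" for n
    by (auto simp: truncation_def quot_algebra_def FactRing_def A_RCOSETS_def' simp del: dual_numbers_simps)
  have triv: "{el 0 0} +>\<^bsub>?A\<^esub> a = {a}" if "a \<in> carrier ?A" for a
    using that by (auto simp: a_r_coset_def')
  have mp2: "max_power ?A n = {el 0 0}" if "n \<ge> 2" for n
    using that by (rule max_power_dual_numbers(2))
  then have "max_power ?A 2 = {el 0 0}" by simp
  then obtain a where a: "a \<in> carrier ?A" "x 2 = {a}" using x(1)[of 2] triv unfolding carr by auto
  have ge2: "x n = {a}" if "n \<ge> 2" for n
    using that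
  proof (induction n rule: dec_induct)
    case (step n)
    obtain b where b: "b \<in> carrier ?A" "x (Suc n) = max_power ?A (Suc n) +>\<^bsub>?A\<^esub> b"
      using x(1)[of "Suc n"] unfolding carr by blast
    have mp: "max_power ?A (Suc n) = {el 0 0}" by (rule max_power_dual_numbers(2)) (use step(1) in simp)
    have xb: "x (Suc n) = {b}" unfolding b(2) mp by (rule triv[OF b(1)])
    have "{a} = coset_map ?A {el 0 0} (\<lambda>a. a) {b}"
      using x(2)[of n] mp2[OF step(1)] step.IH xb by simp
    also have "\<dots> = {b}" using b(1) by (auto simp: coset_map_def set_add_def')
    finally show ?case using xb by simp
  qed (rule a)
  have eq: "x n = max_power ?A n +>\<^bsub>?A\<^esub> a" for n
  proof (cases "n \<ge> 2")
    case True
    then show ?thesis using ge2 triv[OF a(1)] mp2[OF True] by simp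
  next
    case False
    have step: "coset_map ?A U (\<lambda>a. a) {a} = U +>\<^bsub>?A\<^esub> a" for U
      by (simp add: coset_map_def set_add_def' a_r_coset_def')
    have 1: "x 1 = max_power ?A 1 +>\<^bsub>?A\<^esub> a"
      using x(2)[of 1] step ge2[of 2] by (simp add: numeral_2_eq_2)
    obtain b where b: "b \<in> carrier ?A" "x 0 = max_power ?A 0 +>\<^bsub>?A\<^esub> b" using x(1)[of 0] unfolding carr by blast
    have "max_power ?A 0 +>\<^bsub>?A\<^esub> b = max_power ?A 0 +>\<^bsub>?A\<^esub> a"
      using dnV.coset_eq_iff[OF subspace_dual_numbers_power b(1) a(1), of 0] dn.minus_closed[OF b(1) a(1)] by simp
    then show ?thesis using False 1 b(2) by (cases n) (auto simp: not_le less_Suc_eq numeral_2_eq_2)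
  qed
  show ?thesis
  proof (rule ex1I[where a = a])
    fix b assume b: "b \<in> carrier ?A \<and> (\<forall>n. x n = max_power ?A n +>\<^bsub>?A\<^esub> b)"
    then have "x 2 = {el 0 0} +>\<^bsub>?A\<^esub> b" using max_power_dual_numbers(2)[of 2, where 'k = 'k] by simp
    then show "b = a" using a(2) triv b by simp
  qed (use a eq in blast)
qed

text \<open>The graded pieces are spanned by the class of \<open>1\<close> in degree
  \<open>0\<close> and of \<epsilon> in degree \<open>1\<close>, and are zero afterwards.\<close>

lemma dual_numbers_gr_finite:
  "finite_dimensional (subquotient (dual_numbers :: ('k::field, nat \<Rightarrow> 'k) module) (max_power dual_numbers k)
     (max_power dual_numbers (Suc k)))"
proof -
  let ?A = "dual_numbers :: ('k, nat \<Rightarrow> 'k) module"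
  let ?Q = "subquotient ?A (max_power ?A k) (max_power ?A (Suc k))"
  note sub = subspace_dual_numbers_power[where 'k = 'k]
  interpret Q: vector_module ?Q
    by (rule dnV.vector_module_subquotient[OF sub sub])
  have carr: "carrier ?Q = (\<lambda>u. max_power ?A (Suc k) +>\<^bsub>?A\<^esub> u) ` max_power ?A k"
    by (rule dnV.subquotient_simps(1))
  have sm: "c \<odot>\<^bsub>?Q\<^esub> (max_power ?A (Suc k) +>\<^bsub>?A\<^esub> el a b) = max_power ?A (Suc k) +>\<^bsub>?A\<^esub> el (c * a) (c * b)" for a b c
    using dnV.subquotient_cosets(2)[OF sub, of "el a b"] by auto
  have eq: "max_power ?A (Suc k) +>\<^bsub>?A\<^esub> el a b = max_power ?A (Suc k) +>\<^bsub>?A\<^esub> el c d \<longleftrightarrow>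
      el (a - c) (b - d) \<in> max_power ?A (Suc k)" for a b c d
    using dnV.coset_eq_iff[OF sub, of "el a b" "el c d"] by (auto simp: dual_numbers_minus)
  consider "k = 0" | "k = 1" | "k \<ge> 2" by linarith
  then show ?thesis
  proof cases
    case k: 1
    have "is_basis ?Q {max_power ?A (Suc k) +>\<^bsub>?A\<^esub> el 1 0}"
    proof (rule Q.is_basis_singleton)
      fix v assume "v \<in> carrier ?Q"
      then obtain a b where v: "v = max_power ?A (Suc k) +>\<^bsub>?A\<^esub> el a b" unfolding carr unfolding k by auto
      show "\<exists>!c. v = c \<odot>\<^bsub>?Q\<^esub> (max_power ?A (Suc k) +>\<^bsub>?A\<^esub> el 1 0)"
        unfolding v sm eq using max_power_dual_numbers(1)[where 'k = 'k] k by auto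
    qed (unfold carr, unfold k, auto)
    then show ?thesis unfolding finite_dimensional_def by blast
  next
    case k: 2
    have "is_basis ?Q {max_power ?A (Suc k) +>\<^bsub>?A\<^esub> el 0 1}"
    proof (rule Q.is_basis_singleton)
      fix v assume "v \<in> carrier ?Q"
      then obtain b where v: "v = max_power ?A (Suc k) +>\<^bsub>?A\<^esub> el 0 b"
        unfolding carr unfolding k max_power_dual_numbers(1) by (auto simp: nilp_def)
      show "\<exists>!c. v = c \<odot>\<^bsub>?Q\<^esub> (max_power ?A (Suc k) +>\<^bsub>?A\<^esub> el 0 1)"
        unfolding v sm eq using max_power_dual_numbers(2)[of "Suc k", where 'k = 'k] k by auto
    next
      show "max_power ?A (Suc k) +>\<^bsub>?A\<^esub> el 0 1 \<in> carrier ?Q"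
        unfolding carr unfolding k max_power_dual_numbers(1) by (rule imageI) simp
    qed
    then show ?thesis unfolding finite_dimensional_def by blast
  next
    case k: 3
    have "carrier ?Q = {max_power ?A (Suc k) +>\<^bsub>?A\<^esub> el 0 0}"
      unfolding carr unfolding max_power_dual_numbers(2)[OF k] by simp
    also have "max_power ?A (Suc k) +>\<^bsub>?A\<^esub> el 0 0 = \<zero>\<^bsub>?Q\<^esub>"
      using dnV.coset_zero[OF sub] by (simp add: dnV.subquotient_simps)
    finally have "is_basis ?Q {}" by (rule Q.is_basis_empty)
    then show ?thesis unfolding finite_dimensional_def by blast
  qed
qed

lemma complete_local_base_dual_numbers: "complete_local_base (dual_numbers :: ('k::field, nat \<Rightarrow> 'k) module)"
proof -
  let ?A = "dual_numbers :: ('k, nat \<Rightarrow> 'k) module"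
  have sub: "dnV.subspace (nilp :: (nat \<Rightarrow> 'k) set)"
    using subspace_dual_numbers_power[of 1, where 'k = 'k] max_power_dual_numbers(1)[where 'k = 'k] by simp
  have eq: "nilp +>\<^bsub>?A\<^esub> el a b = nilp +>\<^bsub>?A\<^esub> el c d \<longleftrightarrow> a = c" for a b c d
    using dnV.coset_eq_iff[OF sub, of "el a b" "el c d"] by (auto simp: dual_numbers_minus)
  have bij: "bij_betw (\<lambda>c. nilp +>\<^bsub>?A\<^esub> (c \<odot>\<^bsub>?A\<^esub> \<one>\<^bsub>?A\<^esub>)) UNIV (carrier (?A Quot nilp))"
    unfolding bij_betw_def
  proof
    show "inj (\<lambda>c. nilp +>\<^bsub>?A\<^esub> (c \<odot>\<^bsub>?A\<^esub> \<one>\<^bsub>?A\<^esub>))" by (rule injI) (simp add: eq)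
    have "nilp +>\<^bsub>?A\<^esub> el a b \<in> range (\<lambda>c. nilp +>\<^bsub>?A\<^esub> (c \<odot>\<^bsub>?A\<^esub> \<one>\<^bsub>?A\<^esub>))" for a b
      by (rule image_eqI[where x = a]) (simp_all add: eq)
    then show "range (\<lambda>c. nilp +>\<^bsub>?A\<^esub> (c \<odot>\<^bsub>?A\<^esub> \<one>\<^bsub>?A\<^esub>)) = carrier (?A Quot nilp)"
      by (auto simp: FactRing_def A_RCOSETS_def')
  qed
  show ?thesis
    unfolding complete_local_base_def max_ideal_dual_numbers
  proof (intro conjI allI impI)
    show "\<exists>!I. maximalideal I ?A" by (simp add: maximalideal_dual_numbers_iff)
    fix x assume x: "(\<forall>n. x n \<in> carrier (truncation ?A n)) \<and>
      (\<forall>n. coset_map ?A (max_power ?A n) (\<lambda>a. a) (x (Suc n)) = x n)"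
    show "\<exists>!a. a \<in> carrier ?A \<and> (\<forall>n. x n = max_power ?A n +>\<^bsub>?A\<^esub> a)"
      by (rule dual_numbers_complete; rule spec, rule conjunct1[OF x] conjunct2[OF x])
  qed (rule algebra_dual_numbers bij dual_numbers_gr_finite)+
qed

section \<open>Deformations over the dual numbers\<close>

context lie_algebra
begin

lemma br_add_left: "br (x + y) z = br x z + br y z"
  and br_scale_left: "br (sc c x) z = sc c (br x z)"
proof -
  interpret l: Vector_Spaces.linear sc sc "\<lambda>x. br x z" by (rule br_linear_left)
  show "br (x + y) z = br x z + br y z" by (rule l.add)
  show "br (sc c x) z = sc c (br x z)" by (rule l.scale)
qed

lemma br_add_right: "br x (y + z) = br x y + br x z"
  and br_scale_right: "br x (sc c z) = sc c (br x z)"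
proof -
  interpret l: Vector_Spaces.linear sc sc "br x" by (rule br_linear_right)
  show "br x (y + z) = br x y + br x z" by (rule l.add)
  show "br x (sc c z) = sc c (br x z)" by (rule l.scale)
qed

lemma br_anti: "br x y = - br y x"
proof -
  have "br (x + y) (x + y) = br x y + br y x"
    unfolding br_add_left br_add_right by (simp add: br_self)
  then show ?thesis by (simp add: br_self eq_neg_iff_add_eq_0)
qed

text \<open>A 2-cocycle in curried form. The last clause is the \<epsilon>-coefficient of the Jacobi
  identity for the bracket \<open>br\<close> plus \<epsilon> times \<open>\<phi>\<close>, before any
  use of antisymmetry.\<close>

definition cocycle2 :: "('l \<Rightarrow> 'l \<Rightarrow> 'l) \<Rightarrow> bool" where
  "cocycle2 \<phi> \<longleftrightarrow> (\<forall>x y z. \<phi> (x + y) z = \<phi> x z + \<phi> y z) \<and> (\<forall>x y z. \<phi> x (y + z) = \<phi> x y + \<phi> x z) \<and>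
     (\<forall>c x y. \<phi> (sc c x) y = sc c (\<phi> x y)) \<and> (\<forall>c x y. \<phi> x (sc c y) = sc c (\<phi> x y)) \<and>
     (\<forall>x. \<phi> x x = 0) \<and>
     (\<forall>x y z. br x (\<phi> y z) + \<phi> x (br y z) + (br y (\<phi> z x) + \<phi> y (br z x)) + (br z (\<phi> x y) + \<phi> z (br x y)) = 0)"

lemma cocycle2_anti: "cocycle2 \<phi> \<Longrightarrow> \<phi> x y = - \<phi> y x"
proof -
  assume \<phi>: "cocycle2 \<phi>"
  have add: "\<phi> (x + y) z = \<phi> x z + \<phi> y z" "\<phi> x (y + z) = \<phi> x y + \<phi> x z" and self: "\<phi> x x = 0" for x y z
    using \<phi> unfolding cocycle2_def by blast+
  have "\<phi> (x + y) (x + y) = \<phi> x y + \<phi> y x" unfolding add by (simp add: self)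
  then show ?thesis by (simp add: self eq_neg_iff_add_eq_0)
qed

end

text \<open>The dual numbers are presented with the single generator \<epsilon>, indexed by the unit
  type, so that the division \<open>decompose_M\<close> applies to them.\<close>

locale dual_lie = generated_tensor_base "dual_numbers :: ('k, nat \<Rightarrow> 'k) module" "{()}" "\<lambda>_. el 0 1" sc +
    lie_algebra sc br
  for sc :: "'k::field \<Rightarrow> 'l::ab_group_add \<Rightarrow> 'l" and br

lemma dual_lieI:
  fixes sc :: "'k::field \<Rightarrow> 'l::ab_group_add \<Rightarrow> 'l"
  assumes "lie_algebra sc br"
  shows "dual_lie sc br"
proof -
  interpret lie_algebra sc br by fact
  interpret local_base "dual_numbers :: ('k, nat \<Rightarrow> 'k) module"
    by (rule complete_local_base_imp_local_base[OF complete_local_base_dual_numbers])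
  have "generated_base (dual_numbers :: ('k, nat \<Rightarrow> 'k) module) {()} (\<lambda>_. el 0 1)"
  proof (rule generated_baseI)
    show "el 0 1 \<in> max_power (dual_numbers :: ('k, nat \<Rightarrow> 'k) module) 1"
      unfolding max_power_dual_numbers(1) by simp
    fix a assume "a \<in> max_power (dual_numbers :: ('k, nat \<Rightarrow> 'k) module) 1"
    then obtain b where a: "a = el 0 b" unfolding max_power_dual_numbers(1) by (auto simp: nilp_def)
    have "finsum dual_numbers (\<lambda>s. b \<odot>\<^bsub>dual_numbers\<^esub> el 0 1) {()} = a"
      by (subst dn.finsum_insert) (auto simp: a)
    moreover have "a \<in> carrier dual_numbers" by (auto simp: a)
    ultimately show "\<exists>c. cg 2 a (\<Oplus>\<^bsub>dual_numbers\<^esub>s\<in>{()}. c s \<odot>\<^bsub>dual_numbers\<^esub> el 0 1)"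
      by (intro exI[where x = "\<lambda>_. b"]) (simp only: cg_refl)
  qed simp
  then interpret generated_base "dual_numbers :: ('k, nat \<Rightarrow> 'k) module" "{()}" "\<lambda>_. el 0 1" .
  show ?thesis by unfold_locales
qed

context dual_lie
begin

lemma el_carrier: "el (a :: 'k) b \<in> carrier dual_numbers"
  by auto

lemma augmentation_el [simp]: "augmentation dual_numbers (el (a :: 'k) b) = a"
proof (rule augmentation_unique)
  have "el a b \<ominus>\<^bsub>dual_numbers\<^esub> el a 0 \<in> P 1" for a b :: 'k
    unfolding dual_numbers_minus max_power_dual_numbers(1) by simp
  then show "cg 1 (el a b) (a \<odot>\<^bsub>dual_numbers\<^esub> \<one>\<^bsub>dual_numbers\<^esub>)"
    unfolding cg_def by auto
qed

text \<open>\<open>\<Theta> x y = 1 \<otimes> x + \<epsilon> \<otimes> y\<close>; every element of the completed tensor product has this form.\<close>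

definition \<Theta> :: "'l \<Rightarrow> 'l \<Rightarrow> ('k, nat \<Rightarrow> 'k, 'l) ctensor" where
  "\<Theta> x y = const x \<oplus>\<^bsub>M\<^esub> el 0 1 \<odot>\<^bsub>M\<^esub> const y"

lemma \<Theta>_level: "\<Theta> x y n \<beta> = pt n (el 1 0) x \<beta> + pt n (el 0 1) y \<beta>"
  using mulm_pt[of "el 0 1" "el 1 0" n y] by (auto simp: \<Theta>_def M_simps(3,4) const_def)

lemma \<Theta>_M [simp]: "\<Theta> x y \<in> carrier M"
  unfolding \<Theta>_def by (intro Mod.M.a_closed const_M Mod.smult_closed el_carrier)

lemma taug_\<Theta> [simp]: "taug (\<Theta> x y) = x"
  unfolding \<Theta>_def
  by (subst taug_add) (auto simp: taug_smult el_carrier intro: Mod.smult_closed simp del: dual_numbers_simps(1))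

lemma pt_el: "pt n (el a b) x \<beta> = pt n (el 1 0) (sc a x) \<beta> + pt n (el 0 1) (sc b x) \<beta>"
proof -
  have "el a b = a \<odot>\<^bsub>dual_numbers\<^esub> el 1 0 \<oplus>\<^bsub>dual_numbers\<^esub> b \<odot>\<^bsub>dual_numbers\<^esub> el 0 1" by simp
  then show ?thesis
    by (metis (no_types) el_carrier pt_add_left pt_smult smult_in)
qed

lemma \<Theta>_add: "\<Theta> x y \<oplus>\<^bsub>M\<^esub> \<Theta> x' y' = \<Theta> (x + x') (y + y')"
  by (intro ext) (simp add: M_simps(3) \<Theta>_level pt_add_right el_carrier del: dual_numbers_simps(1))

lemma \<Theta>_zero: "\<Theta> 0 0 = \<zero>\<^bsub>M\<^esub>"
  by (intro ext) (simp add: M_simps(2) \<Theta>_level el_carrier del: dual_numbers_simps(1))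

lemma \<Theta>_smult: "el a b \<odot>\<^bsub>M\<^esub> \<Theta> x y = \<Theta> (sc a x) (sc a y + sc b x)"
proof (intro ext)
  fix n \<beta>
  have lv: "\<Theta> x y n = (\<lambda>\<beta>. pt n (el 1 0) x \<beta> + pt n (el 0 1) y \<beta>)" by (rule ext) (rule \<Theta>_level)
  have "(el a b \<odot>\<^bsub>M\<^esub> \<Theta> x y) n \<beta> = pt n (el a b) x \<beta> + pt n (el 0 a) y \<beta>"
    unfolding M_simps(4) lv mulm_add using mulm_pt[of "el a b" "el 1 0" n x] mulm_pt[of "el a b" "el 0 1" n y]
    by auto
  also have "\<dots> = \<Theta> (sc a x) (sc a y + sc b x) n \<beta>"
    unfolding pt_el[of n a b] pt_el[of n 0 a] \<Theta>_level
    by (simp add: pt_add_right el_carrier del: dual_numbers_simps(1))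
  finally show "(el a b \<odot>\<^bsub>M\<^esub> \<Theta> x y) n \<beta> = \<Theta> (sc a x) (sc a y + sc b x) n \<beta>" .
qed

lemma \<Theta>_inject: "\<Theta> x y = \<Theta> x' y' \<Longrightarrow> x = x' \<and> y = y'"
proof -
  assume eq: "\<Theta> x y = \<Theta> x' y'"
  then have x: "x = x'" using taug_\<Theta> by metis
  \<comment> \<open>Level \<open>2\<close> is the first level at which \<epsilon> survives;
    \<open>x\<close> has already been recovered by the augmentation.\<close>
  have "pt 2 (el 0 1) (y - y') \<beta> = 0" for \<beta>
  proof -
    have "pt 2 (el 0 1) y \<beta> = pt 2 (el 0 1) y' \<beta>"
      using fun_cong[OF fun_cong[OF eq, of 2], of \<beta>] x by (simp add: \<Theta>_level)
    then show ?thesis using pt_add_right[of "el 0 1" 2 "y - y'" y' \<beta>] el_carrier by simp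
  qed
  moreover have "el 0 1 \<notin> P 2" using max_power_dual_numbers(2)[of 2, where 'k = 'k] by simp
  ultimately have "y - y' = 0" using pt_eq_0[OF el_carrier, of 0 1 2] by blast
  then show ?thesis using x by simp
qed

text \<open>Dividing by \<epsilon> twice leaves a remainder with a factor \<epsilon> squared, so
  only the augmentations of \<open>u\<close> and of the first quotient survive.\<close>

lemma \<Theta>_surj:
  assumes u: "u \<in> carrier M"
  obtains x y where "u = \<Theta> x y"
proof -
  have sum: "finsum M (\<lambda>s. el 0 1 \<odot>\<^bsub>M\<^esub> w s) {()} = el 0 1 \<odot>\<^bsub>M\<^esub> w ()" if "w () \<in> carrier M" for w :: "unit \<Rightarrow> _"
    using Mod.smult_closed[OF el_carrier that] by (subst Mod.M.finsum_insert) simp_all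
  obtain w where w: "\<And>s. s \<in> {()} \<Longrightarrow> w s \<in> carrier M" "u = const (taug u) \<oplus>\<^bsub>M\<^esub> finsum M (\<lambda>s. el 0 1 \<odot>\<^bsub>M\<^esub> w s) {()}"
    by (rule decompose_M[OF u]) (rule that; assumption)
  have wM: "w () \<in> carrier M" using w(1) by simp
  obtain v where v: "\<And>s. s \<in> {()} \<Longrightarrow> v s \<in> carrier M"
    "w () = const (taug (w ())) \<oplus>\<^bsub>M\<^esub> finsum M (\<lambda>s. el 0 1 \<odot>\<^bsub>M\<^esub> v s) {()}"
    by (rule decompose_M[OF wM]) (rule that; assumption)
  have vM: "v () \<in> carrier M" using v(1) by simp
  have "el 0 1 \<odot>\<^bsub>M\<^esub> (el 0 1 \<odot>\<^bsub>M\<^esub> v ()) = (el 0 1 \<otimes>\<^bsub>dual_numbers\<^esub> el 0 1) \<odot>\<^bsub>M\<^esub> v ()"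
    by (rule Mod.smult_assoc1[OF el_carrier el_carrier vM, symmetric])
  also have "\<dots> = \<zero>\<^bsub>dual_numbers\<^esub> \<odot>\<^bsub>M\<^esub> v ()" by simp
  also have "\<dots> = \<zero>\<^bsub>M\<^esub>" by (rule Mod.smult_l_null[OF vM])
  finally have zero: "el 0 1 \<odot>\<^bsub>M\<^esub> (el 0 1 \<odot>\<^bsub>M\<^esub> v ()) = \<zero>\<^bsub>M\<^esub>" .
  have "el 0 1 \<odot>\<^bsub>M\<^esub> w () = el 0 1 \<odot>\<^bsub>M\<^esub> (const (taug (w ())) \<oplus>\<^bsub>M\<^esub> el 0 1 \<odot>\<^bsub>M\<^esub> v ())"
    using v(2) sum[of v, OF vM] by simp
  also have "\<dots> = el 0 1 \<odot>\<^bsub>M\<^esub> const (taug (w ())) \<oplus>\<^bsub>M\<^esub> \<zero>\<^bsub>M\<^esub>"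
    using Mod.smult_r_distr[OF el_carrier const_M Mod.smult_closed[OF el_carrier vM], of 0 1 "taug (w ())" 0 1] zero by simp
  also have "\<dots> = el 0 1 \<odot>\<^bsub>M\<^esub> const (taug (w ()))"
    by (rule Mod.M.r_zero[OF Mod.smult_closed[OF el_carrier const_M]])
  finally have "u = \<Theta> (taug u) (taug (w ()))" using w(2) sum[of w, OF wM] unfolding \<Theta>_def by simp
  then show ?thesis by (rule that)
qed

definition p2 :: "('k, nat \<Rightarrow> 'k, 'l) ctensor \<Rightarrow> 'l" where
  "p2 u = (THE y. u = \<Theta> (taug u) y)"

lemma p2_\<Theta> [simp]: "p2 (\<Theta> x y) = y"
  unfolding p2_def by (rule the_equality) (auto dest: \<Theta>_inject)

text \<open>The deformation \<open>[x, y] + \<epsilon> \<phi>(x, y)\<close>, extended bilinearly over the dual numbers.\<close>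

definition \<nu> where
  "\<nu> \<phi> u v = \<Theta> (br (taug u) (taug v)) (br (taug u) (p2 v) + br (p2 u) (taug v) + \<phi> (taug u) (taug v))"

lemma \<nu>_\<Theta>: "\<nu> \<phi> (\<Theta> x y) (\<Theta> x' y') = \<Theta> (br x x') (br x y' + br y x' + \<phi> x x')"
  by (simp add: \<nu>_def)

lemma formal_deformation_\<nu>:
  assumes \<phi>: "cocycle2 \<phi>"
  shows "formal_deformation sc br dual_numbers (\<nu> \<phi>)"
proof -
  have add: "\<phi> (x + y) z = \<phi> x z + \<phi> y z" "\<phi> x (y + z) = \<phi> x y + \<phi> x z"
    and scale: "\<phi> (sc c x) y = sc c (\<phi> x y)" "\<phi> x (sc c y) = sc c (\<phi> x y)"
    and self: "\<phi> x x = 0"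
    and coc: "br x (\<phi> y z) + \<phi> x (br y z) + (br y (\<phi> z x) + \<phi> y (br z x)) + (br z (\<phi> x y) + \<phi> z (br x y)) = 0"
    for x y z c
    using \<phi> unfolding cocycle2_def by blast+
  have "lie_algebra_over dual_numbers M (\<nu> \<phi>)"
  proof (intro lie_algebra_over.intro lie_algebra_over_axioms.intro module_M)
    fix u v assume "u \<in> carrier M" "v \<in> carrier M"
    obtain x y where u: "u = \<Theta> x y" by (rule \<Theta>_surj[OF \<open>u \<in> carrier M\<close>])
    obtain x' y' where v: "v = \<Theta> x' y'" by (rule \<Theta>_surj[OF \<open>v \<in> carrier M\<close>])
    show "\<nu> \<phi> u v \<in> carrier M" by (simp add: \<nu>_def)
    {
      fix a :: "nat \<Rightarrow> 'k" assume "a \<in> carrier dual_numbers"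
      then obtain p q where a: "a = el p q" by auto
      show "\<nu> \<phi> (a \<odot>\<^bsub>M\<^esub> u) v = a \<odot>\<^bsub>M\<^esub> \<nu> \<phi> u v"
        unfolding u v a \<Theta>_smult \<nu>_\<Theta>
        by (simp add: br_add_left br_scale_left br_scale_right scale L.scale_right_distrib ac_simps)
      show "\<nu> \<phi> u (a \<odot>\<^bsub>M\<^esub> v) = a \<odot>\<^bsub>M\<^esub> \<nu> \<phi> u v"
        unfolding u v a \<Theta>_smult \<nu>_\<Theta>
        by (simp add: br_add_right br_scale_left br_scale_right scale L.scale_right_distrib ac_simps)
    }
    {
      fix w assume "w \<in> carrier M"
      obtain x'' y'' where w: "w = \<Theta> x'' y''" by (rule \<Theta>_surj[OF \<open>w \<in> carrier M\<close>])
      show "\<nu> \<phi> (u \<oplus>\<^bsub>M\<^esub> v) w = \<nu> \<phi> u w \<oplus>\<^bsub>M\<^esub> \<nu> \<phi> v w"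
        unfolding u v w \<Theta>_add \<nu>_\<Theta> by (simp add: br_add_left add ac_simps)
      show "\<nu> \<phi> u (v \<oplus>\<^bsub>M\<^esub> w) = \<nu> \<phi> u v \<oplus>\<^bsub>M\<^esub> \<nu> \<phi> u w"
        unfolding u v w \<Theta>_add \<nu>_\<Theta> by (simp add: br_add_right add ac_simps)
      have "br x (br x' y'' + br y' x'' + \<phi> x' x'') + br y (br x' x'') + \<phi> x (br x' x'') +
          (br x' (br x'' y + br y'' x + \<phi> x'' x) + br y' (br x'' x) + \<phi> x' (br x'' x)) +
          (br x'' (br x y' + br y x' + \<phi> x x') + br y'' (br x x') + \<phi> x'' (br x x')) =
          (br x (br x' y'') + br x' (br y'' x) + br y'' (br x x')) +
          (br x (br y' x'') + br y' (br x'' x) + br x'' (br x y')) +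
          (br y (br x' x'') + br x' (br x'' y) + br x'' (br y x')) +
          (br x (\<phi> x' x'') + \<phi> x (br x' x'') + (br x' (\<phi> x'' x) + \<phi> x' (br x'' x)) + (br x'' (\<phi> x x') + \<phi> x'' (br x x')))"
        unfolding br_add_right by (simp only: ac_simps)
      also have "\<dots> = 0" unfolding jacobi coc by simp
      finally show "\<nu> \<phi> u (\<nu> \<phi> v w) \<oplus>\<^bsub>M\<^esub> \<nu> \<phi> v (\<nu> \<phi> w u) \<oplus>\<^bsub>M\<^esub> \<nu> \<phi> w (\<nu> \<phi> u v) = \<zero>\<^bsub>M\<^esub>"
        unfolding u v w \<nu>_\<Theta> \<Theta>_add jacobi \<Theta>_zero[symmetric] by (rule arg_cong)
    }
    show "\<nu> \<phi> u u = \<zero>\<^bsub>M\<^esub>"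
      unfolding u \<nu>_\<Theta> \<Theta>_zero[symmetric] using br_anti[of x y] by (simp add: br_self self)
  qed
  moreover have "taug (\<nu> \<phi> u v) = br (taug u) (taug v)" for u v by (simp add: \<nu>_def)
  ultimately show ?thesis unfolding formal_deformation_def by blast
qed

text \<open>The equivalence is the identity minus \<epsilon> times \<open>\<psi>\<close>, with
  inverse the identity plus \<epsilon> times \<open>\<psi>\<close>. The condition on
  \<open>\<phi>\<close> says that it is the coboundary of \<open>\<psi>\<close>; taking
  \<open>\<psi>\<close> zero gives reflexivity for the trivial deformation.\<close>

lemma deformations_equivalent_\<nu>:
  assumes \<psi>: "Vector_Spaces.linear sc sc \<psi>"
    and \<phi>: "\<And>x y. \<phi> x y = br x (\<psi> y) + br (\<psi> x) y - \<psi> (br x y)"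
  shows "deformations_equivalent sc dual_numbers (\<nu> (\<lambda>x y. 0)) (\<nu> \<phi>)"
proof -
  interpret \<psi>: Vector_Spaces.linear sc sc \<psi> by (rule \<psi>)
  define \<Phi> where "\<Phi> u = \<Theta> (taug u) (p2 u - \<psi> (taug u))" for u
  have \<Phi>: "\<Phi> (\<Theta> x y) = \<Theta> x (y - \<psi> x)" for x y by (simp add: \<Phi>_def)
  have diff_right: "br x (y - z) = br x y - br x z" and diff_left: "br (y - z) x = br y x - br z x" for x y z
    using br_add_right[of x "y - z" z] br_add_left[of "y - z" z x] by (simp_all add: algebra_simps)
  show ?thesis
    unfolding deformations_equivalent_def Let_def
  proof (intro exI[where x = \<Phi>] conjI ballI)
    show "bij_betw \<Phi> (carrier M) (carrier M)"
    proof (rule bij_betw_byWitness[where f' = "\<lambda>u. \<Theta> (taug u) (p2 u + \<psi> (taug u))"])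
      show "\<forall>u\<in>carrier M. \<Theta> (taug (\<Phi> u)) (p2 (\<Phi> u) + \<psi> (taug (\<Phi> u))) = u"
      proof
        fix u assume "u \<in> carrier M"
        then obtain x y where "u = \<Theta> x y" by (rule \<Theta>_surj)
        then show "\<Theta> (taug (\<Phi> u)) (p2 (\<Phi> u) + \<psi> (taug (\<Phi> u))) = u" by (simp add: \<Phi>)
      qed
      show "\<forall>u\<in>carrier M. \<Phi> (\<Theta> (taug u) (p2 u + \<psi> (taug u))) = u"
      proof
        fix u assume "u \<in> carrier M"
        then obtain x y where "u = \<Theta> x y" by (rule \<Theta>_surj)
        then show "\<Phi> (\<Theta> (taug u) (p2 u + \<psi> (taug u))) = u" by (simp add: \<Phi>)
      qed
    qed (auto simp: \<Phi>_def)
    fix u assume "u \<in> carrier M"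
    obtain x y where u: "u = \<Theta> x y" by (rule \<Theta>_surj[OF \<open>u \<in> carrier M\<close>])
    show "taug (\<Phi> u) = taug u" by (simp add: \<Phi>_def)
    {
      fix a :: "nat \<Rightarrow> 'k" assume "a \<in> carrier dual_numbers"
      then obtain p q where a: "a = el p q" by auto
      show "\<Phi> (a \<odot>\<^bsub>M\<^esub> u) = a \<odot>\<^bsub>M\<^esub> \<Phi> u"
        unfolding u a \<Theta>_smult \<Phi> \<psi>.scale by (simp add: L.scale_right_diff_distrib algebra_simps)
    }
    fix v assume "v \<in> carrier M"
    obtain x' y' where v: "v = \<Theta> x' y'" by (rule \<Theta>_surj[OF \<open>v \<in> carrier M\<close>])
    show "\<Phi> (u \<oplus>\<^bsub>M\<^esub> v) = \<Phi> u \<oplus>\<^bsub>M\<^esub> \<Phi> v"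
      unfolding u v \<Theta>_add \<Phi> \<psi>.add by (simp add: algebra_simps)
    show "\<Phi> (\<nu> (\<lambda>x y. 0) u v) = \<nu> \<phi> (\<Phi> u) (\<Phi> v)"
      unfolding u v \<nu>_\<Theta> \<Phi> \<phi> diff_left diff_right by (simp add: algebra_simps)
  qed
qed

end

section \<open>Push-outs along tangent vectors\<close>

locale coordinatized_base = generated_tensor_base A S t sc
  for A :: "('k::field, 'a) module" (structure) and S :: "'x set" and t
    and sc :: "'k \<Rightarrow> 'l::ab_group_add \<Rightarrow> 'l" +
  fixes x :: "'x \<Rightarrow> 'a \<Rightarrow> 'k"
  assumes x_add: "s \<in> S \<Longrightarrow> a \<in> P 1 \<Longrightarrow> b \<in> P 1 \<Longrightarrow> x s (a \<oplus> b) = x s a + x s b"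
    and x_smult: "s \<in> S \<Longrightarrow> a \<in> P 1 \<Longrightarrow> x s (c \<odot> a) = c * x s a"
    and x_P2: "s \<in> S \<Longrightarrow> a \<in> P 2 \<Longrightarrow> x s a = 0"
    and x_t: "s \<in> S \<Longrightarrow> s' \<in> S \<Longrightarrow> x s (t s') = (if s = s' then 1 else 0)"
begin

text \<open>The component of \<open>a\<close> in the maximal ideal, for the splitting of the base
  into scalars and the maximal ideal.\<close>

definition red :: "'a \<Rightarrow> 'a" where
  "red a = a \<ominus> augmentation A a \<odot> \<one>"

lemma red_P: "a \<in> carrier A \<Longrightarrow> red a \<in> P 1"
  using cg_augmentation[of a] by (simp only: cg_def red_def)

lemma red_carrier: "a \<in> carrier A \<Longrightarrow> red a \<in> carrier A"
  by (rule P_carrier[OF red_P])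

lemma red_eq: "a \<in> carrier A \<Longrightarrow> a = red a \<oplus> augmentation A a \<odot> \<one>"
  by (simp add: red_def A.minus_eq A.a_assoc A.l_neg)

lemma red_unique:
  assumes "a \<in> carrier A" "b \<in> carrier A" "a = b \<oplus> augmentation A a \<odot> \<one>"
  shows "red a = b"
proof -
  have "red a = (b \<oplus> augmentation A a \<odot> \<one>) \<ominus> augmentation A a \<odot> \<one>" unfolding red_def using assms(3) by simp
  also have "\<dots> = b" using assms(2) by (simp add: A.minus_eq A.a_assoc A.r_neg)
  finally show ?thesis .
qed

lemma red_add:
  assumes a: "a \<in> carrier A" "b \<in> carrier A"
  shows "red (a \<oplus> b) = red a \<oplus> red b"
proof (rule red_unique)
  have "a \<oplus> b = (red a \<oplus> augmentation A a \<odot> \<one>) \<oplus> (red b \<oplus> augmentation A b \<odot> \<one>)"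
    using red_eq[OF a(1)] red_eq[OF a(2)] by simp
  also have "\<dots> = red a \<oplus> red b \<oplus> (augmentation A a \<odot> \<one> \<oplus> augmentation A b \<odot> \<one>)"
    using red_carrier[OF a(1)] red_carrier[OF a(2)] by (simp add: A.a_ac)
  finally show "a \<oplus> b = red a \<oplus> red b \<oplus> augmentation A (a \<oplus> b) \<odot> \<one>"
    unfolding augmentation_add[OF a] smult_add_left[OF A.one_closed] .
qed (use a red_carrier in auto)

lemma red_smult:
  assumes a: "a \<in> carrier A"
  shows "red (c \<odot> a) = c \<odot> red a"
proof (rule red_unique)
  have "c \<odot> a = c \<odot> (red a \<oplus> augmentation A a \<odot> \<one>)" using red_eq[OF a] by simp
  also have "\<dots> = c \<odot> red a \<oplus> c \<odot> (augmentation A a \<odot> \<one>)"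
    using red_carrier[OF a] by (simp add: smult_add_right)
  finally show "c \<odot> a = c \<odot> red a \<oplus> augmentation A (c \<odot> a) \<odot> \<one>"
    unfolding augmentation_smult[OF a] smult_mult[OF A.one_closed] .
qed (use a red_carrier in auto)

lemma red_mult:
  assumes a: "a \<in> carrier A" "b \<in> carrier A"
  shows "red (a \<otimes> b) = red a \<otimes> red b \<oplus> (augmentation A b \<odot> red a \<oplus> augmentation A a \<odot> red b)"
proof (rule red_unique)
  have c: "red a \<in> carrier A" "red b \<in> carrier A" using a red_carrier by auto
  have "a \<otimes> b = (red a \<oplus> augmentation A a \<odot> \<one>) \<otimes> (red b \<oplus> augmentation A b \<odot> \<one>)"
    using red_eq[OF a(1)] red_eq[OF a(2)] by simp
  also have "\<dots> = red a \<otimes> red b \<oplus> (augmentation A b \<odot> red a \<oplus> augmentation A a \<odot> red b)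
      \<oplus> augmentation A (a \<otimes> b) \<odot> \<one>"
    using c by (simp add: A.l_distr A.r_distr smult_mult_left smult_mult_right augmentation_mult a
        smult_add_right A.a_ac mult.commute flip: smult_mult)
  finally show "a \<otimes> b = red a \<otimes> red b \<oplus> (augmentation A b \<odot> red a \<oplus> augmentation A a \<odot> red b)
      \<oplus> augmentation A (a \<otimes> b) \<odot> \<one>" .
qed (use a red_carrier in auto)

lemma red_one: "red \<one> = \<zero>"
  by (rule red_unique) (simp_all add: augmentation_one)

lemma red_of_P1: "a \<in> P 1 \<Longrightarrow> red a = a"
  using augmentation_eq_0_iff[of a] P_carrier[of a 1] by (intro red_unique) simp_all

text \<open>The homomorphism to the dual numbers given by the tangent vector \<open>c\<close>.\<close>

definition lift :: "('x \<Rightarrow> 'k) \<Rightarrow> 'a \<Rightarrow> nat \<Rightarrow> 'k" where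
  "lift c a = el (augmentation A a) (\<Sum>s\<in>S. c s * x s (red a))"

lemma lift_t: "s \<in> S \<Longrightarrow> lift c (t s) = el 0 (c s)"
proof -
  assume s: "s \<in> S"
  have "(\<Sum>s'\<in>S. c s' * x s' (t s)) = (\<Sum>s'\<in>S. if s' = s then c s' else 0)"
    by (rule sum.cong[OF refl]) (simp add: x_t s)
  then show ?thesis
    using s finite_S augmentation_eq_0_iff[of "t s"] t_carrier[OF s] t_P[OF s]
    by (simp add: lift_def red_of_P1 del: One_nat_def)
qed

text \<open>Multiplicativity is a Leibniz rule: the product of two components in the maximal ideal
  lies in \<open>P 2\<close>, where the coordinates vanish. \<open>dual_lie\<close> supplies the
  augmentation of the dual numbers.\<close>

lemma base_hom_lift:
  assumes "dual_lie sc br"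
  shows "base_hom A dual_numbers (lift c)"
proof -
  interpret D: dual_lie sc br by fact
  have add: "lift c (a \<oplus> b) = lift c a \<oplus>\<^bsub>dual_numbers\<^esub> lift c b" if "a \<in> carrier A" "b \<in> carrier A" for a b
    using that red_P by (simp add: lift_def red_add x_add augmentation_add distrib_left sum.distrib del: One_nat_def)
  have scale: "lift c (k \<odot> a) = k \<odot>\<^bsub>dual_numbers\<^esub> lift c a" if "a \<in> carrier A" for a k
    using that red_P
    by (simp add: lift_def red_smult x_smult augmentation_smult sum_distrib_left mult.left_commute del: One_nat_def)
  have mult: "lift c (a \<otimes> b) = lift c a \<otimes>\<^bsub>dual_numbers\<^esub> lift c b"
    if a: "a \<in> carrier A" and b: "b \<in> carrier A" for a b
  proof -
    have "x s (red (a \<otimes> b)) = augmentation A b * x s (red a) + augmentation A a * x s (red b)" if s: "s \<in> S" for s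
    proof -
      have P2: "red a \<otimes> red b \<in> P 2" using P_mult[OF red_P[OF a] red_P[OF b]] by (simp add: numeral_2_eq_2)
      then have P1: "red a \<otimes> red b \<in> P 1" using P_antimono[of 1 2] by auto
      show ?thesis
        unfolding red_mult[OF a b]
        using x_P2[OF s P2] P1 red_P[OF a] red_P[OF b] P_subspaceD(3,4)
        by (simp add: x_add[OF s] x_smult[OF s] del: One_nat_def)
    qed
    then have "(\<Sum>s\<in>S. c s * x s (red (a \<otimes> b))) =
        (\<Sum>s\<in>S. augmentation A a * (c s * x s (red b)) + (c s * x s (red a)) * augmentation A b)"
      by (intro sum.cong refl) (simp add: algebra_simps)
    also have "\<dots> = augmentation A a * (\<Sum>s\<in>S. c s * x s (red b)) + (\<Sum>s\<in>S. c s * x s (red a)) * augmentation A b"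
      by (simp only: sum.distrib sum_distrib_left sum_distrib_right)
    finally show ?thesis using a b by (simp add: lift_def augmentation_mult)
  qed
  have one: "lift c \<one> = \<one>\<^bsub>dual_numbers\<^esub>"
  proof -
    have "x s \<zero> = 0" if "s \<in> S" for s using x_P2[OF that] P_subspaceD(2) by blast
    then show ?thesis by (simp add: lift_def red_one augmentation_one)
  qed
  have closed: "lift c a \<in> carrier dual_numbers" for a by (auto simp: lift_def)
  have hom: "lift c \<in> ring_hom A dual_numbers"
    by (rule ring_hom_memI) (use add mult one closed in auto)
  show ?thesis unfolding base_hom_def using hom scale by (simp add: lift_def)
qed

end

locale deformed_lie = B: coordinatized_base B E t sc x + dual_lie sc br
  for B :: "('k::field, 'b) module" and E :: "'e set" and t
    and sc :: "'k \<Rightarrow> 'l::ab_group_add \<Rightarrow> 'l" and x and br +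
  fixes \<eta>
  assumes \<eta>: "formal_deformation sc br B \<eta>"
begin

sublocale two_bases B dual_numbers sc
  by unfold_locales

sublocale H: lie_algebra_over B B.M \<eta>
  using \<eta> by (simp add: formal_deformation_def)

lemma taug_\<eta>: "u \<in> carrier B.M \<Longrightarrow> v \<in> carrier B.M \<Longrightarrow> B.taug (\<eta> u v) = br (B.taug u) (B.taug v)"
  using \<eta> by (simp add: formal_deformation_def)

lemma hom: "base_hom B dual_numbers (B.lift c)"
  by (rule B.base_hom_lift) unfold_locales

abbreviation G where "G c \<equiv> F (B.lift c)"

lemmas G_M = F_carrier[OF hom] and G_add = F_add and G_smult = F_smult[OF hom]
  and G_const = F_const[OF hom] and G_finsum = F_finsum[OF hom] and taug_G = taug_F[OF hom]

lemma const_eq_\<Theta>: "const y = \<Theta> y 0"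
proof (intro ext)
  show "const y n \<beta> = \<Theta> y 0 n \<beta>" for n \<beta>
    unfolding \<Theta>_level pt_zero_right[OF el_carrier] by (simp add: const_def)
qed

text \<open>Multiplication by \<epsilon> destroys the \<epsilon>-part, so only the augmentation of
  \<open>u\<close> remains. With \<open>lift_t\<close> this makes the image of a multiple of
  \<open>t e\<close> linear in \<open>c e\<close>.\<close>

lemma eps_G: "u \<in> carrier B.M \<Longrightarrow> el 0 k \<odot>\<^bsub>M\<^esub> G c u = \<Theta> 0 (sc k (B.taug u))"
proof -
  assume u: "u \<in> carrier B.M"
  obtain y z where yz: "G c u = \<Theta> y z" by (rule \<Theta>_surj[OF G_M[OF u]])
  then have "y = B.taug u" using taug_G[OF u, of c] by simp
  then show ?thesis by (simp add: yz \<Theta>_smult)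
qed

lemma finsum_\<Theta>: "finite I \<Longrightarrow> finsum M (\<lambda>i. \<Theta> 0 (y i)) I = \<Theta> 0 (\<Sum>i\<in>I. y i)"
  by (induction I rule: finite_induct) (simp_all add: \<Theta>_zero \<Theta>_add)

text \<open>Linearity over the base. The instances are the identity and the bracket with one
  argument fixed.\<close>

definition endo :: "(('k, 'b, 'l) ctensor \<Rightarrow> ('k, 'b, 'l) ctensor) \<Rightarrow> bool" where
  "endo g \<longleftrightarrow> (\<forall>u\<in>carrier B.M. g u \<in> carrier B.M) \<and>
     (\<forall>u\<in>carrier B.M. \<forall>v\<in>carrier B.M. g (u \<oplus>\<^bsub>B.M\<^esub> v) = g u \<oplus>\<^bsub>B.M\<^esub> g v) \<and>
     (\<forall>b\<in>carrier B. \<forall>u\<in>carrier B.M. g (b \<odot>\<^bsub>B.M\<^esub> u) = b \<odot>\<^bsub>B.M\<^esub> g u)"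

lemma endoD:
  assumes "endo g"
  shows "u \<in> carrier B.M \<Longrightarrow> g u \<in> carrier B.M"
    "u \<in> carrier B.M \<Longrightarrow> v \<in> carrier B.M \<Longrightarrow> g (u \<oplus>\<^bsub>B.M\<^esub> v) = g u \<oplus>\<^bsub>B.M\<^esub> g v"
    "b \<in> carrier B \<Longrightarrow> u \<in> carrier B.M \<Longrightarrow> g (b \<odot>\<^bsub>B.M\<^esub> u) = b \<odot>\<^bsub>B.M\<^esub> g u"
  using assms unfolding endo_def by blast+

lemma finsum_hom:
  assumes "finite I" "\<And>i. i \<in> I \<Longrightarrow> u i \<in> carrier B.M"
    and "endo g"
  shows "g (finsum B.M u I) = finsum B.M (\<lambda>i. g (u i)) I"
  using assms(1,2)
proof (induction I rule: finite_induct)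
  note g = endoD[OF assms(3)]
  case empty
  have "g \<zero>\<^bsub>B.M\<^esub> = g (\<zero>\<^bsub>B\<^esub> \<odot>\<^bsub>B.M\<^esub> \<zero>\<^bsub>B.M\<^esub>)" by simp
  also have "\<dots> = \<zero>\<^bsub>B\<^esub> \<odot>\<^bsub>B.M\<^esub> g \<zero>\<^bsub>B.M\<^esub>" by (rule g(3)) simp_all
  also have "\<dots> = \<zero>\<^bsub>B.M\<^esub>" by (rule B.Mod.smult_l_null) (simp add: g(1))
  finally show ?case by simp
next
  case (insert i I)
  then show ?case by (simp add: Pi_iff endoD[OF assms(3)] B.Mod.M.finsum_closed)
qed

text \<open>The \<open>y e\<close> are the augmentations of the quotients of \<open>u\<close> by the
  generators. They depend neither on \<open>c\<close> nor on \<open>g\<close>, which yields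
  linearity in \<open>c\<close> and allows the identity and \<open>g\<close> to be compared through
  the same vectors.\<close>

lemma G_decompose:
  assumes u: "u \<in> carrier B.M"
  obtains y where "\<forall>c. p2 (G c u) = (\<Sum>e\<in>E. sc (c e) (y e))"
    and "\<forall>g h c. endo g \<longrightarrow> (\<forall>u\<in>carrier B.M. B.taug (g u) = h (B.taug u)) \<longrightarrow>
      G c (g u) = G c (g (B.const (B.taug u))) \<oplus>\<^bsub>M\<^esub> \<Theta> 0 (\<Sum>e\<in>E. sc (c e) (h (y e)))"
proof -
  obtain w where w: "\<And>e. e \<in> E \<Longrightarrow> w e \<in> carrier B.M"
    "u = B.const (B.taug u) \<oplus>\<^bsub>B.M\<^esub> finsum B.M (\<lambda>e. t e \<odot>\<^bsub>B.M\<^esub> w e) E"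
    by (rule B.decompose_M[OF u]) (rule that; assumption)
  define y where "y e = B.taug (w e)" for e
  have tw: "t e \<odot>\<^bsub>B.M\<^esub> w e \<in> carrier B.M" if "e \<in> E" for e
    by (rule B.Mod.smult_closed[OF B.t_carrier[OF that] w(1)[OF that]])
  have sum_M: "finsum B.M (\<lambda>e. t e \<odot>\<^bsub>B.M\<^esub> w e) E \<in> carrier B.M"
    by (rule B.Mod.M.finsum_closed) (use tw in auto)
  have main: "G c (g u) = G c (g (B.const (B.taug u))) \<oplus>\<^bsub>M\<^esub> \<Theta> 0 (\<Sum>e\<in>E. sc (c e) (h (y e)))"
    if endo: "endo g" and h: "\<And>u. u \<in> carrier B.M \<Longrightarrow> B.taug (g u) = h (B.taug u)" for g h c
  proof -
    note g = endoD[OF endo]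
    have "g u = g (B.const (B.taug u)) \<oplus>\<^bsub>B.M\<^esub> g (finsum B.M (\<lambda>e. t e \<odot>\<^bsub>B.M\<^esub> w e) E)"
      by (subst w(2)) (rule g(2)[OF B.const_M sum_M])
    also have "g (finsum B.M (\<lambda>e. t e \<odot>\<^bsub>B.M\<^esub> w e) E) = finsum B.M (\<lambda>e. g (t e \<odot>\<^bsub>B.M\<^esub> w e)) E"
      by (rule finsum_hom[OF B.finite_S tw endo])
    finally have "G c (g u) = G c (g (B.const (B.taug u))) \<oplus>\<^bsub>M\<^esub> finsum M (\<lambda>e. G c (g (t e \<odot>\<^bsub>B.M\<^esub> w e))) E"
      using G_finsum[OF B.finite_S, of "\<lambda>e. g (t e \<odot>\<^bsub>B.M\<^esub> w e)" c] g(1)[OF tw] by (simp add: G_add)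
    also have "finsum M (\<lambda>e. G c (g (t e \<odot>\<^bsub>B.M\<^esub> w e))) E = finsum M (\<lambda>e. \<Theta> 0 (sc (c e) (h (y e)))) E"
    proof (rule Mod.M.finsum_cong')
      fix e assume e: "e \<in> E"
      have "G c (g (t e \<odot>\<^bsub>B.M\<^esub> w e)) = B.lift c (t e) \<odot>\<^bsub>M\<^esub> G c (g (w e))"
        unfolding g(3)[OF B.t_carrier[OF e] w(1)[OF e]] by (rule G_smult[OF B.t_carrier[OF e] g(1)[OF w(1)[OF e]]])
      also have "\<dots> = \<Theta> 0 (sc (c e) (h (y e)))"
        unfolding B.lift_t[OF e] eps_G[OF g(1)[OF w(1)[OF e]]] h[OF w(1)[OF e]] y_def ..
      finally show "G c (g (t e \<odot>\<^bsub>B.M\<^esub> w e)) = \<Theta> 0 (sc (c e) (h (y e)))" .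
    qed simp_all
    also have "\<dots> = \<Theta> 0 (\<Sum>e\<in>E. sc (c e) (h (y e)))" by (rule finsum_\<Theta>[OF B.finite_S])
    finally show ?thesis .
  qed
  \<comment> \<open>The identity instance; the constant part is mapped to a constant and has no
    \<epsilon>-component.\<close>
  have "p2 (G c u) = (\<Sum>e\<in>E. sc (c e) (y e))" for c
    using main[of "\<lambda>u. u" "\<lambda>y. y" c] unfolding G_const const_eq_\<Theta> \<Theta>_add by (simp add: endo_def)
  with main show ?thesis by (intro that[of y] allI impI) simp_all
qed

text \<open>Replacing \<open>u\<close> by its constant part changes the result only by a first-order
  term. The same \<open>y e\<close> compute that term and \<open>p2 (G c u)\<close>, and linearity
  of \<open>h\<close> identifies the two.\<close>

lemma G_hom:
  assumes u: "u \<in> carrier B.M"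
    and g: "endo g"
    and h: "\<And>u. u \<in> carrier B.M \<Longrightarrow> B.taug (g u) = h (B.taug u)" "Vector_Spaces.linear sc sc h"
  shows "G c (g u) = G c (g (B.const (B.taug u))) \<oplus>\<^bsub>M\<^esub> \<Theta> 0 (h (p2 (G c u)))"
proof -
  interpret h: Vector_Spaces.linear sc sc h by (rule h(2))
  obtain y where y: "\<forall>c. p2 (G c u) = (\<Sum>e\<in>E. sc (c e) (y e))"
    "\<forall>g h c. endo g \<longrightarrow> (\<forall>u\<in>carrier B.M. B.taug (g u) = h (B.taug u)) \<longrightarrow>
      G c (g u) = G c (g (B.const (B.taug u))) \<oplus>\<^bsub>M\<^esub> \<Theta> 0 (\<Sum>e\<in>E. sc (c e) (h (y e)))"
    by (rule G_decompose[OF u]) (rule that; assumption)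
  have "G c (g u) = G c (g (B.const (B.taug u))) \<oplus>\<^bsub>M\<^esub> \<Theta> 0 (\<Sum>e\<in>E. sc (c e) (h (y e)))"
    using y(2) g h(1) by blast
  moreover have "h (p2 (G c u)) = (\<Sum>e\<in>E. sc (c e) (h (y e)))" unfolding spec[OF y(1), of c] h.sum h.scale ..
  ultimately show ?thesis by simp
qed

text \<open>Linearity in the tangent vector, with the coefficient vectors of
  \<open>G_decompose\<close> recovered by evaluating at unit tangent vectors.\<close>

lemma p2_G_sum:
  assumes u: "u \<in> carrier B.M"
  shows "p2 (G c u) = (\<Sum>e\<in>E. sc (c e) (p2 (G (\<lambda>e'. if e' = e then 1 else 0) u)))"
proof -
  obtain y where "\<forall>c. p2 (G c u) = (\<Sum>e\<in>E. sc (c e) (y e))"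
    by (rule G_decompose[OF u]) (rule that)
  then have y: "p2 (G c u) = (\<Sum>e\<in>E. sc (c e) (y e))" for c by (rule spec)
  have "p2 (G (\<lambda>e'. if e' = e then 1 else 0) u) = y e" if e: "e \<in> E" for e
  proof -
    have "p2 (G (\<lambda>e'. if e' = e then 1 else 0) u) = (\<Sum>e'\<in>E. if e' = e then y e' else 0)"
      unfolding y by (rule sum.cong) auto
    then show ?thesis using e B.finite_S by simp
  qed
  then show ?thesis by (simp add: y)
qed

text \<open>The infinitesimal deformation in direction \<open>c\<close>: the \<epsilon>-component of
  the pushed-forward bracket of constant tensors.\<close>

definition \<phi> :: "('e \<Rightarrow> 'k) \<Rightarrow> 'l \<Rightarrow> 'l \<Rightarrow> 'l" where
  "\<phi> c y z = p2 (G c (\<eta> (B.const y) (B.const z)))"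

lemma \<phi>_sum: "\<phi> c y z = (\<Sum>e\<in>E. sc (c e) (\<phi> (\<lambda>e'. if e' = e then 1 else 0) y z))"
  unfolding \<phi>_def by (rule p2_G_sum[OF H.bracket_closed[OF B.const_M B.const_M]])

lemma G_\<Theta>:
  assumes "u \<in> carrier B.M"
  shows "G c u = \<Theta> (B.taug u) (p2 (G c u))"
proof -
  obtain y z where yz: "G c u = \<Theta> y z" by (rule \<Theta>_surj[OF G_M[OF assms]])
  then have "y = B.taug u" using taug_G[OF assms, of c] by simp
  then show ?thesis by (simp add: yz)
qed

lemma G_\<eta>_const: "G c (\<eta> (B.const y) (B.const z)) = \<Theta> (br y z) (\<phi> c y z)"
  using G_\<Theta>[OF H.bracket_closed[OF B.const_M B.const_M], of c y z]
  by (simp add: taug_\<eta> \<phi>_def)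

text \<open>The two arguments are replaced by their constant parts one after the other with
  \<open>G_hom\<close>; the corrections are the mixed terms in \<open>\<nu>\<close>.\<close>

lemma G_\<eta>:
  assumes u: "u \<in> carrier B.M" and v: "v \<in> carrier B.M"
  shows "G c (\<eta> u v) = \<nu> (\<phi> c) (G c u) (G c v)"
proof -
  have "G c (\<eta> u v) = G c (\<eta> (B.const (B.taug u)) v) \<oplus>\<^bsub>M\<^esub> \<Theta> 0 (br (p2 (G c u)) (B.taug v))"
    by (rule G_hom[OF u, where g = "\<lambda>u. \<eta> u v"])
       (use v in \<open>simp_all add: endo_def H.bracket_closed H.bracket_add_left H.bracket_smult_left taug_\<eta> br_linear_left\<close>)
  also have "G c (\<eta> (B.const (B.taug u)) v) =
      G c (\<eta> (B.const (B.taug u)) (B.const (B.taug v))) \<oplus>\<^bsub>M\<^esub> \<Theta> 0 (br (B.taug u) (p2 (G c v)))"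
    by (rule G_hom[OF v, where g = "\<lambda>v. \<eta> (B.const (B.taug u)) v"])
       (simp_all add: endo_def H.bracket_closed H.bracket_add_right H.bracket_smult_right taug_\<eta> br_linear_right)
  finally have "G c (\<eta> u v) = \<Theta> (br (B.taug u) (B.taug v))
      (br (B.taug u) (p2 (G c v)) + br (p2 (G c u)) (B.taug v) + \<phi> c (B.taug u) (B.taug v))"
    unfolding G_\<eta>_const \<Theta>_add by (simp add: ac_simps)
  then show ?thesis by (simp add: \<nu>_def taug_G u v)
qed

text \<open>Each identity of \<open>\<eta>\<close> on constant tensors is transported by
  \<open>G c\<close>, and its \<epsilon>-component is extracted through uniqueness of the
  coordinates in \<open>\<Theta>\<close>.\<close>

lemma cocycle2_\<phi>: "cocycle2 (\<phi> c)"
proof -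
  have eqI: "z = z'" if "\<Theta> y z = \<Theta> y' z'" for y y' z z' using \<Theta>_inject[OF that] by simp
  have add_l: "\<phi> c (y + y') z = \<phi> c y z + \<phi> c y' z" for y y' z
    by (rule eqI[of "br (y + y') z" _ "br y z + br y' z"])
       (simp only: G_\<eta>_const[symmetric] B.const_add H.bracket_add_left B.const_M G_add \<Theta>_add[symmetric])
  have add_r: "\<phi> c z (y + y') = \<phi> c z y + \<phi> c z y'" for y y' z
    by (rule eqI[of "br z (y + y')" _ "br z y + br z y'"])
       (simp only: G_\<eta>_const[symmetric] B.const_add H.bracket_add_right B.const_M G_add \<Theta>_add[symmetric])
  have lift_one: "B.lift c (k \<odot>\<^bsub>B\<^esub> \<one>\<^bsub>B\<^esub>) = el k 0" for k
  proof -
    have "B.lift c (k \<odot>\<^bsub>B\<^esub> \<one>\<^bsub>B\<^esub>) = k \<odot>\<^bsub>dual_numbers\<^esub> B.lift c \<one>\<^bsub>B\<^esub>"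
      using hom[of c] by (simp add: base_hom_def)
    also have "B.lift c \<one>\<^bsub>B\<^esub> = \<one>\<^bsub>dual_numbers\<^esub>"
      using hom[of c] by (intro ring_hom_one) (simp add: base_hom_def)
    finally show ?thesis by simp
  qed
  have k1: "k \<odot>\<^bsub>B\<^esub> \<one>\<^bsub>B\<^esub> \<in> carrier B" for k by simp
  have scale_l: "\<phi> c (sc k y) z = sc k (\<phi> c y z)" for k y z
  proof -
    have "\<Theta> (br (sc k y) z) (\<phi> c (sc k y) z) = el k 0 \<odot>\<^bsub>M\<^esub> \<Theta> (br y z) (\<phi> c y z)"
      unfolding G_\<eta>_const[symmetric] B.const_scale H.bracket_smult_left[OF k1 B.const_M B.const_M]
        G_smult[OF k1 H.bracket_closed[OF B.const_M B.const_M]] lift_one ..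
    then show ?thesis unfolding \<Theta>_smult by (auto dest: \<Theta>_inject)
  qed
  have scale_r: "\<phi> c z (sc k y) = sc k (\<phi> c z y)" for k y z
  proof -
    have "\<Theta> (br z (sc k y)) (\<phi> c z (sc k y)) = el k 0 \<odot>\<^bsub>M\<^esub> \<Theta> (br z y) (\<phi> c z y)"
      unfolding G_\<eta>_const[symmetric] B.const_scale H.bracket_smult_right[OF k1 B.const_M B.const_M]
        G_smult[OF k1 H.bracket_closed[OF B.const_M B.const_M]] lift_one ..
    then show ?thesis unfolding \<Theta>_smult by (auto dest: \<Theta>_inject)
  qed
  have self: "\<phi> c y y = 0" for y
    unfolding \<phi>_def H.bracket_self[OF B.const_M] F_zero unfolding \<Theta>_zero[symmetric] by (rule p2_\<Theta>)
  have coc: "br x (\<phi> c y z) + \<phi> c x (br y z) + (br y (\<phi> c z x) + \<phi> c y (br z x)) + (br z (\<phi> c x y) + \<phi> c z (br x y)) = 0"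
    for x y z
  proof -
    let ?j = "\<lambda>x y z. \<eta> (B.const x) (\<eta> (B.const y) (B.const z))"
    \<comment> \<open>The second coordinate is one of the three cyclic terms of the cocycle
      condition, so the Jacobi identity of \<open>\<eta>\<close> supplies the whole sum.\<close>
    have j: "G c (?j x y z) = \<Theta> (br x (br y z)) (br x (\<phi> c y z) + \<phi> c x (br y z))" for x y z
      unfolding G_\<eta>[OF B.const_M H.bracket_closed[OF B.const_M B.const_M]] G_\<eta>_const G_const const_eq_\<Theta> \<nu>_\<Theta>
      by (simp add: \<nu>_def br_add_left[of 0 0, simplified])
    have "G c (?j x y z \<oplus>\<^bsub>B.M\<^esub> ?j y z x \<oplus>\<^bsub>B.M\<^esub> ?j z x y) = \<Theta> 0 0"
      unfolding H.bracket_jacobi[OF B.const_M B.const_M B.const_M] F_zero \<Theta>_zero ..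
    then show ?thesis unfolding G_add j \<Theta>_add by (auto dest: \<Theta>_inject)
  qed
  show ?thesis unfolding cocycle2_def using add_l add_r scale_l scale_r self coc by blast
qed

lemma is_push_out_\<nu>: "is_push_out sc br B dual_numbers (B.lift c) \<eta> (\<nu> (\<phi> c))"
  unfolding is_push_out_def using formal_deformation_\<nu>[OF cocycle2_\<phi>] G_\<eta> by (simp add: F_def)

lemma cotangent_injective:
  assumes mini: "miniversal sc br B \<eta>"
    and \<psi>: "Vector_Spaces.linear sc sc \<psi>" "\<And>y z. \<phi> c y z = br y (\<psi> z) + br (\<psi> y) z - \<psi> (br y z)"
    and e: "e \<in> E"
  shows "c e = 0"
proof -
  let ?A = "dual_numbers :: ('k, nat \<Rightarrow> 'k) module"
  have zero: "cocycle2 (\<lambda>y z. 0)" by (simp add: cocycle2_def br_add_right[of _ 0 0, simplified])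
  \<comment> \<open>By linearity in the tangent vector, the zero vector gives the zero cocycle, so
    its push-out is the trivial deformation.\<close>
  have \<phi>0: "\<phi> (\<lambda>e. 0) = (\<lambda>y z. 0)" by (intro ext, subst \<phi>_sum) simp
  have linear0: "Vector_Spaces.linear sc sc (\<lambda>y. 0)"
    by unfold_locales simp_all
  have 0: "induces sc br B \<eta> ?A (\<nu> (\<lambda>y z. 0)) (B.lift (\<lambda>e. 0))"
    unfolding induces_def
  proof (intro conjI exI)
    show "is_push_out sc br B ?A (B.lift (\<lambda>e. 0)) \<eta> (\<nu> (\<lambda>y z. 0))"
      using is_push_out_\<nu>[of "\<lambda>e. 0"] unfolding \<phi>0 .
    show "deformations_equivalent sc ?A (\<nu> (\<lambda>y z. 0)) (\<nu> (\<lambda>y z. 0))"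
      by (rule deformations_equivalent_\<nu>[OF linear0])
         (simp add: br_add_right[of _ 0 0, simplified] br_add_left[of 0 0, simplified])
  qed (rule hom)
  have c: "induces sc br B \<eta> ?A (\<nu> (\<lambda>y z. 0)) (B.lift c)"
    unfolding induces_def
    using hom is_push_out_\<nu> deformations_equivalent_\<nu>[OF \<psi>] by blast
  have "max_power ?A 2 = {\<zero>\<^bsub>?A\<^esub>}" using max_power_dual_numbers(2)[of 2, where 'k = 'k] by simp
  moreover have "\<forall>(A :: ('k, nat \<Rightarrow> 'k) module) \<mu>.
        complete_local_base A \<and> formal_deformation sc br A \<mu> \<longrightarrow>
        (\<exists>f. induces sc br B \<eta> A \<mu> f) \<and>
        (max_power A 2 = {\<zero>\<^bsub>A\<^esub>} \<longrightarrow>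
           (\<forall>f g. induces sc br B \<eta> A \<mu> f \<and> induces sc br B \<eta> A \<mu> g \<longrightarrow>
              (\<forall>b\<in>carrier B. f b = g b)))"
    using mini unfolding miniversal_def by (elim conjE)
  ultimately have "\<forall>b\<in>carrier B. B.lift c b = B.lift (\<lambda>e. 0) b"
    using complete_local_base_dual_numbers formal_deformation_\<nu>[OF zero] 0 c by blast
  \<comment> \<open>Evaluation at the representative \<open>t e\<close> reads off the coordinate
    \<open>c e\<close>.\<close>
  then have "B.lift c (t e) = B.lift (\<lambda>e. 0) (t e)" using B.t_carrier[OF e] by blast
  then show ?thesis by (simp add: B.lift_t[OF e])
qed

end

section \<open>Cohomology\<close>

text \<open>Gaussian elimination by induction on the equations: an unknown with nonzero coefficient
  in the new equation is eliminated, which keeps more unknowns than equations.\<close>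

lemma homogeneous_system:
  fixes m :: "'e \<Rightarrow> 's \<Rightarrow> 'k::field"
  assumes "finite S" "finite E" "card S < card E"
  shows "\<exists>c. (\<exists>e\<in>E. c e \<noteq> 0) \<and> (\<forall>s\<in>S. (\<Sum>e\<in>E. c e * m e s) = 0)"
  using assms
proof (induction S arbitrary: E m rule: finite_induct)
  case empty
  then obtain e where "e \<in> E" by fastforce
  then show ?case by (intro exI[where x = "\<lambda>_. 1"]) auto
next
  case (insert s S)
  show ?case
  proof (cases "\<forall>e\<in>E. m e s = 0")
    case True
    have "card S < card E" using insert by simp
    from insert.IH[OF insert.prems(1) this, of m] obtain c
      where "\<exists>e\<in>E. c e \<noteq> 0" "\<forall>s\<in>S. (\<Sum>e\<in>E. c e * m e s) = 0" by blast
    then show ?thesis using True by (intro exI[where x = c]) auto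
  next
    case False
    then obtain e0 where e0: "e0 \<in> E" "m e0 s \<noteq> 0" by blast
    define E' where "E' = E - {e0}"
    have E': "finite E'" "E = insert e0 E'" "e0 \<notin> E'" using insert.prems(1) e0(1) by (auto simp: E'_def)
    have "card S < card E'" using insert.hyps insert.prems E' by simp
    from insert.IH[OF E'(1) this, of "\<lambda>e s'. m e s' - m e s / m e0 s * m e0 s'"] obtain c
      where c: "\<exists>e\<in>E'. c e \<noteq> 0" "\<forall>s'\<in>S. (\<Sum>e\<in>E'. c e * (m e s' - m e s / m e0 s * m e0 s')) = 0" by blast
    \<comment> \<open>The value at the pivot \<open>e0\<close> is forced by equation
      \<open>s\<close>; the reduced system arises by substituting it into the other
      equations.\<close>
    define d where "d e = (if e = e0 then - (\<Sum>e\<in>E'. c e * m e s) / m e0 s else c e)" for e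
    have sum: "(\<Sum>e\<in>E. d e * m e s') = (\<Sum>e\<in>E'. c e * m e s') - (\<Sum>e\<in>E'. c e * m e s) / m e0 s * m e0 s'" for s'
    proof -
      have "(\<Sum>e\<in>E'. d e * m e s') = (\<Sum>e\<in>E'. c e * m e s')"
        by (rule sum.cong[OF refl]) (use E'(3) in \<open>auto simp: d_def\<close>)
      then show ?thesis using E' by (simp add: d_def)
    qed
    have "(\<Sum>e\<in>E. d e * m e s') = 0" if "s' \<in> insert s S" for s'
    proof (cases "s' = s")
      case True
      then show ?thesis unfolding sum using e0(2) by simp
    next
      case False
      then have "(\<Sum>e\<in>E'. c e * (m e s' - m e s / m e0 s * m e0 s')) = 0" using c(2) that by blast
      then show ?thesis unfolding sum
        by (simp add: right_diff_distrib sum_subtractf sum_distrib_right sum_divide_distrib mult.assoc)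
    qed
    moreover have "\<exists>e\<in>E. d e \<noteq> 0" using c(1) E' by (auto simp: d_def)
    ultimately show ?thesis by blast
  qed
qed

section \<open>Bases of dual spaces\<close>

lemma vector_module_dual: "vector_module (dual V :: ('k::field, 'v \<Rightarrow> 'k) module)"
  unfolding vector_module_def
proof (rule moduleI)
  show "abelian_group (dual V)"
  proof (rule abelian_groupI)
    fix \<xi> assume "\<xi> \<in> carrier (dual V)"
    then show "\<exists>\<zeta>\<in>carrier (dual V). \<zeta> \<oplus>\<^bsub>dual V\<^esub> \<xi> = \<zero>\<^bsub>dual V\<^esub>"
      by (intro bexI[where x = "\<lambda>v. - \<xi> v"]) (auto simp: dual_def)
  qed (auto simp: dual_def algebra_simps)
qed (auto simp: dual_def algebra_simps intro: cring_from_type_algebra)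

lemma finsum_dual:
  assumes "finite I" "\<And>i. i \<in> I \<Longrightarrow> \<xi> i \<in> carrier (dual V)"
  shows "finsum (dual V) \<xi> I = (\<lambda>v. \<Sum>i\<in>I. \<xi> i v)"
proof -
  interpret D: vector_module "dual V" by (rule vector_module_dual)
  show ?thesis using assms
  proof (induction I rule: finite_induct)
    case (insert i I)
    then show ?case by (subst D.M.finsum_insert) (auto simp: dual_def)
  next
    case empty
    show ?case unfolding D.M.finsum_empty by (simp add: dual_def)
  qed
qed

lemma dual_basis_eq:
  assumes "S \<subseteq> carrier (dual V)" "finite {\<xi>. c \<xi> \<noteq> 0}" "{\<xi>. c \<xi> \<noteq> 0} \<subseteq> S"
  shows "finsum (dual V) (\<lambda>\<xi>. c \<xi> \<odot>\<^bsub>dual V\<^esub> \<xi>) {\<xi>. c \<xi> \<noteq> 0} = (\<lambda>v. \<Sum>\<xi> | c \<xi> \<noteq> 0. c \<xi> * \<xi> v)"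
proof -
  interpret D: vector_module "dual V" by (rule vector_module_dual)
  have "finsum (dual V) (\<lambda>\<xi>. c \<xi> \<odot>\<^bsub>dual V\<^esub> \<xi>) {\<xi>. c \<xi> \<noteq> 0} = (\<lambda>v. \<Sum>\<xi> | c \<xi> \<noteq> 0. (c \<xi> \<odot>\<^bsub>dual V\<^esub> \<xi>) v)"
    by (rule finsum_dual[OF assms(2)]) (use assms in blast)
  then show ?thesis by (simp add: dual_def)
qed

context vector_module
begin

text \<open>The coordinate functionals of a finite basis of \<open>V\<close> are combinations of
  \<open>S\<close>, so a vector killed by \<open>S\<close> has zero coordinates.\<close>

lemma dual_basis_separates:
  assumes V: "finite_dimensional V" and S: "is_basis (dual V) S"
    and v: "v \<in> carrier V" and zero: "\<And>\<xi>. \<xi> \<in> S \<Longrightarrow> \<xi> v = 0"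
  shows "v = \<zero>"
proof -
  obtain T where T: "finite T" "is_basis V T" using V unfolding finite_dimensional_def by blast
  obtain x where x: "\<And>b. b \<in> T \<Longrightarrow> x b \<in> carrier (dual V)"
    "\<And>v. v \<in> carrier V \<Longrightarrow> v = finsum V (\<lambda>b. x b v \<odot> b) T"
    by (rule basis_coordinates[OF T(2,1)]) (rule that; assumption)
  have T_V: "b \<in> carrier V" if "b \<in> T" for b using T(2) that by (auto simp: is_basis_def)
  have S_D: "S \<subseteq> carrier (dual V)" using S by (simp add: is_basis_def)
  have "x b v = 0" if b: "b \<in> T" for b
  proof -
    obtain c where c: "finite {\<xi>. c \<xi> \<noteq> 0}" "{\<xi>. c \<xi> \<noteq> 0} \<subseteq> S"
      "x b = finsum (dual V) (\<lambda>\<xi>. c \<xi> \<odot>\<^bsub>dual V\<^esub> \<xi>) {\<xi>. c \<xi> \<noteq> 0}"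
      using S x(1)[OF b] unfolding is_basis_def by blast
    have "x b v = (\<Sum>\<xi> | c \<xi> \<noteq> 0. c \<xi> * \<xi> v)" unfolding c(3) dual_basis_eq[OF S_D c(1,2)] ..
    also have "\<dots> = 0" by (rule sum.neutral) (use c(2) zero in auto)
    finally show ?thesis .
  qed
  then have "finsum V (\<lambda>b. x b v \<odot> b) T = finsum V (\<lambda>b. \<zero>) T"
    by (intro M.finsum_cong') (use T_V in auto)
  then show ?thesis using x(2)[OF v] by simp
qed

text \<open>Finitely many elements of \<open>S\<close> suffice to express the coordinate functionals
  and hence the whole dual; any further element of \<open>S\<close> would have two
  expansions.\<close>

lemma dual_basis_finite:
  assumes V: "finite_dimensional V" and S: "is_basis (dual V) S"
  shows "finite S"
proof -
  obtain T where T: "finite T" "is_basis V T" using V unfolding finite_dimensional_def by blast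
  obtain x where x: "\<And>b. b \<in> T \<Longrightarrow> x b \<in> carrier (dual V)"
    "\<And>v. v \<in> carrier V \<Longrightarrow> v = finsum V (\<lambda>b. x b v \<odot> b) T"
    by (rule basis_coordinates[OF T(2,1)]) (rule that; assumption)
  have T_V: "b \<in> carrier V" if "b \<in> T" for b using T(2) that by (auto simp: is_basis_def)
  have S_D: "S \<subseteq> carrier (dual V)" using S by (simp add: is_basis_def)
  have "\<forall>b\<in>T. \<exists>c. finite {\<xi>. c \<xi> \<noteq> 0} \<and> {\<xi>. c \<xi> \<noteq> 0} \<subseteq> S \<and>
      x b = finsum (dual V) (\<lambda>\<xi>. c \<xi> \<odot>\<^bsub>dual V\<^esub> \<xi>) {\<xi>. c \<xi> \<noteq> 0}"
    using S x(1) unfolding is_basis_def by blast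
  from bchoice[OF this] obtain c where c: "\<forall>b\<in>T. finite {\<xi>. c b \<xi> \<noteq> 0} \<and> {\<xi>. c b \<xi> \<noteq> 0} \<subseteq> S \<and>
      x b = finsum (dual V) (\<lambda>\<xi>. c b \<xi> \<odot>\<^bsub>dual V\<^esub> \<xi>) {\<xi>. c b \<xi> \<noteq> 0}" by (elim exE)
  define S' where "S' = (\<Union>b\<in>T. {\<xi>. c b \<xi> \<noteq> 0})"
  have S': "finite S'" "S' \<subseteq> S" using c T(1) by (auto simp: S'_def)
  have xb: "x b v = (\<Sum>\<xi>\<in>S'. c b \<xi> * \<xi> v)" if b: "b \<in> T" for b v
  proof -
    have cb: "finite {\<xi>. c b \<xi> \<noteq> 0}" "{\<xi>. c b \<xi> \<noteq> 0} \<subseteq> S"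
      "x b = finsum (dual V) (\<lambda>\<xi>. c b \<xi> \<odot>\<^bsub>dual V\<^esub> \<xi>) {\<xi>. c b \<xi> \<noteq> 0}"
      using bspec[OF c b] by blast+
    have "x b v = (\<Sum>\<xi> | c b \<xi> \<noteq> 0. c b \<xi> * \<xi> v)"
      unfolding cb(3) dual_basis_eq[OF S_D cb(1,2)] ..
    also have "\<dots> = (\<Sum>\<xi>\<in>S'. c b \<xi> * \<xi> v)"
      by (rule sum.mono_neutral_left[OF S'(1)]) (use b in \<open>auto simp: S'_def\<close>)
    finally show ?thesis .
  qed
  have "S \<subseteq> S'"
  proof
    fix s assume s: "s \<in> S"
    have sD: "s \<in> carrier (dual V)" using s S_D by blast
    show "s \<in> S'"
    proof (rule ccontr)
      assume "s \<notin> S'"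
      \<comment> \<open>\<open>s\<close> is the sum of its values \<open>s b\<close> times the
        coordinate functionals, each of which is expanded in \<open>S'\<close>.\<close>
      define d where "d \<xi> = (if \<xi> \<in> S' then \<Sum>b\<in>T. s b * c b \<xi> else 0)" for \<xi>
      have d: "{\<xi>. d \<xi> \<noteq> 0} \<subseteq> S'" by (auto simp: d_def)
      have d_fin: "finite {\<xi>. d \<xi> \<noteq> 0}" using finite_subset[OF d S'(1)] .
      have s_eq: "s v = (\<Sum>\<xi> | d \<xi> \<noteq> 0. d \<xi> * \<xi> v)" for v
      proof (cases "v \<in> carrier V")
        case True
        have "s v = s (finsum V (\<lambda>b. x b v \<odot> b) T)" using x(2)[OF True] by simp
        also have "\<dots> = (\<Sum>b\<in>T. s (x b v \<odot> b))"
          by (rule dual_finsum[OF sD _ T(1)]) (use T_V in auto)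
        also have "\<dots> = (\<Sum>b\<in>T. x b v * s b)" by (rule sum.cong) (use sD T_V in \<open>auto simp: dual_iff\<close>)
        also have "\<dots> = (\<Sum>b\<in>T. \<Sum>\<xi>\<in>S'. (s b * c b \<xi>) * \<xi> v)"
          by (rule sum.cong[OF refl]) (simp add: xb sum_distrib_left mult.commute mult.left_commute)
        also have "\<dots> = (\<Sum>\<xi>\<in>S'. \<Sum>b\<in>T. (s b * c b \<xi>) * \<xi> v)" by (rule sum.swap)
        also have "\<dots> = (\<Sum>\<xi>\<in>S'. d \<xi> * \<xi> v)"
          by (rule sum.cong[OF refl]) (simp add: d_def sum_distrib_right)
        also have "\<dots> = (\<Sum>\<xi> | d \<xi> \<noteq> 0. d \<xi> * \<xi> v)"
          by (rule sum.mono_neutral_right[OF S'(1) d]) auto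
        finally show ?thesis .
      next
        case False
        \<comment> \<open>The expansions are equalities of functions on the whole type; outside the
          carrier all functionals have the default value \<open>0\<close>.\<close>
        have "\<xi> v = 0" if "\<xi> \<in> S" for \<xi> using that False S_D by (auto simp: dual_iff)
        then have "(\<Sum>\<xi> | d \<xi> \<noteq> 0. d \<xi> * \<xi> v) = 0" using d S'(2) by (intro sum.neutral) auto
        then show ?thesis using False sD by (simp add: dual_iff)
      qed
      let ?\<delta> = "\<lambda>\<xi>. if \<xi> = s then 1 else 0 :: 'k"
      have \<delta>: "{\<xi>. ?\<delta> \<xi> \<noteq> 0} = {s}" by auto
      have 1: "finite {\<xi>. d \<xi> \<noteq> 0} \<and> {\<xi>. d \<xi> \<noteq> 0} \<subseteq> S \<and>
          s = finsum (dual V) (\<lambda>\<xi>. d \<xi> \<odot>\<^bsub>dual V\<^esub> \<xi>) {\<xi>. d \<xi> \<noteq> 0}"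
        using d d_fin S'(2) s_eq dual_basis_eq[OF S_D d_fin] by (auto simp: fun_eq_iff)
      have 2: "finite {\<xi>. ?\<delta> \<xi> \<noteq> 0} \<and> {\<xi>. ?\<delta> \<xi> \<noteq> 0} \<subseteq> S \<and>
          s = finsum (dual V) (\<lambda>\<xi>. ?\<delta> \<xi> \<odot>\<^bsub>dual V\<^esub> \<xi>) {\<xi>. ?\<delta> \<xi> \<noteq> 0}"
        using dual_basis_eq[OF S_D, of ?\<delta>] s unfolding \<delta> by simp
      have "\<exists>!c. finite {\<xi>. c \<xi> \<noteq> 0} \<and> {\<xi>. c \<xi> \<noteq> 0} \<subseteq> S \<and>
          s = finsum (dual V) (\<lambda>\<xi>. c \<xi> \<odot>\<^bsub>dual V\<^esub> \<xi>) {\<xi>. c \<xi> \<noteq> 0}"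
        using S sD unfolding is_basis_def by blast
      then obtain c0 where c0: "\<forall>c. finite {\<xi>. c \<xi> \<noteq> 0} \<and> {\<xi>. c \<xi> \<noteq> 0} \<subseteq> S \<and>
          s = finsum (dual V) (\<lambda>\<xi>. c \<xi> \<odot>\<^bsub>dual V\<^esub> \<xi>) {\<xi>. c \<xi> \<noteq> 0} \<longrightarrow> c = c0"
        by (elim ex1E) (rule that)
      have "d = c0" "?\<delta> = c0" by (rule mp[OF spec[OF c0, of d] 1], rule mp[OF spec[OF c0, of ?\<delta>] 2])
      then have "d = ?\<delta>" by simp
      then have "d s = 1" by simp
      then show False using \<open>s \<notin> S'\<close> by (simp add: d_def)
    qed
  qed
  then show ?thesis using S'(1) finite_subset by blast
qed

end

section \<open>Cochains in degrees one and two\<close>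

context lie_algebra
begin

lemma linear_sc_iff: "Vector_Spaces.linear sc sc f \<longleftrightarrow>
    (\<forall>x y. f (x + y) = f x + f y) \<and> (\<forall>c x. f (sc c x) = sc c (f x))"
  unfolding Vector_Spaces.linear_def module_hom_def module_hom_axioms_def module_iff_vector_space
  using vector_space_axioms by auto

lemma vector_module_cochains: "vector_module (cochains sc q)"
  unfolding vector_module_def
proof (rule moduleI)
  show "abelian_group (cochains sc q)"
  proof (rule abelian_groupI)
    fix \<chi> assume "\<chi> \<in> carrier (cochains sc q)"
    then show "\<exists>\<zeta>\<in>carrier (cochains sc q). \<zeta> \<oplus>\<^bsub>cochains sc q\<^esub> \<chi> = \<zero>\<^bsub>cochains sc q\<^esub>"
      by (intro bexI[where x = "\<lambda>v. - \<chi> v"]) (auto simp: cochains_def linear_sc_iff)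
    fix \<zeta> assume "\<zeta> \<in> carrier (cochains sc q)"
    with \<open>\<chi> \<in> carrier (cochains sc q)\<close> show "\<chi> \<oplus>\<^bsub>cochains sc q\<^esub> \<zeta> \<in> carrier (cochains sc q)"
      by (simp add: cochains_def linear_sc_iff scale_right_distrib ac_simps)
  qed (simp_all add: cochains_def linear_sc_iff ac_simps)
  fix c \<chi> assume "\<chi> \<in> carrier (cochains sc q)"
  then show "c \<odot>\<^bsub>cochains sc q\<^esub> \<chi> \<in> carrier (cochains sc q)"
    by (simp add: cochains_def linear_sc_iff scale_right_distrib mult.commute)
qed (simp_all add: cochains_def scale_right_distrib scale_left_distrib cring_from_type_algebra)

lemma finsum_cochains:
  assumes "finite I" "\<And>i. i \<in> I \<Longrightarrow> \<chi> i \<in> carrier (cochains sc q)"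
  shows "finsum (cochains sc q) \<chi> I = (\<lambda>xs. \<Sum>i\<in>I. \<chi> i xs)"
proof -
  interpret D: vector_module "cochains sc q" by (rule vector_module_cochains)
  show ?thesis using assms
  proof (induction I rule: finite_induct)
    case (insert i I)
    then show ?case by (subst D.M.finsum_insert) (auto simp: cochains_def)
  next
    case empty
    show ?case unfolding D.M.finsum_empty by (simp add: cochains_def)
  qed
qed

lemma coboundary_map_1:
  "coboundary_map sc br 1 \<chi> [a, b] = br a (\<chi> [b]) - br b (\<chi> [a]) - \<chi> [br a b]"
  "length xs \<noteq> 2 \<Longrightarrow> coboundary_map sc br 1 \<chi> xs = 0"
  by (simp_all add: coboundary_map_def nths_Cons numeral_2_eq_2)

lemma coboundary_map_2:
  "coboundary_map sc br 2 \<chi> [a, b, c] = br a (\<chi> [b, c]) - br b (\<chi> [a, c]) + br c (\<chi> [a, b])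
     - \<chi> [br a b, c] + \<chi> [br a c, b] - \<chi> [br b c, a]"
  "length xs \<noteq> 3 \<Longrightarrow> coboundary_map sc br 2 \<chi> xs = 0"
  by (simp_all add: coboundary_map_def nths_Cons numeral_2_eq_2 numeral_3_eq_3 lessThan_Suc atMost_Suc)

lemma cochains_1_linear:
  assumes "\<chi> \<in> carrier (cochains sc 1)"
  shows "Vector_Spaces.linear sc sc (\<lambda>l. \<chi> [l])"
proof -
  have "\<forall>xs. \<forall>i<1. length xs = 1 \<longrightarrow> Vector_Spaces.linear sc sc (\<lambda>y. \<chi> (xs[i := y]))"
    using assms by (simp add: cochains_def)
  from this[rule_format, of 0 "[0]"] show ?thesis by simp
qed

lemma cochains_2I:
  assumes "\<And>x y z. f (x + y) z = f x z + f y z" "\<And>x y z. f x (y + z) = f x y + f x z"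
    "\<And>c x y. f (sc c x) y = sc c (f x y)" "\<And>c x y. f x (sc c y) = sc c (f x y)" "\<And>x. f x x = 0"
  shows "(\<lambda>xs. if length xs = 2 then f (xs ! 0) (xs ! 1) else 0) \<in> carrier (cochains sc 2)"
proof -
  have "i = 0 \<or> i = Suc 0" if "i < 2" for i :: nat using that by auto
  then show ?thesis
    using assms by (auto simp: cochains_def linear_sc_iff length_Suc_conv numeral_2_eq_2 less_Suc_eq)
qed

lemma coboundaries_2: "coboundaries sc br 2 = coboundary_map sc br 1 ` carrier (cochains sc 1)"
  by (simp add: numeral_2_eq_2)

lemma coboundary_map_1_eq:
  "coboundary_map sc br 1 \<chi> = (\<lambda>xs. if length xs = 2
     then br (xs ! 0) (\<chi> [xs ! 1]) - br (xs ! 1) (\<chi> [xs ! 0]) - \<chi> [br (xs ! 0) (xs ! 1)] else 0)"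
proof
  fix xs :: "'l list"
  show "coboundary_map sc br 1 \<chi> xs = (if length xs = 2
     then br (xs ! 0) (\<chi> [xs ! 1]) - br (xs ! 1) (\<chi> [xs ! 0]) - \<chi> [br (xs ! 0) (xs ! 1)] else 0)"
  proof (cases "length xs = 2")
    case True
    then obtain a b where "xs = [a, b]" by (auto simp: length_Suc_conv numeral_2_eq_2)
    then show ?thesis by (simp add: coboundary_map_1 del: One_nat_def)
  qed (simp add: coboundary_map_1 del: One_nat_def)
qed

lemma subspace_coboundaries_2:
  "submodule (coboundaries sc br 2) (ring_of_type_algebra :: 'k ring) (cochains sc 2)"
proof -
  interpret V: vector_module "cochains sc 2" by (rule vector_module_cochains)
  interpret V1: vector_module "cochains sc 1" by (rule vector_module_cochains)
  show ?thesis
  proof (rule V.subspaceI)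
    show "coboundaries sc br 2 \<subseteq> carrier (cochains sc 2)"
    proof
      fix u assume "u \<in> coboundaries sc br 2"
      then obtain \<chi> where \<chi>: "\<chi> \<in> carrier (cochains sc 1)" "u = coboundary_map sc br 1 \<chi>"
        unfolding coboundaries_2 by blast
      interpret l: Vector_Spaces.linear sc sc "\<lambda>l. \<chi> [l]" by (rule cochains_1_linear[OF \<chi>(1)])
      show "u \<in> carrier (cochains sc 2)"
        unfolding \<chi>(2) coboundary_map_1_eq
        by (rule cochains_2I[where f = "\<lambda>a b. br a (\<chi> [b]) - br b (\<chi> [a]) - \<chi> [br a b]"])
           (simp_all add: br_add_left br_add_right br_scale_left br_scale_right l.add l.scale l.zero br_self
             scale_right_diff_distrib)
    qed
    have zero: "\<zero>\<^bsub>cochains sc 2\<^esub> = coboundary_map sc br 1 \<zero>\<^bsub>cochains sc 1\<^esub>"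
      unfolding coboundary_map_1_eq using br_add_right[of _ 0 0] by (simp add: cochains_def fun_eq_iff)
    show "\<zero>\<^bsub>cochains sc 2\<^esub> \<in> coboundaries sc br 2"
      unfolding coboundaries_2 zero by (intro imageI V1.M.zero_closed)
    fix u assume "u \<in> coboundaries sc br 2"
    then obtain \<chi> where \<chi>: "\<chi> \<in> carrier (cochains sc 1)" "u = coboundary_map sc br 1 \<chi>"
      unfolding coboundaries_2 by blast
    have smult: "c \<odot>\<^bsub>cochains sc 2\<^esub> u = coboundary_map sc br 1 (c \<odot>\<^bsub>cochains sc 1\<^esub> \<chi>)" for c
      unfolding \<chi>(2) coboundary_map_1_eq
      by (simp add: cochains_def fun_eq_iff br_scale_right scale_right_diff_distrib)
    show "c \<odot>\<^bsub>cochains sc 2\<^esub> u \<in> coboundaries sc br 2" for c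
      unfolding coboundaries_2 smult using \<chi>(1) by (intro imageI V1.smult_in)
    fix v assume "v \<in> coboundaries sc br 2"
    then obtain \<zeta> where \<zeta>: "\<zeta> \<in> carrier (cochains sc 1)" "v = coboundary_map sc br 1 \<zeta>"
      unfolding coboundaries_2 by blast
    have add: "u \<oplus>\<^bsub>cochains sc 2\<^esub> v = coboundary_map sc br 1 (\<chi> \<oplus>\<^bsub>cochains sc 1\<^esub> \<zeta>)"
      unfolding \<chi>(2) \<zeta>(2) coboundary_map_1_eq
      by (simp add: cochains_def fun_eq_iff br_add_right algebra_simps)
    show "u \<oplus>\<^bsub>cochains sc 2\<^esub> v \<in> coboundaries sc br 2"
      unfolding coboundaries_2 add using \<chi>(1) \<zeta>(1) by (intro imageI V1.M.a_closed)
  qed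
qed

lemma subspace_cocycles_2:
  "submodule (cocycles sc br 2) (ring_of_type_algebra :: 'k ring) (cochains sc 2)"
proof -
  interpret V: vector_module "cochains sc 2" by (rule vector_module_cochains)
  have sub: "cocycles sc br 2 = {\<chi> \<in> carrier (cochains sc 2). \<forall>a b c. coboundary_map sc br 2 \<chi> [a, b, c] = 0}"
  proof (intro equalityI subsetI)
    fix \<chi> assume \<chi>: "\<chi> \<in> {\<chi> \<in> carrier (cochains sc 2). \<forall>a b c. coboundary_map sc br 2 \<chi> [a, b, c] = 0}"
    have "coboundary_map sc br 2 \<chi> xs = 0" for xs
    proof (cases "length xs = 3")
      case True
      then obtain a b c where "xs = [a, b, c]" by (auto simp: length_Suc_conv numeral_3_eq_3)
      then show ?thesis using \<chi> by simp
    qed (rule coboundary_map_2)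
    then show "\<chi> \<in> cocycles sc br 2" using \<chi> by (auto simp: cocycles_def)
  qed (auto simp: cocycles_def)
  show ?thesis
    unfolding sub coboundary_map_2
  proof (rule V.subspaceI, goal_cases)
    case 2
    show ?case using br_add_right[of _ 0 0] V.M.zero_closed by (simp add: cochains_def)
  next
    case (3 \<chi> \<zeta>)
    then have "\<chi> \<oplus>\<^bsub>cochains sc 2\<^esub> \<zeta> \<in> carrier (cochains sc 2)" by simp
    moreover have "br a ((\<chi> \<oplus>\<^bsub>cochains sc 2\<^esub> \<zeta>) [b, c]) - br b ((\<chi> \<oplus>\<^bsub>cochains sc 2\<^esub> \<zeta>) [a, c]) + br c ((\<chi> \<oplus>\<^bsub>cochains sc 2\<^esub> \<zeta>) [a, b])
     - (\<chi> \<oplus>\<^bsub>cochains sc 2\<^esub> \<zeta>) [br a b, c] + (\<chi> \<oplus>\<^bsub>cochains sc 2\<^esub> \<zeta>) [br a c, b] - (\<chi> \<oplus>\<^bsub>cochains sc 2\<^esub> \<zeta>) [br b c, a] =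
     (br a (\<chi> [b, c]) - br b (\<chi> [a, c]) + br c (\<chi> [a, b]) - \<chi> [br a b, c] + \<chi> [br a c, b] - \<chi> [br b c, a]) +
     (br a (\<zeta> [b, c]) - br b (\<zeta> [a, c]) + br c (\<zeta> [a, b]) - \<zeta> [br a b, c] + \<zeta> [br a c, b] - \<zeta> [br b c, a])" for a b c
      by (simp add: cochains_def br_add_right)
    ultimately show ?case using 3 by simp
  next
    case (4 k \<chi>)
    then have "k \<odot>\<^bsub>cochains sc 2\<^esub> \<chi> \<in> carrier (cochains sc 2)" by simp
    moreover have "br a ((k \<odot>\<^bsub>cochains sc 2\<^esub> \<chi>) [b, c]) - br b ((k \<odot>\<^bsub>cochains sc 2\<^esub> \<chi>) [a, c]) + br c ((k \<odot>\<^bsub>cochains sc 2\<^esub> \<chi>) [a, b])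
     - (k \<odot>\<^bsub>cochains sc 2\<^esub> \<chi>) [br a b, c] + (k \<odot>\<^bsub>cochains sc 2\<^esub> \<chi>) [br a c, b] - (k \<odot>\<^bsub>cochains sc 2\<^esub> \<chi>) [br b c, a] =
     sc k (br a (\<chi> [b, c]) - br b (\<chi> [a, c]) + br c (\<chi> [a, b]) - \<chi> [br a b, c] + \<chi> [br a c, b] - \<chi> [br b c, a])" for a b c
      by (simp add: cochains_def br_scale_right scale_right_distrib scale_right_diff_distrib)
    ultimately show ?case using 4 by simp
  qed auto
qed

text \<open>\<open>cocycle2\<close> has cyclic terms where \<open>coboundary_map\<close> has
  alternating signs; antisymmetry of \<open>br\<close> and of \<open>\<phi>\<close> turns one
  expression into the other.\<close>

lemma cocycle2_imp_cocycles:
  assumes \<phi>: "cocycle2 \<phi>"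
  shows "(\<lambda>xs. if length xs = 2 then \<phi> (xs ! 0) (xs ! 1) else 0) \<in> cocycles sc br 2" (is "?\<Phi> \<in> _")
proof -
  have add: "\<phi> (x + y) z = \<phi> x z + \<phi> y z" "\<phi> x (y + z) = \<phi> x y + \<phi> x z"
    and scale: "\<phi> (sc c x) y = sc c (\<phi> x y)" "\<phi> x (sc c y) = sc c (\<phi> x y)"
    and self: "\<phi> x x = 0"
    and coc: "br x (\<phi> y z) + \<phi> x (br y z) + (br y (\<phi> z x) + \<phi> y (br z x)) + (br z (\<phi> x y) + \<phi> z (br x y)) = 0"
    for x y z c
    using \<phi> unfolding cocycle2_def by blast+
  have neg: "br x (- y) = - br x y" for x y
    using br_add_right[of x y "- y"] br_add_right[of x 0 0] by (simp add: eq_neg_iff_add_eq_0 add.commute)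
  have neg': "\<phi> x (- y) = - \<phi> x y" for x y
    using add(2)[of x y "- y"] add(2)[of x 0 0] by (simp add: eq_neg_iff_add_eq_0 add.commute)
  have "coboundary_map sc br 2 ?\<Phi> [a, b, c] = 0" for a b c
  proof -
    have "coboundary_map sc br 2 ?\<Phi> [a, b, c] =
        br a (\<phi> b c) - br b (\<phi> a c) + br c (\<phi> a b) - \<phi> (br a b) c + \<phi> (br a c) b - \<phi> (br b c) a"
      unfolding coboundary_map_2 by simp
    also have "\<dots> = br a (\<phi> b c) + \<phi> a (br b c) + (br b (\<phi> c a) + \<phi> b (br c a)) + (br c (\<phi> a b) + \<phi> c (br a b))"
      using cocycle2_anti[OF \<phi>, of a c] cocycle2_anti[OF \<phi>, of "br a b" c] cocycle2_anti[OF \<phi>, of "br a c" b]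
        cocycle2_anti[OF \<phi>, of "br b c" a] br_anti[of a c] by (simp add: neg neg')
    also have "\<dots> = 0" by (rule coc)
    finally show ?thesis .
  qed
  then have "coboundary_map sc br 2 ?\<Phi> xs = 0" for xs
  proof (cases "length xs = 3")
    case True
    then obtain a b c where "xs = [a, b, c]" by (auto simp: length_Suc_conv numeral_3_eq_3)
    then show ?thesis using \<open>\<And>a b c. coboundary_map sc br 2 ?\<Phi> [a, b, c] = 0\<close> by simp
  qed (rule coboundary_map_2)
  moreover have "?\<Phi> \<in> carrier (cochains sc 2)" by (rule cochains_2I) (rule add scale self)+
  ultimately show ?thesis unfolding cocycles_def by blast
qed

end

text \<open>With more cotangent directions than elements of \<open>S\<close>, the classes of the
  cocycles of the unit tangent vectors would be linearly dependent. The dependence is a nonzero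
  tangent vector whose cocycle is a coboundary, which \<open>cotangent_injective\<close>
  excludes.\<close>

lemma (in deformed_lie) card_cotangent_le:
  assumes mini: "miniversal sc br B \<eta>" and fin: "finite_dimensional (cohomology sc br 2)"
    and S: "is_basis (dual (cohomology sc br 2)) S"
  shows "card E \<le> card S"
proof (rule ccontr)
  let ?V = "cochains sc 2" and ?H = "cohomology sc br 2"
  let ?Z = "cocycles sc br 2" and ?W = "coboundaries sc br 2"
  assume "\<not> card E \<le> card S"
  interpret V: vector_module ?V by (rule vector_module_cochains)
  note W = subspace_coboundaries_2 and Z = subspace_cocycles_2
  have H_eq: "?H = subquotient ?V ?Z ?W" by (simp add: cohomology_def)
  interpret H: vector_module ?H unfolding H_eq by (rule V.vector_module_subquotient[OF Z W])
  have S_D: "S \<subseteq> carrier (dual ?H)" using S by (simp add: is_basis_def)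
  define \<phi>1 where "\<phi>1 e = \<phi> (\<lambda>e'. if e' = e then 1 else 0)" for e
  define \<Phi> where "\<Phi> e = (\<lambda>xs. if length xs = 2 then \<phi>1 e (xs ! 0) (xs ! 1) else 0)" for e
  have \<Phi>: "\<Phi> e \<in> ?Z" for e unfolding \<Phi>_def \<phi>1_def by (rule cocycle2_imp_cocycles[OF cocycle2_\<phi>])
  have \<Phi>V: "\<Phi> e \<in> carrier ?V" for e using \<Phi> by (auto simp: cocycles_def)
  define h where "h e = ?W +>\<^bsub>?V\<^esub> \<Phi> e" for e
  have h: "h e \<in> carrier ?H" for e
    unfolding h_def H_eq V.subquotient_simps by (rule imageI[OF \<Phi>])
  have finS: "finite S" by (rule H.dual_basis_finite[OF fin S])
  \<comment> \<open>One equation for each \<open>\<xi>\<close> in \<open>S\<close>: the combination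
    of the classes \<open>h e\<close> is to be killed by all of \<open>S\<close>, hence to vanish in
    cohomology.\<close>
  obtain c where c: "\<exists>e\<in>E. c e \<noteq> 0" "\<forall>\<xi>\<in>S. (\<Sum>e\<in>E. c e * \<xi> (h e)) = 0"
    using homogeneous_system[OF finS B.finite_S, of "\<lambda>e \<xi>. \<xi> (h e)"] \<open>\<not> card E \<le> card S\<close> by auto
  define \<Sigma> where "\<Sigma> = finsum ?V (\<lambda>e. c e \<odot>\<^bsub>?V\<^esub> \<Phi> e) E"
  have \<Sigma>V: "\<Sigma> \<in> carrier ?V"
    unfolding \<Sigma>_def by (rule V.M.finsum_closed) (use \<Phi>V in auto)
  have sum_h: "finsum ?H (\<lambda>e. c e \<odot>\<^bsub>?H\<^esub> h e) E = ?W +>\<^bsub>?V\<^esub> \<Sigma>"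
  proof -
    have "finsum ?H (\<lambda>e. c e \<odot>\<^bsub>?H\<^esub> h e) E = finsum ?H (\<lambda>e. ?W +>\<^bsub>?V\<^esub> (c e \<odot>\<^bsub>?V\<^esub> \<Phi> e)) E"
      unfolding h_def H_eq V.subquotient_cosets(2)[OF W \<Phi>V] ..
    also have "\<dots> = ?W +>\<^bsub>?V\<^esub> \<Sigma>"
      unfolding H_eq \<Sigma>_def by (rule V.finsum_subquotient[OF Z W V.subspaceD(4)[OF Z \<Phi>]])
    finally show ?thesis .
  qed
  have "finsum ?H (\<lambda>e. c e \<odot>\<^bsub>?H\<^esub> h e) E = \<zero>\<^bsub>?H\<^esub>"
  proof (rule H.dual_basis_separates[OF fin S])
    show "finsum ?H (\<lambda>e. c e \<odot>\<^bsub>?H\<^esub> h e) E \<in> carrier ?H"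
      by (rule H.M.finsum_closed) (use h in auto)
    fix \<xi> assume \<xi>: "\<xi> \<in> S"
    then have \<xi>D: "\<xi> \<in> carrier (dual ?H)" using S_D by blast
    have "\<xi> (finsum ?H (\<lambda>e. c e \<odot>\<^bsub>?H\<^esub> h e) E) = (\<Sum>e\<in>E. \<xi> (c e \<odot>\<^bsub>?H\<^esub> h e))"
      by (rule H.dual_finsum[OF \<xi>D _ B.finite_S]) (use h in auto)
    also have "\<dots> = (\<Sum>e\<in>E. c e * \<xi> (h e))"
      by (rule sum.cong[OF refl]) (use \<xi>D h in \<open>simp add: H.dual_iff\<close>)
    finally show "\<xi> (finsum ?H (\<lambda>e. c e \<odot>\<^bsub>?H\<^esub> h e) E) = 0" using c(2) \<xi> by simp
  qed
  then have "?W +>\<^bsub>?V\<^esub> \<Sigma> = ?W" unfolding sum_h by (simp add: H_eq V.subquotient_simps)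
  then have "\<Sigma> \<in> ?W" using V.coset_self[OF W \<Sigma>V] by simp
  then obtain \<chi> where \<chi>: "\<chi> \<in> carrier (cochains sc 1)" "\<Sigma> = coboundary_map sc br 1 \<chi>"
    unfolding coboundaries_2 by blast
  \<comment> \<open>Linearity in the tangent vector identifies the combined cocycle with the cocycle
    of \<open>c\<close>, and antisymmetry brings the coboundary into the form used for
    equivalences.\<close>
  have "\<phi> c y z = br y (\<chi> [z]) + br (\<chi> [y]) z - \<chi> [br y z]" for y z
  proof -
    have "\<phi> c y z = (\<Sum>e\<in>E. sc (c e) (\<phi>1 e y z))" unfolding \<phi>1_def by (rule \<phi>_sum)
    also have "\<dots> = \<Sigma> [y, z]"
      unfolding \<Sigma>_def finsum_cochains[OF B.finite_S V.smult_in[OF \<Phi>V]] by (simp add: cochains_def \<Phi>_def)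
    also have "\<dots> = br y (\<chi> [z]) - br z (\<chi> [y]) - \<chi> [br y z]" unfolding \<chi>(2) by (rule coboundary_map_1)
    finally show ?thesis using br_anti[of "\<chi> [y]" z] by simp
  qed
  from cotangent_injective[OF mini cochains_1_linear[OF \<chi>(1)] this] have "c e = 0" if "e \<in> E" for e
    using that .
  with c(1) show False by blast
qed

theorem theorem4p6:
  fixes sc :: "'k::field_char_0 \<Rightarrow> 'l::ab_group_add \<Rightarrow> 'l"
    and br :: "'l \<Rightarrow> 'l \<Rightarrow> 'l"
    and C :: "('k, 'c) module"
    and \<eta> :: "('k, 'c, 'l) ctensor \<Rightarrow> ('k, 'c, 'l) ctensor \<Rightarrow> ('k, 'c, 'l) ctensor"
    and S :: "(('l list \<Rightarrow> 'l) set \<Rightarrow> 'k) set"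
  assumes "lie_algebra sc br"
    and "finite_dimensional (cohomology sc br 2)"
    and "miniversal sc br C \<eta>"
    and "is_basis (dual (cohomology sc br 2)) S"
  shows "\<exists>I. finitely_generated_ideal I (power_series S :: ('k, _) module) \<and>
             algebra_isomorphic C (quot_algebra (power_series S) I)"
proof -
  have C: "complete_local_base C" and \<eta>: "formal_deformation sc br C \<eta>"
    using assms(3) unfolding miniversal_def by blast+
  interpret L: lie_algebra sc br by (rule assms(1))
  interpret D: dual_lie sc br by (rule dual_lieI[OF assms(1)])
  interpret C: local_base C by (rule complete_local_base_imp_local_base[OF C])
  obtain E :: "'c set set" and t and x :: "'c set \<Rightarrow> 'c \<Rightarrow> 'k"
    where finE: "finite E" and t: "\<And>e. e \<in> E \<Longrightarrow> t e \<in> C.P 1"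
    and span: "\<And>a. a \<in> C.P 1 \<Longrightarrow> C.cg 2 a (\<Oplus>\<^bsub>C\<^esub>e\<in>E. x e a \<odot>\<^bsub>C\<^esub> t e)"
    and x: "\<And>e a b. e \<in> E \<Longrightarrow> a \<in> C.P 1 \<Longrightarrow> b \<in> C.P 1 \<Longrightarrow> x e (a \<oplus>\<^bsub>C\<^esub> b) = x e a + x e b"
    "\<And>e a c. e \<in> E \<Longrightarrow> a \<in> C.P 1 \<Longrightarrow> x e (c \<odot>\<^bsub>C\<^esub> a) = c * x e a"
    "\<And>e a. e \<in> E \<Longrightarrow> a \<in> C.P 2 \<Longrightarrow> x e a = 0"
    "\<And>e e'. e \<in> E \<Longrightarrow> e' \<in> E \<Longrightarrow> x e (t e') = (if e = e' then 1 else 0)"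
    by (rule C.cotangent_basis) (rule that; assumption)
  interpret C: generated_base C E t
    by (intro C.generated_baseI[OF finE t] exI) (assumption | erule span)+
  interpret deformed_lie C E t sc x br \<eta>
    by unfold_locales (fact x \<eta>)+
  have card: "card E \<le> card S" by (rule card_cotangent_le[OF assms(3,2,4)])
  have finS: "finite S"
  proof -
    interpret H: vector_module "cohomology sc br 2"
      unfolding cohomology_def
      by (rule vector_module.vector_module_subquotient[OF L.vector_module_cochains
            L.subspace_cocycles_2 L.subspace_coboundaries_2])
    show ?thesis by (rule H.dual_basis_finite[OF assms(2,4)])
  qed
  \<comment> \<open>Only the cardinalities matter, so any injection of the cotangent basis into
    \<open>S\<close> will do.\<close>
  obtain k where k: "k ` E \<subseteq> S" "inj_on k E" using card_le_inj[OF finE finS card] by blast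
  \<comment> \<open>The generators are re-indexed by \<open>S\<close>, so that the power series get
    the prescribed variables; variables outside the image of \<open>k\<close> are evaluated at
    \<open>0\<close>.\<close>
  define t' where "t' s = (if s \<in> k ` E then t (inv_into E k s) else \<zero>\<^bsub>C\<^esub>)" for s
  have t'k: "t' (k e) = t e" if "e \<in> E" for e using k(2) that by (simp add: t'_def)
  interpret S: generated_base C S t'
  proof (rule C.generated_baseI[OF finS])
    show t'P: "t' s \<in> C.P 1" for s
      using t C.P_subspaceD(2) k(2) by (auto simp: t'_def)
    fix a assume a: "a \<in> C.P 1"
    define c where "c s = x (inv_into E k s) a" for s
    have tc: "t' s \<in> carrier C" for s by (rule C.P_carrier[OF t'P])
    have "(\<Oplus>\<^bsub>C\<^esub>s\<in>S. c s \<odot>\<^bsub>C\<^esub> t' s) = (\<Oplus>\<^bsub>C\<^esub>s\<in>k ` E. c s \<odot>\<^bsub>C\<^esub> t' s)"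
      by (rule C.A.add.finprod_mono_neutral_cong_right) (use finS k(1) tc in \<open>auto simp: t'_def\<close>)
    also have "\<dots> = (\<Oplus>\<^bsub>C\<^esub>e\<in>E. c (k e) \<odot>\<^bsub>C\<^esub> t' (k e))"
      by (rule C.A.finsum_reindex) (use tc k(2) in auto)
    also have "\<dots> = (\<Oplus>\<^bsub>C\<^esub>e\<in>E. x e a \<odot>\<^bsub>C\<^esub> t e)"
      by (rule C.A.finsum_cong') (use k(2) t'k C.t_carrier in \<open>auto simp: c_def\<close>)
    finally show "\<exists>c. C.cg 2 a (\<Oplus>\<^bsub>C\<^esub>s\<in>S. c s \<odot>\<^bsub>C\<^esub> t' s)" using span[OF a] by metis
  qed
  show ?thesis by (rule S.isomorphic_quotient_power_series)
qed

end
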